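(* Let $M$ be Minkowski space, $\mathcal{H}$ a complex Hilbert space, and $a\mapsto U(a)$ a strongly continuous unitary representation on $\mathcal{H}$ of the translation group of $M$ such that for every future-directed timelike unit vector $a$ the generator $H(a)$ of the one-parameter group $t\mapsto U(ta)$ is bounded below (spectrum condition). Fix a family $\mathcal{S}$ of parallel spacelike hyperplanes foliating $M$ (so $S\in\mathcal{S}$ implies $S+a\in\mathcal{S}$ for all $a\in M$), and for each $S\in\mathcal{S}$ a family $\mathcal{F}(S)$ of subsets of $S$ ("spatial sets") that contains a covering family of bounded subsets of $S$ and such that $\mathcal{F}(S+a)=\{\Delta+a:\Delta\in\mathcal{F}(S)\}$ for all $a\in M$. Let $\Delta\mapsto E_\Delta$ be a map assigning to each spatial set $\Delta\in\bigcup_{S\in\mathcal{S}}\mathcal{F}(S)$ an effect $E_\Delta$ on $\mathcal{H}$ (not necessarily a projection), satisfying: (1) Translation covariance: $U(a)E_\Delta U(a)^{*}=E_{\Delta+a}$ for all $a\in M$ and all spatial sets $\Delta$; (2) Localizability: for each $S\in\mathcal{S}$ and $\Delta_1,\Delta_2\in\mathcal{F}(S)$ with $\Delta_1\cap\Delta_2=\emptyset$, one has $E_{\Delta_1}E_{\Delta_2}=E_{\Delta_2}E_{\Delta_1}=0$; (3) Local commutativity: for $S_1,S_2\in\mathcal{S}$, $\Delta_1\in\mathcal{F}(S_1)$, $\Delta_2\in\mathcal{F}(S_2)$ spacelike separated, one has $E_{\Delta_1}E_{\Delta_2}=E_{\Delta_2}E_{\Delta_1}$. Then $E_\Delta=0$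 for every bounded spatial set $\Delta$.
   Context: An effect is a bounded operator $E$ on $\mathcal{H}$ with $0\le E\le I$. Two subsets $\Delta_1,\Delta_2\subset M$ are spacelike separated if $x-y$ is a spacelike vector for every $x\in\Delta_1$, $y\in\Delta_2$. A subset of a hyperplane $S$ is bounded if it is bounded in the Euclidean metric induced on $S$. *)

theory Defs
  imports "HOL-Analysis.Analysis"
begin

text \<open>Inner product is conjugate-linear in the first and linear in the second argument
  (physics convention).\<close>

class complex_hilbert = ab_group_add +
  fixes scaleC :: "complex \<Rightarrow> 'a \<Rightarrow> 'a" (infixr "*\<^sub>C" 75)
    and cinner :: "'a \<Rightarrow> 'a \<Rightarrow> complex"
  assumes scaleC_add_right: "c *\<^sub>C (x + y) = c *\<^sub>C x + c *\<^sub>C y"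
    and scaleC_add_left: "(c + d) *\<^sub>C x = c *\<^sub>C x + d *\<^sub>C x"
    and scaleC_scaleC: "c *\<^sub>C (d *\<^sub>C x) = (c * d) *\<^sub>C x"
    and scaleC_one: "1 *\<^sub>C x = x"
    and cinner_conj: "cinner x y = cnj (cinner y x)"
    and cinner_add_right: "cinner x (y + z) = cinner x y + cinner x z"
    and cinner_scaleC_right: "cinner x (c *\<^sub>C y) = c * cinner x y"
    and cinner_pos: "0 \<le> Re (cinner x x)"
    and cinner_eq_zero: "cinner x x = 0 \<longleftrightarrow> x = 0"
    and complete: "(\<forall>e>0. \<exists>N. \<forall>m\<ge>N. \<forall>n\<ge>N. sqrt (Re (cinner (X m - X n) (X m - X n))) < e)
        \<Longrightarrow> \<exists>L. (\<lambda>n. sqrt (Re (cinner (X n - L) (X n - L)))) \<longlonglongrightarrow> 0"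

definition cnorm :: "'a::complex_hilbert \<Rightarrow> real" where
  "cnorm x = sqrt (Re (cinner x x))"

definition clinear :: "('a::complex_hilbert \<Rightarrow> 'a) \<Rightarrow> bool" where
  "clinear T \<longleftrightarrow> (\<forall>x y. T (x + y) = T x + T y) \<and> (\<forall>c x. T (c *\<^sub>C x) = c *\<^sub>C T x)"

definition bounded_op :: "('a::complex_hilbert \<Rightarrow> 'a) \<Rightarrow> bool" where
  "bounded_op T \<longleftrightarrow> clinear T \<and> (\<exists>K. \<forall>x. cnorm (T x) \<le> K * cnorm x)"

text \<open>The adjoint of an operator (well defined for bounded operators by Riesz).\<close>
definition cadjoint :: "('a::complex_hilbert \<Rightarrow> 'a) \<Rightarrow> ('a \<Rightarrow> 'a)" where
  "cadjoint T = (\<lambda>y. THE z. \<forall>x. cinner (T x) y = cinner x z)"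

definition unitary_op :: "('a::complex_hilbert \<Rightarrow> 'a) \<Rightarrow> bool" where
  "unitary_op U \<longleftrightarrow> bounded_op U \<and> surj U \<and> (\<forall>x y. cinner (U x) (U y) = cinner x y)"

definition effect :: "('a::complex_hilbert \<Rightarrow> 'a) \<Rightarrow> bool" where
  "effect E \<longleftrightarrow> bounded_op E \<and>
     (\<forall>x. Im (cinner x (E x)) = 0 \<and> 0 \<le> Re (cinner x (E x)) \<and> Re (cinner x (E x)) \<le> Re (cinner x x))"

text \<open>Minkowski space: time coordinate times three space coordinates, signature (+,-,-,-).\<close>
type_synonym mink = "real \<times> (real^3)"

definition mink_prod :: "mink \<Rightarrow> mink \<Rightarrow> real" where
  "mink_prod x y = fst x * fst y - snd x \<bullet> snd y"

definition spacelike :: "mink \<Rightarrow> bool" where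
  "spacelike v \<longleftrightarrow> mink_prod v v < 0"

definition timelike :: "mink \<Rightarrow> bool" where
  "timelike v \<longleftrightarrow> mink_prod v v > 0"

definition spacelike_separated :: "mink set \<Rightarrow> mink set \<Rightarrow> bool" where
  "spacelike_separated A B \<longleftrightarrow> (\<forall>x\<in>A. \<forall>y\<in>B. spacelike (x - y))"

text \<open>The foliation of M by the parallel spacelike hyperplanes with timelike normal n.\<close>
definition hyperplanes :: "mink \<Rightarrow> mink set set" where
  "hyperplanes n = range (\<lambda>c. {x. mink_prod n x = c})"

definition translate :: "mink set \<Rightarrow> mink \<Rightarrow> mink set" where
  "translate A a = (\<lambda>x. x + a) ` A"

definition unitary_rep :: "(mink \<Rightarrow> 'a::complex_hilbert \<Rightarrow> 'a) \<Rightarrow> bool" where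
  "unitary_rep U \<longleftrightarrow> (\<forall>a. unitary_op (U a)) \<and> U 0 = id \<and> (\<forall>a b. U (a + b) = U a \<circ> U b)"

definition strongly_continuous :: "(mink \<Rightarrow> 'a::complex_hilbert \<Rightarrow> 'a) \<Rightarrow> bool" where
  "strongly_continuous U \<longleftrightarrow>
     (\<forall>x a0. \<forall>e>0. \<exists>d>0. \<forall>a. norm (a - a0) < d \<longrightarrow> cnorm (U a x - U a0 x) < e)"

text \<open>The generator H of t \<mapsto> U(t a), with U(t a) = exp(i t H):
  gen_at U a \<psi> \<phi> means \<psi> is in the domain of H(a) and H(a) \<psi> = \<phi>.\<close>
definition gen_at :: "(mink \<Rightarrow> 'a::complex_hilbert \<Rightarrow> 'a) \<Rightarrow> mink \<Rightarrow> 'a \<Rightarrow> 'a \<Rightarrow> bool" where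
  "gen_at U a \<psi> \<phi> \<longleftrightarrow>
     ((\<lambda>t. cnorm ((1 / (\<i> * complex_of_real t)) *\<^sub>C (U (t *\<^sub>R a) \<psi> - \<psi>) - \<phi>)) \<longlongrightarrow> 0) (at (0::real))"

definition generator_bounded_below :: "(mink \<Rightarrow> 'a::complex_hilbert \<Rightarrow> 'a) \<Rightarrow> mink \<Rightarrow> bool" where
  "generator_bounded_below U a \<longleftrightarrow>
     (\<exists>c. \<forall>\<psi> \<phi>. gen_at U a \<psi> \<phi> \<longrightarrow> c * (cnorm \<psi>)\<^sup>2 \<le> Re (cinner \<psi> \<phi>))"

definition spectrum_condition :: "(mink \<Rightarrow> 'a::complex_hilbert \<Rightarrow> 'a) \<Rightarrow> bool" where
  "spectrum_condition U \<longleftrightarrow>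
     (\<forall>a. fst a > 0 \<and> mink_prod a a = 1 \<longrightarrow> generator_bounded_below U a)"

end

theory Submission
  imports Defs "HOL-Complex_Analysis.Complex_Analysis" "HOL-Probability.Sinc_Integral"
begin

text \<open>For a positive generator the group \<open>V t\<close> extends to a holomorphic family of contractions
  \<open>T z\<close> on the upper half plane, namely the Poisson integral of the orbits; its \<open>z\<close>-bar derivative is a
  multiple of \<open>\<integral> V t y / (t - w)\<^sup>2 dt\<close> with \<open>Im w < 0\<close>, which positivity forces to vanish.

  If \<open>A B = 0\<close> and \<open>A\<close> commutes with \<open>B t = V t B V (-t)\<close> for small \<open>t\<close>, consider a matrix element of
  \<open>A B(t\<^sub>0) \<dots> B(t\<^sub>m)\<close> at \<open>t\<^sub>k = z + i k \<eta>\<close>. Every factor can be continued provided \<open>A\<close> stands between the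
  factors with negative and those with positive imaginary part, and commutation allows \<open>A\<close> to be moved across a
  factor exactly when its argument is real. The resulting function is holomorphic near 0, bounded independently
  of \<open>m\<close>, and has \<open>m + 1\<close> zeros close to 0, so the Schwarz lemma gives the bound \<open>(|t| / r)\<^sup>m\<^sup>+\<^sup>1\<close>. With
  \<open>1 - (1 - B)\<^sup>N\<close> in the slots this yields \<open>A B t = 0\<close> for small \<open>t\<close>, hence for all \<open>t\<close>.

  In Minkowski space, take a translate \<open>\<Delta> + a\<close> within the hyperplane far away from \<open>\<Delta>\<close>. Then
  \<open>E \<Delta> E (\<Delta> + a + v) = 0\<close> for every timelike \<open>v\<close>. As \<open>-a\<close> is a sum of two timelike vectors,
  a second continuation reaches \<open>E \<Delta> E \<Delta> = 0\<close>.\<close>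

text \<open>The group continues only upwards, so a product of translated factors continues only if
  the gaps between neighbouring arguments have nonnegative imaginary part; hence the heights k *
  \<eta> increase. The outer ends would demand opposite signs of Im z. They are therefore padded
  with \<open>T (\<i> * of_real \<rho>)\<close>, which is injective with dense range and can be
  stripped off at the end. For a projection every slot could hold \<open>B\<close> itself. The
  powers of an effect may tend to 0, which would make a small bound on them worthless. The slots 1 -
  (1 - B)^N repair this: \<open>B\<close> times a fixed power of them converges strongly to
  \<open>B\<close> as N grows, so the bound passes to \<open>B\<close> alone. A timelike translate
  of a nonempty \<Delta> is never spacelike separated from \<Delta>, so commutation is available
  only around a distant \<Delta> + a. Positivity in turn is available only along timelike vectors,
  so the way back along the spacelike -a needs two legs. The second leg uses no commutation:
  vanishing is already known on an open cone and is merely continued.\<close>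

section \<open>Complex Hilbert spaces\<close>

text \<open>Limits, derivatives and integrals run on type-class topology, so the complex inner
  product is tied to a real one; \<open>cnorm\<close> then becomes the ordinary norm.\<close>

class chilbert = complex_hilbert + real_inner + complete_space +
  assumes inner_eq_Re_cinner: "inner x y = Re (cinner x y)"
    and scaleR_eq_scaleC: "r *\<^sub>R x = complex_of_real r *\<^sub>C x"

lemma cnorm_eq_norm: "cnorm (x :: 'a::chilbert) = norm x"
  by (simp add: cnorm_def norm_eq_sqrt_inner inner_eq_Re_cinner)

context complex_hilbert
begin

lemma scaleC_zero_left [simp]: "scaleC 0 x = 0"
  using scaleC_add_left[of 0 0 x] by simp

lemma scaleC_zero_right [simp]: "scaleC c 0 = 0"
  using scaleC_add_right[of c 0 0] by simp

lemma scaleC_diff_right: "scaleC c (x - y) = scaleC c x - scaleC c y"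
  using scaleC_add_right[of c "x - y" y] by (simp add: algebra_simps)

lemma scaleC_diff_left: "scaleC (c - d) x = scaleC c x - scaleC d x"
  using scaleC_add_left[of "c - d" d x] by (simp add: algebra_simps)

lemma cinner_zero_right [simp]: "cinner x 0 = 0"
  using cinner_add_right[of x 0 0] by simp

lemma cinner_zero_left [simp]: "cinner 0 x = 0"
  by (metis cinner_zero_right cinner_conj complex_cnj_zero)

lemma cinner_add_left: "cinner (x + y) z = cinner x z + cinner y z"
  by (metis cinner_add_right cinner_conj complex_cnj_add)

lemma cinner_diff_right: "cinner x (y - z) = cinner x y - cinner x z"
  using cinner_add_right[of x "y - z" z] by (simp add: algebra_simps)

lemma cinner_diff_left: "cinner (x - y) z = cinner x z - cinner y z"
  using cinner_add_left[of "x - y" y z] by (simp add: algebra_simps)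

lemma cinner_scaleC_left: "cinner (scaleC c x) y = cnj c * cinner x y"
  by (metis cinner_scaleC_right cinner_conj complex_cnj_mult complex_cnj_cnj)

lemma Im_cinner_self [simp]: "Im (cinner x x) = 0"
  using cinner_conj[of x x] by (metis Reals_cnj_iff complex_is_Real_iff)

lemma cinner_ext: "(\<And>x. cinner x y = cinner x z) \<Longrightarrow> y = z"
  using cinner_eq_zero[of "y - z"] by (simp add: cinner_diff_right)

end

text \<open>The class of the given Hilbert spaces carries no topology; this copy of the type does.\<close>

typedef (overloaded) 'a hilb = "UNIV :: 'a::complex_hilbert set"
  morphisms of_hilb to_hilb ..

setup_lifting type_definition_hilb

instantiation hilb :: (complex_hilbert) real_inner
begin

lift_definition zero_hilb :: "'a hilb" is 0 .
lift_definition plus_hilb :: "'a hilb \<Rightarrow> 'a hilb \<Rightarrow> 'a hilb" is "(+)" .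
lift_definition minus_hilb :: "'a hilb \<Rightarrow> 'a hilb \<Rightarrow> 'a hilb" is "(-)" .
lift_definition uminus_hilb :: "'a hilb \<Rightarrow> 'a hilb" is "uminus" .
lift_definition scaleR_hilb :: "real \<Rightarrow> 'a hilb \<Rightarrow> 'a hilb" is "\<lambda>r. scaleC (complex_of_real r)" .
lift_definition inner_hilb :: "'a hilb \<Rightarrow> 'a hilb \<Rightarrow> real" is "\<lambda>x y. Re (cinner x y)" .
lift_definition norm_hilb :: "'a hilb \<Rightarrow> real" is "\<lambda>x. sqrt (Re (cinner x x))" .
definition dist_hilb :: "'a hilb \<Rightarrow> 'a hilb \<Rightarrow> real" where "dist_hilb x y = norm (x - y)"
definition sgn_hilb :: "'a hilb \<Rightarrow> 'a hilb" where "sgn_hilb x = inverse (norm x) *\<^sub>R x"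
definition uniformity_hilb :: "('a hilb \<times> 'a hilb) filter" where
  "uniformity_hilb = (INF e\<in>{0<..}. principal {(x, y). dist x y < e})"
definition open_hilb :: "'a hilb set \<Rightarrow> bool" where
  "open_hilb S \<longleftrightarrow> (\<forall>x\<in>S. \<forall>\<^sub>F (x', y) in uniformity. x' = x \<longrightarrow> y \<in> S)"

instance
proof
  fix x y z :: "'a hilb" and a b :: real
  show "x + y + z = x + (y + z)" by transfer (simp add: add.assoc)
  show "x + y = y + x" by transfer (simp add: add.commute)
  show "0 + x = x" by transfer simp
  show "- x + x = 0" by transfer simp
  show "x - y = x + - y" by transfer simp
  show "a *\<^sub>R (x + y) = a *\<^sub>R x + a *\<^sub>R y" by transfer (simp add: scaleC_add_right)
  show "(a + b) *\<^sub>R x = a *\<^sub>R x + b *\<^sub>R x" by transfer (simp add: scaleC_add_left)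
  show "a *\<^sub>R b *\<^sub>R x = (a * b) *\<^sub>R x" by transfer (simp add: scaleC_scaleC)
  show "1 *\<^sub>R x = x" by transfer (simp add: scaleC_one)
  show "sgn x = inverse (norm x) *\<^sub>R x" by (rule sgn_hilb_def)
  show "dist x y = norm (x - y)" by (rule dist_hilb_def)
  show "uniformity = (INF e\<in>{0<..}. principal {(x :: 'a hilb, y). dist x y < e})"
    by (rule uniformity_hilb_def)
  show "open S \<longleftrightarrow> (\<forall>x\<in>S. \<forall>\<^sub>F (x', y) in uniformity. x' = x \<longrightarrow> y \<in> S)" for S :: "'a hilb set"
    by (rule open_hilb_def)
  show "inner x y = inner y x" by transfer (subst cinner_conj, simp)
  show "inner (x + y) z = inner x z + inner y z" by transfer (simp add: cinner_add_left)
  show "inner (a *\<^sub>R x) y = a * inner x y" by transfer (simp add: cinner_scaleC_left)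
  show "0 \<le> inner x x" by transfer (rule cinner_pos)
  show "inner x x = 0 \<longleftrightarrow> x = 0"
    by transfer (simp add: complex_eq_iff flip: cinner_eq_zero)
  show "norm x = sqrt (inner x x)" by transfer simp
qed

end

instantiation hilb :: (complex_hilbert) complex_hilbert
begin

lift_definition scaleC_hilb :: "complex \<Rightarrow> 'a hilb \<Rightarrow> 'a hilb" is scaleC .
lift_definition cinner_hilb :: "'a hilb \<Rightarrow> 'a hilb \<Rightarrow> complex" is "cinner" .

instance
proof
  fix x y z :: "'a hilb" and c d :: complex and X :: "nat \<Rightarrow> 'a hilb"
  show "c *\<^sub>C (x + y) = c *\<^sub>C x + c *\<^sub>C y" by transfer (rule scaleC_add_right)
  show "(c + d) *\<^sub>C x = c *\<^sub>C x + d *\<^sub>C x" by transfer (rule scaleC_add_left)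
  show "c *\<^sub>C d *\<^sub>C x = (c * d) *\<^sub>C x" by transfer (rule scaleC_scaleC)
  show "1 *\<^sub>C x = x" by transfer (rule scaleC_one)
  show "cinner x y = cnj (cinner y x)" by transfer (rule cinner_conj)
  show "cinner x (y + z) = cinner x y + cinner x z" by transfer (rule cinner_add_right)
  show "cinner x (c *\<^sub>C y) = c * cinner x y" by transfer (rule cinner_scaleC_right)
  show "0 \<le> Re (cinner x x)" by transfer (rule cinner_pos)
  show "cinner x x = 0 \<longleftrightarrow> x = 0" by transfer (rule cinner_eq_zero)
  show "\<exists>L. (\<lambda>n. sqrt (Re (cinner (X n - L) (X n - L)))) \<longlonglongrightarrow> 0"
    if cauchy: "\<forall>e>0. \<exists>N. \<forall>m\<ge>N. \<forall>n\<ge>N. sqrt (Re (cinner (X m - X n) (X m - X n))) < e"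
  proof -
    obtain L where "(\<lambda>n. sqrt (Re (cinner (of_hilb (X n) - L) (of_hilb (X n) - L)))) \<longlonglongrightarrow> 0"
      using complete[of "\<lambda>n. of_hilb (X n)"] cauchy unfolding cinner_hilb.rep_eq minus_hilb.rep_eq by blast
    then show ?thesis
      by (intro exI[of _ "to_hilb L"]) (simp add: cinner_hilb.rep_eq minus_hilb.rep_eq to_hilb_inverse)
  qed
qed

end

lemma norm_hilb_eq: "norm (x :: 'a::complex_hilbert hilb) = sqrt (Re (cinner x x))"
  by transfer simp

instance hilb :: (complex_hilbert) complete_space
proof
  fix X :: "nat \<Rightarrow> 'a hilb"
  assume "Cauchy X"
  then have "\<forall>e>0. \<exists>N. \<forall>m\<ge>N. \<forall>n\<ge>N. sqrt (Re (cinner (X m - X n) (X m - X n))) < e"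
    unfolding Cauchy_def dist_norm norm_hilb_eq .
  then obtain L where "(\<lambda>n. norm (X n - L)) \<longlonglongrightarrow> 0"
    using complete[of X] unfolding norm_hilb_eq by blast
  then show "convergent X"
    unfolding convergent_def by (metis LIM_zero_iff tendsto_norm_zero_iff)
qed

instance hilb :: (complex_hilbert) chilbert
proof
  fix x y :: "'a hilb" and r :: real
  show "inner x y = Re (cinner x y)" by transfer simp
  show "r *\<^sub>R x = complex_of_real r *\<^sub>C x" by transfer simp
qed

section \<open>Norm estimates and joint continuity of the complex operations\<close>

lemma cinner_self: "cinner (x::'a::chilbert) x = complex_of_real ((norm x)\<^sup>2)"
  by (simp add: complex_eq_iff power2_norm_eq_inner inner_eq_Re_cinner)

lemma norm_scaleC [simp]: "norm (c *\<^sub>C (x::'a::chilbert)) = cmod c * norm x"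
proof -
  have "cinner (c *\<^sub>C x) (c *\<^sub>C x) = (c * cnj c) * cinner x x"
    by (simp add: cinner_scaleC_left cinner_scaleC_right)
  then have "complex_of_real ((norm (c *\<^sub>C x))\<^sup>2) = of_real ((cmod c * norm x)\<^sup>2)"
    unfolding cinner_self complex_norm_square[of c, symmetric] by (simp add: power_mult_distrib)
  then have "(norm (c *\<^sub>C x))\<^sup>2 = (cmod c * norm x)\<^sup>2" by (metis of_real_eq_iff)
  then show ?thesis by (simp add: power2_eq_iff_nonneg)
qed

lemma cmod_cinner_le: "cmod (cinner x (y::'a::chilbert)) \<le> norm x * norm y"
proof (cases "cinner x y = 0")
  case False
  \<comment> \<open>This phase turns \<open>cinner x y\<close> into its modulus and reduces the
    claim to the real Cauchy-Schwarz inequality.\<close>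
  define u where "u = cnj (cinner x y) / cmod (cinner x y)"
  have u: "cmod u = 1" using False by (simp add: u_def norm_divide)
  have "cinner x (u *\<^sub>C y) = of_real (cmod (cinner x y))"
    using False by (simp add: u_def cinner_scaleC_right field_simps flip: complex_norm_square power2_eq_square)
  then have "cmod (cinner x y) = inner x (u *\<^sub>C y)" by (simp add: inner_eq_Re_cinner)
  also have "\<dots> \<le> norm x * norm (u *\<^sub>C y)" by (rule norm_cauchy_schwarz)
  finally show ?thesis unfolding norm_scaleC u mult_1 .
next
  case True
  then show ?thesis by (simp only: norm_zero) (intro mult_nonneg_nonneg norm_ge_zero)
qed

lemma bounded_bilinear_cinner: "bounded_bilinear (cinner :: 'a::chilbert \<Rightarrow> 'a \<Rightarrow> complex)"
proof
  show "\<exists>K. \<forall>a b::'a. norm (cinner a b) \<le> norm a * norm b * K"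
    by (rule exI[of _ 1]) (simp add: cmod_cinner_le)
qed (simp_all add: cinner_add_left cinner_add_right scaleR_eq_scaleC cinner_scaleC_left
      cinner_scaleC_right scaleR_conv_of_real)

lemmas tendsto_cinner [tendsto_intros] = bounded_bilinear.tendsto[OF bounded_bilinear_cinner]
lemmas continuous_on_cinner [continuous_intros] = bounded_bilinear.continuous_on[OF bounded_bilinear_cinner]

lemma bounded_bilinear_scaleC: "bounded_bilinear (scaleC :: complex \<Rightarrow> 'a::chilbert \<Rightarrow> 'a)"
proof
  fix a a' :: complex and b b' :: 'a and r :: real
  show "(a + a') *\<^sub>C b = a *\<^sub>C b + a' *\<^sub>C b" by (rule scaleC_add_left)
  show "a *\<^sub>C (b + b') = a *\<^sub>C b + a *\<^sub>C b'" by (rule scaleC_add_right)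
  show "(r *\<^sub>R a) *\<^sub>C b = r *\<^sub>R a *\<^sub>C b"
    by (simp only: scaleR_eq_scaleC[where 'a='a] scaleC_scaleC scaleR_conv_of_real)
  show "a *\<^sub>C r *\<^sub>R b = r *\<^sub>R a *\<^sub>C b"
    by (simp only: scaleR_eq_scaleC[where 'a='a] scaleC_scaleC mult.commute)
  show "\<exists>K. \<forall>a (b::'a). norm (a *\<^sub>C b) \<le> norm a * norm b * K"
  proof (intro exI[of _ 1] allI)
    fix a :: complex and b :: 'a
    have "norm (a *\<^sub>C b) = cmod a * norm b" by (rule norm_scaleC)
    then show "norm (a *\<^sub>C b) \<le> norm a * norm b * 1" by linarith
  qed
qed

lemmas tendsto_scaleC [tendsto_intros] = bounded_bilinear.tendsto[OF bounded_bilinear_scaleC]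
lemmas continuous_on_scaleC [continuous_intros] = bounded_bilinear.continuous_on[OF bounded_bilinear_scaleC]

section \<open>Riesz representation by minimising a quadratic functional\<close>

lemma riesz_real:
  fixes f :: "'a::{real_inner,complete_space} \<Rightarrow> real"
  assumes "bounded_linear f"
  shows "\<exists>z. \<forall>x. f x = inner z x"
proof -
  interpret f: bounded_linear f by fact
  obtain K where K: "\<And>x. norm (f x) \<le> norm x * K" using f.bounded by blast
  \<comment> \<open>Up to a constant, \<open>J x\<close> is the squared distance from x to the
    representing vector, so the vector is sought as the minimiser.\<close>
  define J where "J x = (norm x)\<^sup>2 - 2 * f x" for x
  have J_ge: "- K\<^sup>2 \<le> J x" for x
  proof -
    have "f x \<le> norm x * K" using K[of x] by auto
    moreover have "0 \<le> (norm x - K)\<^sup>2" by simp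
    ultimately show ?thesis unfolding J_def by (simp add: power2_diff)
  qed
  define d where "d = Inf (range J)"
  have bdd: "bdd_below (range J)" using J_ge by (intro bdd_belowI[of _ "- K\<^sup>2"]) auto
  have d_le: "d \<le> J x" for x unfolding d_def by (rule cInf_lower[OF _ bdd]) simp
  have "\<exists>x. J x < d + inverse (Suc n)" for n
  proof -
    have "Inf (range J) < d + inverse (Suc n)" unfolding d_def by simp
    then show ?thesis by (subst (asm) cInf_less_iff) (use bdd in auto)
  qed
  then obtain X where X: "\<And>n. J (X n) < d + inverse (Suc n)" by metis
  \<comment> \<open>Parallelogram law: the linear part of \<open>J\<close> cancels, so
    near-minimisers lie close together and the minimising sequence is Cauchy.\<close>
  have par: "(norm (x - y))\<^sup>2 \<le> 2 * (J x - d) + 2 * (J y - d)" for x y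
  proof -
    have "(norm (x - y))\<^sup>2 = 2 * J x + 2 * J y - 4 * J ((1/2) *\<^sub>R (x + y))"
      unfolding J_def f.scaleR f.add power2_norm_eq_inner
      by (simp add: algebra_simps inner_commute)
    then show ?thesis using d_le[of "(1/2) *\<^sub>R (x + y)"] by simp
  qed
  have "Cauchy X"
  proof (rule CauchyI)
    fix e :: real assume "e > 0"
    then obtain N where N: "inverse (Suc N) < e\<^sup>2 / 4"
      using reals_Archimedean[of "e\<^sup>2 / 4"] by auto
    have "norm (X m - X n) < e" if "m \<ge> N" "n \<ge> N" for m n
    proof -
      have "inverse (real (Suc m)) \<le> inverse (Suc N)" "inverse (real (Suc n)) \<le> inverse (Suc N)"
        using that by (auto intro!: le_imp_inverse_le)
      then have "J (X m) < d + inverse (Suc N)" "J (X n) < d + inverse (Suc N)"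
        using less_le_trans[OF X[of m] add_left_mono] less_le_trans[OF X[of n] add_left_mono] by blast+
      moreover have "2 * (a - d) + 2 * (b - d) < e\<^sup>2" if "a < d + i" "b < d + i" "i < e\<^sup>2 / 4" for a b i :: real
        using that by (simp add: field_simps)
      ultimately have "2 * (J (X m) - d) + 2 * (J (X n) - d) < e\<^sup>2" using N by blast
      then have "(norm (X m - X n))\<^sup>2 < e\<^sup>2"
        using par[of "X m" "X n"] by linarith
      then show ?thesis using \<open>e > 0\<close> by (simp add: power2_less_imp_less)
    qed
    then show "\<exists>M. \<forall>m\<ge>M. \<forall>n\<ge>M. norm (X m - X n) < e" by blast
  qed
  then obtain L where L: "X \<longlonglongrightarrow> L" using Cauchy_convergent_iff convergent_def by blast
  have "(\<lambda>n. J (X n)) \<longlonglongrightarrow> J L" unfolding J_def by (intro tendsto_intros L f.tendsto)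
  moreover have "(\<lambda>n. d + inverse (Suc n)) \<longlonglongrightarrow> d + 0"
    by (intro tendsto_intros LIMSEQ_inverse_real_of_nat)
  ultimately have "J L \<le> d + 0"
    by (rule LIMSEQ_le) (use X less_imp_le in blast)
  have "f h = inner L h" for h
  proof -
    define c where "c = inner L h - f h"
    have quad: "0 \<le> t\<^sup>2 * (norm h)\<^sup>2 + 2 * t * c" for t
    proof -
      have "J (L + t *\<^sub>R h) = J L + t\<^sup>2 * (norm h)\<^sup>2 + 2 * t * c"
        unfolding J_def c_def f.add f.scaleR power2_norm_eq_inner
        by (simp add: algebra_simps inner_commute power2_eq_square)
      then show ?thesis using \<open>J L \<le> d + 0\<close> d_le[of "L + t *\<^sub>R h"] by simp
    qed
    have "c = 0"
    proof (rule ccontr)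
      assume "c \<noteq> 0"
      \<comment> \<open>A nonzero first variation would push \<open>J\<close> below its infimum. The
        exact minimiser is -c / |h|^2; the added 1 avoids division by zero and still leaves a
        negative value, as |h|^2 / (|h|^2 + 1) < 2.\<close>
      define t where "t = - c / ((norm h)\<^sup>2 + 1)"
      have pos: "(norm h)\<^sup>2 + 1 > 0" by (smt (verit) zero_le_power2)
      have "t\<^sup>2 * q + 2 * t * c = (c\<^sup>2 / p) * (q / p - 2)" if "t = - c / p" "p \<noteq> 0" for p q :: real
        unfolding that(1) using that(2) by (simp add: field_simps power2_eq_square)
      then have "t\<^sup>2 * (norm h)\<^sup>2 + 2 * t * c = (c\<^sup>2 / ((norm h)\<^sup>2 + 1)) * ((norm h)\<^sup>2 / ((norm h)\<^sup>2 + 1) - 2)"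
        using pos t_def by (metis less_irrefl)
      moreover have "(norm h)\<^sup>2 / ((norm h)\<^sup>2 + 1) - 2 < 0" using pos by (simp add: field_simps)
      moreover have "c\<^sup>2 / ((norm h)\<^sup>2 + 1) > 0" using pos \<open>c \<noteq> 0\<close> by simp
      ultimately have "t\<^sup>2 * (norm h)\<^sup>2 + 2 * t * c < 0" by (metis mult_pos_neg)
      then show False using quad[of t] by linarith
    qed
    then show ?thesis by (simp add: c_def)
  qed
  then show ?thesis by blast
qed

text \<open>A complex functional is determined by its real part through Im (f x) = - Re (f (i x)),
  so the vector representing the real part represents \<open>f\<close>.\<close>

lemma riesz:
  fixes f :: "'a::chilbert \<Rightarrow> complex"
  assumes add: "\<And>x y. f (x + y) = f x + f y" and scale: "\<And>c x. f (c *\<^sub>C x) = c * f x"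
    and bound: "\<And>x. cmod (f x) \<le> K * norm x"
  shows "\<exists>z. \<forall>x. f x = cinner z x"
proof -
  have "bounded_linear (\<lambda>x. Re (f x))"
  proof
    show "\<exists>K. \<forall>x. norm (Re (f x)) \<le> norm x * K"
      by (intro exI[of _ K] allI) (metis abs_Re_le_cmod bound mult.commute order_trans real_norm_def)
  qed (simp_all add: add scaleR_eq_scaleC scale)
  then obtain z where z: "\<And>x. Re (f x) = Re (cinner z x)"
    using riesz_real[of "\<lambda>x. Re (f x)"] unfolding inner_eq_Re_cinner by blast
  have "f x = cinner z x" for x
    using z[of x] z[of "\<i> *\<^sub>C x"] by (simp add: scale cinner_scaleC_right complex_eq_iff)
  then show ?thesis by blast
qed

section \<open>Weak integrals\<close>

definition bcont :: "(real \<Rightarrow> 'a::chilbert) \<Rightarrow> bool" where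
  "bcont v \<longleftrightarrow> continuous_on UNIV v \<and> bounded (range v)"

text \<open>A weak integral, fixed by its scalar products: only scalar Lebesgue integrals occur, and
  no separability of the Hilbert space enters. For integrable \<open>k\<close> and
  \<open>bcont v\<close> the chosen vector has the required pairings by
  \<open>cinner_wint\<close>.\<close>

definition wint :: "(real \<Rightarrow> complex) \<Rightarrow> (real \<Rightarrow> 'a) \<Rightarrow> 'a::chilbert" where
  "wint k v = (SOME z. \<forall>x. cinner x z = (LINT t|lborel. k t * cinner x (v t)))"

lemma integrable_mult_bcont:
  fixes k :: "real \<Rightarrow> complex" and f :: "real \<Rightarrow> complex"
  assumes k: "integrable lborel k" and f: "continuous_on UNIV f" "\<And>t. cmod (f t) \<le> M"
  shows "integrable lborel (\<lambda>t. k t * f t)"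
proof (rule Bochner_Integration.integrable_bound)
  show "integrable lborel (\<lambda>t. M * cmod (k t))" using k by simp
  have "f \<in> borel_measurable lborel"
    using borel_measurable_continuous_onI[OF f(1)] by simp
  then show "(\<lambda>t. k t * f t) \<in> borel_measurable lborel"
    using borel_measurable_integrable[OF k] by simp
  have "M \<ge> 0" using f(2)[of 0] norm_ge_zero order_trans by blast
  show "AE t in lborel. norm (k t * f t) \<le> norm (M * cmod (k t))"
    using f(2) \<open>M \<ge> 0\<close> by (auto simp: norm_mult abs_mult mult.commute intro!: mult_right_mono)
qed

lemma bcont_bound:
  assumes "bcont v" obtains M where "M \<ge> 0" "\<And>t. norm (v t) \<le> M"
  using assms unfolding bcont_def bounded_iff by (metis norm_ge_zero order_trans rangeI)

lemma integrable_cinner: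
  assumes "integrable lborel k" "bcont v"
  shows "integrable lborel (\<lambda>t. k t * cinner x (v t))"
proof -
  obtain M where M: "M \<ge> 0" "\<And>t. norm (v t) \<le> M" using assms(2) bcont_bound by blast
  show ?thesis
  proof (rule integrable_mult_bcont[OF assms(1)])
    show "continuous_on UNIV (\<lambda>t. cinner x (v t))"
      using assms(2) unfolding bcont_def by (intro continuous_intros) auto
    show "cmod (cinner x (v t)) \<le> norm x * M" for t
      using cmod_cinner_le[of x "v t"] M(2)[of t] by (meson mult_left_mono norm_ge_zero order_trans)
  qed
qed

lemma integrable_norm_bcont:
  assumes "integrable lborel k" "bcont v"
  shows "integrable lborel (\<lambda>t. cmod (k t) * norm (v t))"
proof -
  obtain M where M: "M \<ge> 0" "\<And>t. norm (v t) \<le> M" using assms(2) bcont_bound by blast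
  show ?thesis
  proof (rule Bochner_Integration.integrable_bound)
    show "integrable lborel (\<lambda>t. M * cmod (k t))" using assms(1) by simp
    have "(\<lambda>t. norm (v t)) \<in> borel_measurable lborel"
      using assms(2) unfolding bcont_def
      by (simp add: borel_measurable_continuous_onI continuous_on_norm)
    then show "(\<lambda>t. cmod (k t) * norm (v t)) \<in> borel_measurable lborel"
      using borel_measurable_integrable[OF assms(1)] by simp
    show "AE t in lborel. norm (cmod (k t) * norm (v t)) \<le> norm (M * cmod (k t))"
      using M by (auto simp: abs_mult mult.commute intro!: mult_right_mono)
  qed
qed

text \<open>The integral is conjugate-linear in \<open>x\<close> and bounded by a multiple of
  \<open>norm x\<close>; its complex conjugate is thus a functional to which \<open>riesz\<close>
  applies.\<close>

lemma cinner_wint: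
  assumes k: "integrable lborel k" and v: "bcont v"
  shows "cinner x (wint k v) = (LINT t|lborel. k t * cinner x (v t))"
proof -
  note i = integrable_cinner[OF k v]
  let ?I = "\<lambda>x. LINT t|lborel. k t * cinner x (v t)"
  obtain M where M: "M \<ge> 0" "\<And>t. norm (v t) \<le> M" using v bcont_bound by blast
  have bd: "cmod (?I x) \<le> (M * (LINT t|lborel. cmod (k t))) * norm x" for x
  proof -
    have "cmod (?I x) \<le> (LINT t|lborel. (M * norm x) * cmod (k t))"
    proof (rule Bochner_Integration.integral_norm_bound_integral[OF i])
      show "integrable lborel (\<lambda>t. (M * norm x) * cmod (k t))" using k by simp
      fix t
      have "cmod (cinner x (v t)) \<le> norm x * M"
        using cmod_cinner_le[of x "v t"] M(2)[of t] by (meson mult_left_mono norm_ge_zero order_trans)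
      then show "norm (k t * cinner x (v t)) \<le> (M * norm x) * cmod (k t)"
        by (simp add: norm_mult mult.commute mult_left_mono)
    qed
    then show ?thesis by (simp add: mult_ac)
  qed
  have "\<exists>z. \<forall>x. cnj (?I x) = cinner z x"
  proof (rule riesz[where f="\<lambda>x. cnj (?I x)"])
    fix x y c
    show "cnj (?I (x + y)) = cnj (?I x) + cnj (?I y)"
      by (simp add: cinner_add_left distrib_left i)
    have "?I (c *\<^sub>C x) = (LINT t|lborel. cnj c * (k t * cinner x (v t)))"
      by (simp add: cinner_scaleC_left mult_ac)
    then show "cnj (?I (c *\<^sub>C x)) = c * cnj (?I x)" by simp
    show "cmod (cnj (?I x)) \<le> (M * (LINT t|lborel. cmod (k t))) * norm x"
      using bd[of x] by simp
  qed
  then have "\<exists>z. \<forall>x. cinner x z = ?I x"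
    by (metis cinner_conj complex_cnj_cnj)
  then show ?thesis unfolding wint_def by (rule someI2_ex) blast
qed

lemma wint_eqI:
  assumes "integrable lborel k" "bcont v" "\<And>x. (LINT t|lborel. k t * cinner x (v t)) = cinner x z"
  shows "wint k v = z"
  by (rule cinner_ext) (simp add: cinner_wint assms)

lemma norm_wint_le:
  assumes k: "integrable lborel k" and v: "bcont v"
  shows "norm (wint k v) \<le> (LINT t|lborel. cmod (k t) * norm (v t))"
proof -
  define w where "w = wint k v"
  \<comment> \<open>Pair the integral with itself; one factor \<open>norm w\<close> cancels at the
    end.\<close>
  have "(norm w)\<^sup>2 = cmod (cinner w w)" unfolding cinner_self by (metis norm_of_real abs_power2)
  also have "\<dots> = cmod (LINT t|lborel. k t * cinner w (v t))"
    using cinner_wint[OF k v] by (simp add: w_def)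
  also have "\<dots> \<le> (LINT t|lborel. norm w * (cmod (k t) * norm (v t)))"
  proof (rule Bochner_Integration.integral_norm_bound_integral[OF integrable_cinner[OF k v]])
    show "integrable lborel (\<lambda>t. norm w * (cmod (k t) * norm (v t)))"
      using integrable_norm_bcont[OF k v] by simp
    show "norm (k t * cinner w (v t)) \<le> norm w * (cmod (k t) * norm (v t))" for t
      using mult_left_mono[OF cmod_cinner_le[of w "v t"], of "cmod (k t)"]
      by (simp add: norm_mult mult_ac)
  qed
  finally have *: "norm w * norm w \<le> norm w * (LINT t|lborel. cmod (k t) * norm (v t))"
    by (simp add: power2_eq_square)
  show ?thesis
  proof (cases "norm w = 0")
    case True
    then show ?thesis unfolding w_def[symmetric] by simp
  next
    case False
    then show ?thesis using * unfolding w_def[symmetric] by (simp add: mult_le_cancel_left)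
  qed
qed

lemma wint_scale_left:
  assumes "integrable lborel k" "bcont v"
  shows "wint (\<lambda>t. c * k t) v = c *\<^sub>C wint k v"
  by (rule wint_eqI) (simp_all add: assms cinner_wint cinner_scaleC_right mult.assoc)

lemma wint_diff_left:
  assumes "integrable lborel k" "integrable lborel k'" "bcont v"
  shows "wint (\<lambda>t. k t - k' t) v = wint k v - wint k' v"
  by (rule wint_eqI)
     (simp_all add: assms cinner_wint integrable_cinner cinner_diff_right left_diff_distrib)

lemma bcont_add: "bcont u \<Longrightarrow> bcont v \<Longrightarrow> bcont (\<lambda>t. u t + v t)"
  and bcont_diff: "bcont u \<Longrightarrow> bcont v \<Longrightarrow> bcont (\<lambda>t. u t - v t)"
  and bcont_scale: "bcont u \<Longrightarrow> bcont (\<lambda>t. c *\<^sub>C u t)"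
  unfolding bcont_def
  using bounded_linear_image[OF _ bounded_bilinear.bounded_linear_right[OF bounded_bilinear_scaleC, of c],
      of "range u"]
  by (auto intro!: continuous_intros bounded_plus_comp bounded_minus_comp simp: image_image)

lemma wint_add_right:
  assumes "integrable lborel k" "bcont u" "bcont v"
  shows "wint k (\<lambda>t. u t + v t) = wint k u + wint k v"
  by (rule wint_eqI)
     (simp_all add: assms bcont_add cinner_wint integrable_cinner cinner_add_right distrib_left)

lemma wint_diff_right:
  assumes "integrable lborel k" "bcont u" "bcont v"
  shows "wint k (\<lambda>t. u t - v t) = wint k u - wint k v"
  by (rule wint_eqI)
     (simp_all add: assms bcont_diff cinner_wint integrable_cinner cinner_diff_right right_diff_distrib)

lemma wint_scale_right:
  assumes "integrable lborel k" "bcont u"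
  shows "wint k (\<lambda>t. c *\<^sub>C u t) = c *\<^sub>C wint k u"
proof (rule wint_eqI)
  fix x
  have "(LINT t|lborel. k t * cinner x (c *\<^sub>C u t)) = (LINT t|lborel. c * (k t * cinner x (u t)))"
    by (simp add: cinner_scaleC_right mult_ac)
  then show "(LINT t|lborel. k t * cinner x (c *\<^sub>C u t)) = cinner x (c *\<^sub>C wint k u)"
    by (simp add: cinner_scaleC_right cinner_wint assms)
qed (simp_all add: assms bcont_scale)

text \<open>Norm convergence of complex difference quotients, not just holomorphy of matrix
  elements: the product rule in \<open>opfam_comp\<close> applies one moving operator to the moving
  difference quotient of the other.\<close>

definition cderiv :: "(complex \<Rightarrow> 'a::chilbert) \<Rightarrow> 'a \<Rightarrow> complex \<Rightarrow> bool" where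
  "cderiv f d z \<longleftrightarrow> ((\<lambda>w. (1 / (w - z)) *\<^sub>C (f w - f z)) \<longlongrightarrow> d) (at z)"

lemma cderiv_cinner:
  assumes "cderiv f d z"
  shows "((\<lambda>w. cinner x (f w)) has_field_derivative cinner x d) (at z)"
proof -
  have "((\<lambda>w. cinner x ((1 / (w - z)) *\<^sub>C (f w - f z))) \<longlongrightarrow> cinner x d) (at z)"
    using assms unfolding cderiv_def by (intro tendsto_intros)
  then show ?thesis
    unfolding has_field_derivative_iff by (simp add: cinner_scaleC_right cinner_diff_right)
qed

lemma cderiv_transform:
  assumes "cderiv f d z" "open S" "z \<in> S" "\<And>w. w \<in> S \<Longrightarrow> g w = f w"
  shows "cderiv g d z"
proof -
  have "eventually (\<lambda>w. w \<in> S) (at z)"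
    using assms(2,3) by (metis eventually_at_topological)
  then have "eventually (\<lambda>w. (1 / (w - z)) *\<^sub>C (f w - f z) = (1 / (w - z)) *\<^sub>C (g w - g z)) (at z)"
    by eventually_elim (simp add: assms)
  then show ?thesis using assms(1) unfolding cderiv_def by (rule Lim_transform_eventually[rotated])
qed

lemma cderiv_scale:
  assumes "cderiv f d z"
  shows "cderiv (\<lambda>w. c *\<^sub>C f w) (c *\<^sub>C d) z"
proof -
  have "((\<lambda>w. c *\<^sub>C (1 / (w - z)) *\<^sub>C (f w - f z)) \<longlongrightarrow> c *\<^sub>C d) (at z)"
    using assms unfolding cderiv_def by (intro tendsto_intros)
  then show ?thesis
    unfolding cderiv_def by (simp add: scaleC_scaleC scaleC_diff_right[symmetric] mult.commute)
qed

lemma cderiv_affine: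
  assumes "cderiv f d (s * z + b)" "s \<noteq> 0"
  shows "cderiv (\<lambda>w. f (s * w + b)) (s *\<^sub>C d) z"
proof -
  have "filterlim (\<lambda>w. s * w + b) (at (s * z + b)) (at z)"
    unfolding filterlim_at using assms(2)
    by (auto intro!: tendsto_eq_intros simp: eventually_at_filter)
  then have "((\<lambda>w. s *\<^sub>C (1 / (s * w + b - (s * z + b))) *\<^sub>C (f (s * w + b) - f (s * z + b))) \<longlongrightarrow> s *\<^sub>C d) (at z)"
    by (rule tendsto_scaleC[OF tendsto_const filterlim_compose[OF assms(1)[unfolded cderiv_def]]])
  moreover have "s * (1 / (s * w + b - (s * z + b))) = 1 / (w - z)" for w
  proof -
    have "s * w + b - (s * z + b) = s * (w - z)" by (simp add: right_diff_distrib)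
    then show ?thesis using assms(2) by simp
  qed
  ultimately show ?thesis unfolding cderiv_def scaleC_scaleC by simp
qed

text \<open>Differentiation under the integral with an explicit first-order remainder: the error is
  O(|w - z|) times the integral of \<open>g\<close>, so no convergence theorem for integrals is
  needed.\<close>

lemma wint_cderiv:
  assumes v: "bcont v" and k': "integrable lborel k'" and g: "integrable lborel g"
    and \<delta>: "\<delta> > 0" and k: "\<And>w. cmod (w - z) < \<delta> \<Longrightarrow> integrable lborel (k w)"
    and bd: "\<And>w t. w \<noteq> z \<Longrightarrow> cmod (w - z) < \<delta> \<Longrightarrow>
      cmod (1 / (w - z) * (k w t - k z t) - k' t) \<le> cmod (w - z) * g t"
  shows "cderiv (\<lambda>w. wint (k w) v) (wint k' v) z"
proof -
  obtain M where M: "M \<ge> 0" "\<And>t. norm (v t) \<le> M" using v bcont_bound by blast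
  have kz: "integrable lborel (k z)" using k[of z] \<delta> by simp
  have "norm ((1 / (w - z)) *\<^sub>C (wint (k w) v - wint (k z) v) - wint k' v)
      \<le> cmod (w - z) * (M * (LINT t|lborel. g t))" if w: "w \<noteq> z" "cmod (w - z) < \<delta>" for w
  proof -
    note kw = k[OF w(2)]
    let ?k = "\<lambda>t. 1 / (w - z) * (k w t - k z t) - k' t"
    have int: "integrable lborel ?k" using kw kz k' by simp
    have "(1 / (w - z)) *\<^sub>C (wint (k w) v - wint (k z) v) - wint k' v = wint ?k v"
      using kw kz k' v wint_scale_left[of "\<lambda>t. k w t - k z t" v "1 / (w - z)"]
      by (subst wint_diff_left) (simp_all add: wint_diff_left)
    also have "norm \<dots> \<le> (LINT t|lborel. cmod (?k t) * norm (v t))"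
      by (rule norm_wint_le[OF int v])
    also have "\<dots> \<le> (LINT t|lborel. cmod (w - z) * M * g t)"
    proof (rule integral_mono)
      show "integrable lborel (\<lambda>t. cmod (?k t) * norm (v t))"
        by (rule integrable_norm_bcont[OF int v])
      show "integrable lborel (\<lambda>t. cmod (w - z) * M * g t)" using g by simp
      show "cmod (?k t) * norm (v t) \<le> cmod (w - z) * M * g t" for t
        using mult_mono[OF bd[OF w, of t] M(2)[of t]] order_trans[OF norm_ge_zero bd[OF w, of t]]
        by (simp add: mult_ac)
    qed
    also have "\<dots> = cmod (w - z) * (M * (LINT t|lborel. g t))" by simp
    finally show ?thesis .
  qed
  then have "eventually (\<lambda>w. norm ((1 / (w - z)) *\<^sub>C (wint (k w) v - wint (k z) v) - wint k' v)
      \<le> cmod (w - z) * (M * (LINT t|lborel. g t))) (at z)"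
    unfolding eventually_at using \<delta> by (auto simp: dist_norm)
  moreover have "((\<lambda>w. cmod (w - z) * (M * (LINT t|lborel. g t))) \<longlongrightarrow> 0) (at z)"
    by (rule tendsto_eq_intros | simp)+
  ultimately have "((\<lambda>w. (1 / (w - z)) *\<^sub>C (wint (k w) v - wint (k z) v) - wint k' v) \<longlongrightarrow> 0) (at z)"
    by (rule Lim_null_comparison)
  then show ?thesis unfolding cderiv_def by (simp add: LIM_zero_iff)
qed

section \<open>The Poisson and Cauchy kernels\<close>

text \<open>The Poisson kernel of the upper half plane at height one; other heights come from
  rescaling the variable in \<open>T\<close>.\<close>

definition pk :: "real \<Rightarrow> complex" where "pk u = complex_of_real (1 / (pi * (1 + u\<^sup>2)))"
text \<open>The Cauchy kernel decays too slowly to be integrable. Subtracting its value at w = -i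
  makes the decay quadratic, leaves the derivative in \<open>w\<close> unchanged, and makes the
  kernel vanish identically at w = -i, which fixes the constant in
  \<open>cauchy1_zero\<close>.\<close>

definition ck :: "complex \<Rightarrow> real \<Rightarrow> complex" where "ck w t = 1 / (of_real t - w) - 1 / (of_real t + \<i>)"
text \<open>\<open>ak\<close> and \<open>bk\<close> are the first and second derivatives of
  \<open>ck\<close> in \<open>w\<close>.\<close>

definition ak :: "complex \<Rightarrow> real \<Rightarrow> complex" where "ak w t = 1 / (of_real t - w)\<^sup>2"
definition bk :: "complex \<Rightarrow> real \<Rightarrow> complex" where "bk w t = 2 / (of_real t - w) ^ 3"

lemma integrable_lorentz: "integrable lborel (\<lambda>u::real. 1 / (1 + u\<^sup>2))"
  and LINT_lorentz: "(LINT u|lborel. 1 / (1 + u\<^sup>2)) = pi"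
  using integrable_inverse_1_plus_square LBINT_inverse_1_plus_square
  by (simp_all add: set_integrable_def interval_lebesgue_integral_def set_lebesgue_integral_def inverse_eq_divide)

lemma cmod_pk: "cmod (pk u) = 1 / pi * (1 / (1 + u\<^sup>2))"
proof -
  have "pi * (1 + u\<^sup>2) > 0" by (intro mult_pos_pos pi_gt_zero) (smt (verit) zero_le_power2)
  then show ?thesis unfolding pk_def norm_of_real by simp
qed

lemma integrable_pk [simp]: "integrable lborel pk"
proof -
  have "integrable lborel (\<lambda>u. complex_of_real (1 / pi * (1 / (1 + u\<^sup>2))))"
    using integrable_lorentz by (intro integrable_of_real integrable_mult_right) auto
  then show ?thesis by (simp add: pk_def[abs_def])
qed

lemma LINT_cmod_pk: "(LINT u|lborel. cmod (pk u)) = 1"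
  unfolding cmod_pk integral_mult_right_zero LINT_lorentz by simp

lemma cmod_ak_affine:
  assumes "Im w \<noteq> 0"
  shows "cmod (ak w (Re w + Im w * u)) = 1 / (Im w)\<^sup>2 * (1 / (1 + u\<^sup>2))"
proof -
  have "complex_of_real (Re w + Im w * u) - w = Im w * (of_real u - \<i>)"
    by (simp add: complex_eq_iff algebra_simps)
  then have "cmod (ak w (Re w + Im w * u)) = 1 / ((Im w)\<^sup>2 * (cmod (of_real u - \<i>))\<^sup>2)"
    by (simp add: ak_def norm_divide norm_power norm_mult power_mult_distrib)
  also have "(cmod (of_real u - \<i>))\<^sup>2 = 1 + u\<^sup>2" by (simp add: cmod_power2)
  finally show ?thesis by simp
qed

lemma sub_nonreal: "Im w \<noteq> 0 \<Longrightarrow> complex_of_real t - w \<noteq> 0"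
  by (auto simp: complex_eq_iff)

lemma continuous_ak: "Im w \<noteq> 0 \<Longrightarrow> continuous_on UNIV (ak w)"
  unfolding ak_def[abs_def] by (intro continuous_intros) (use sub_nonreal in auto)

lemma integrable_ak [simp]:
  assumes "Im w \<noteq> 0"
  shows "integrable lborel (ak w)"
proof -
  have meas: "ak w \<in> borel_measurable borel"
    using borel_measurable_continuous_onI[OF continuous_ak[OF assms]] .
  have "integrable lborel (\<lambda>u. cmod (ak w (Re w + Im w * u)))"
    unfolding cmod_ak_affine[OF assms] using integrable_lorentz by (intro integrable_mult_right) auto
  then have "integrable lborel (\<lambda>t. cmod (ak w t))"
    using lborel_integrable_real_affine_iff[of "Im w" "\<lambda>t. cmod (ak w t)" "Re w"] assms by simp
  then show ?thesis using meas by (subst (asm) integrable_norm_iff) auto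
qed

text \<open>The decay in |Im w| is what makes \<open>cauchy2\<close> tend to 0 far down in the lower
  half plane.\<close>

lemma LINT_cmod_ak:
  assumes "Im w \<noteq> 0"
  shows "(LINT t|lborel. cmod (ak w t)) = pi / \<bar>Im w\<bar>"
  using assms lborel_integral_real_affine[of "Im w" "\<lambda>t. cmod (ak w t)" "Re w"]
  unfolding cmod_ak_affine[OF assms] integral_mult_right_zero LINT_lorentz
  by (simp add: power2_eq_square abs_if)

lemma integrable_dominated_continuous:
  fixes k :: "real \<Rightarrow> complex"
  assumes "continuous_on UNIV k" "integrable lborel g" "\<And>t. cmod (k t) \<le> g t"
  shows "integrable lborel k"
  using assms(2)
proof (rule Bochner_Integration.integrable_bound)
  show "k \<in> borel_measurable lborel" using borel_measurable_continuous_onI[OF assms(1)] by simp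
  show "AE t in lborel. norm (k t) \<le> norm (g t)"
    using assms(3) by (auto intro: order_trans[OF _ abs_ge_self])
qed

lemma cmod_inverse_le:
  assumes "Im w \<noteq> 0"
  shows "cmod (1 / (of_real t - w)) \<le> 1 / \<bar>Im w\<bar>"
proof -
  have "\<bar>Im w\<bar> \<le> cmod (of_real t - w)" using abs_Im_le_cmod[of "of_real t - w"] by simp
  then show ?thesis using assms by (simp add: norm_divide frac_le)
qed

lemma integrable_bk [simp]:
  assumes "Im w \<noteq> 0"
  shows "integrable lborel (bk w)"
proof (rule integrable_dominated_continuous)
  show "continuous_on UNIV (bk w)"
    unfolding bk_def[abs_def] by (intro continuous_intros) (use assms sub_nonreal in auto)
  show "integrable lborel (\<lambda>t. 2 / \<bar>Im w\<bar> * cmod (ak w t))" using assms by simp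
  show "cmod (bk w t) \<le> 2 / \<bar>Im w\<bar> * cmod (ak w t)" for t
  proof -
    have "bk w t = 2 * (1 / (of_real t - w)) * ak w t"
      by (simp add: bk_def ak_def power2_eq_square power3_eq_cube)
    then have "cmod (bk w t) = 2 * cmod (1 / (of_real t - w)) * cmod (ak w t)"
      by (simp only: norm_mult norm_numeral)
    also have "\<dots> \<le> 2 * (1 / \<bar>Im w\<bar>) * cmod (ak w t)"
      by (intro mult_right_mono mult_left_mono cmod_inverse_le assms) auto
    finally show ?thesis by simp
  qed
qed

lemma integrable_ck [simp]:
  assumes "Im w \<noteq> 0"
  shows "integrable lborel (ck w)"
proof (rule integrable_dominated_continuous)
  have nz: "complex_of_real t + \<i> \<noteq> 0" for t by (simp add: complex_eq_iff)
  show "continuous_on UNIV (ck w)"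
    unfolding ck_def[abs_def] by (intro continuous_intros) (use assms sub_nonreal nz in auto)
  show "integrable lborel (\<lambda>t. cmod (w + \<i>) * (cmod (ak w t) + cmod (ak (- \<i>) t)))" using assms by simp
  show "cmod (ck w t) \<le> cmod (w + \<i>) * (cmod (ak w t) + cmod (ak (- \<i>) t))" for t
  proof -
    define p q where "p = 1 / (of_real t - w)" and "q = 1 / (of_real t + \<i>)"
    have ab: "a * b \<le> a\<^sup>2 + b\<^sup>2" for a b :: real
      using sum_squares_bound[of a b] zero_le_power2[of a] zero_le_power2[of b] by linarith
    \<comment> \<open>Resolvent identity: the difference of two simple poles is a product of them,
      hence dominated by the two squared kernels \<open>ak\<close>.\<close>
    have "ck w t = (w + \<i>) * (p * q)"
      using sub_nonreal[OF assms, of t] nz[of t] by (simp add: ck_def p_def q_def field_simps)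
    then have "cmod (ck w t) = cmod (w + \<i>) * (cmod p * cmod q)" by (simp add: norm_mult)
    also have "\<dots> \<le> cmod (w + \<i>) * ((cmod p)\<^sup>2 + (cmod q)\<^sup>2)"
      by (intro mult_left_mono ab) auto
    also have "(cmod p)\<^sup>2 = cmod (ak w t)"
      by (simp add: p_def ak_def norm_divide norm_power power_divide)
    also have "(cmod q)\<^sup>2 = cmod (ak (- \<i>) t)"
      by (simp add: q_def ak_def norm_divide norm_power power_divide)
    finally show ?thesis .
  qed
qed

text \<open>With half the distance to the real axis as radius, the pole at \<open>w\<close> stays
  uniformly away from the line of integration.\<close>

lemma near_nonreal:
  assumes "cmod (w - z) < \<bar>Im z\<bar> / 2"
  shows "\<bar>Im w\<bar> \<ge> \<bar>Im z\<bar> / 2" "Im w \<noteq> 0"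
proof -
  have "\<bar>Im (w - z)\<bar> < \<bar>Im z\<bar> / 2" using abs_Im_le_cmod[of "w - z"] assms by linarith
  then have "\<bar>Im w - Im z\<bar> < \<bar>Im z\<bar> / 2" by simp
  then show "\<bar>Im w\<bar> \<ge> \<bar>Im z\<bar> / 2" "Im w \<noteq> 0" by linarith+
qed

lemma cderiv_wint_ck:
  assumes v: "bcont v" and z: "Im z \<noteq> 0"
  shows "cderiv (\<lambda>w. wint (ck w) v) (wint (ak z) v) z"
proof (rule wint_cderiv[where \<delta>="\<bar>Im z\<bar> / 2" and g="\<lambda>t. 2 / \<bar>Im z\<bar> * cmod (ak z t)"])
  fix w t assume w: "w \<noteq> z" "cmod (w - z) < \<bar>Im z\<bar> / 2"
  note n = near_nonreal[OF w(2)]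
  define p q where "p = of_real t - z" and "q = of_real t - w"
  have nz: "p \<noteq> 0" "q \<noteq> 0" "w - z \<noteq> 0"
    using sub_nonreal z n(2) w(1) by (auto simp: p_def q_def)
  have h: "w - z = p - q" by (simp add: p_def q_def)
  have "1 / (w - z) * (ck w t - ck z t) - ak z t = 1 / (w - z) * (1 / q - 1 / p) - 1 / p\<^sup>2"
    by (simp add: ck_def ak_def p_def q_def)
  also have "\<dots> = (w - z) * (1 / q) * (1 / p\<^sup>2)"
    using nz unfolding h by (simp add: field_simps power2_eq_square)
  finally have "cmod (1 / (w - z) * (ck w t - ck z t) - ak z t) = cmod (w - z) * cmod (1 / q) * cmod (ak z t)"
    by (simp only: norm_mult ak_def p_def)
  also have "\<dots> \<le> cmod (w - z) * (2 / \<bar>Im z\<bar>) * cmod (ak z t)"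
  proof (intro mult_right_mono mult_left_mono)
    have "cmod (1 / q) \<le> 1 / \<bar>Im w\<bar>" unfolding q_def by (rule cmod_inverse_le[OF n(2)])
    also have "\<dots> \<le> 1 / (\<bar>Im z\<bar> / 2)" using n z by (intro frac_le) auto
    finally show "cmod (1 / q) \<le> 2 / \<bar>Im z\<bar>" by simp
  qed auto
  finally show "cmod (1 / (w - z) * (ck w t - ck z t) - ak z t) \<le> cmod (w - z) * (2 / \<bar>Im z\<bar> * cmod (ak z t))"
    by (simp add: mult.assoc)
qed (use assms near_nonreal in \<open>auto simp del: times_divide_eq_left\<close>)

lemma cderiv_wint_ak:
  assumes v: "bcont v" and z: "Im z \<noteq> 0"
  shows "cderiv (\<lambda>w. wint (ak w) v) (wint (bk z) v) z"
proof (rule wint_cderiv[where \<delta>="\<bar>Im z\<bar> / 2" and g="\<lambda>t. 8 / (Im z)\<^sup>2 * cmod (ak z t)"])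
  fix w t assume w: "w \<noteq> z" "cmod (w - z) < \<bar>Im z\<bar> / 2"
  note n = near_nonreal[OF w(2)]
  define p q where "p = of_real t - z" and "q = of_real t - w"
  define a b where "a = 1 / p" and "b = 1 / q"
  have nz: "p \<noteq> 0" "q \<noteq> 0" "w - z \<noteq> 0"
    using sub_nonreal z n(2) w(1) by (auto simp: p_def q_def)
  have h: "w - z = p - q" by (simp add: p_def q_def)
  have "1 / (w - z) * (ak w t - ak z t) - bk z t = 1 / (w - z) * (1 / q\<^sup>2 - 1 / p\<^sup>2) - 2 / p ^ 3"
    by (simp add: ak_def bk_def p_def q_def)
  also have "\<dots> = (w - z) * ((b * b + 2 * a * b) * (1 / p\<^sup>2))"
    using nz unfolding h a_def b_def by (simp add: field_simps power2_eq_square power3_eq_cube)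
  finally have "cmod (1 / (w - z) * (ak w t - ak z t) - bk z t) = cmod (w - z) * (cmod (b * b + 2 * a * b) * cmod (ak z t))"
    by (simp only: norm_mult ak_def p_def)
  also have "\<dots> \<le> cmod (w - z) * (8 / (Im z)\<^sup>2 * cmod (ak z t))"
  proof (intro mult_right_mono mult_left_mono)
    define m where "m = 1 / (\<bar>Im z\<bar> / 2)"
    have "cmod b \<le> 1 / \<bar>Im w\<bar>" unfolding q_def b_def by (rule cmod_inverse_le[OF n(2)])
    also have "\<dots> \<le> m" using n z unfolding m_def by (intro frac_le) auto
    finally have b: "cmod b \<le> m" .
    have "cmod a \<le> 1 / \<bar>Im z\<bar>" unfolding p_def a_def by (rule cmod_inverse_le[OF z])
    also have a: "\<dots> = m / 2" using z unfolding m_def by simp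
    finally have a: "cmod a \<le> m / 2" .
    have "cmod (b * b + 2 * a * b) \<le> cmod b * cmod b + 2 * cmod a * cmod b"
      using norm_triangle_ineq[of "b * b" "2 * a * b"] by (simp add: norm_mult)
    also have "\<dots> \<le> m * m + 2 * (m / 2) * m"
      using a b order_trans[OF norm_ge_zero b] by (intro add_mono mult_mono) auto
    also have "\<dots> = 8 / (Im z)\<^sup>2" using z unfolding m_def by (simp add: power2_eq_square)
    finally show "cmod (b * b + 2 * a * b) \<le> 8 / (Im z)\<^sup>2" .
  qed auto
  finally show "cmod (1 / (w - z) * (ak w t - ak z t) - bk z t) \<le> cmod (w - z) * (8 / (Im z)\<^sup>2 * cmod (ak z t))" .
qed (use assms near_nonreal in \<open>auto simp del: times_divide_eq_left\<close>)

section \<open>One-parameter unitary groups with positive generator\<close>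

text \<open>In \<open>V_positive\<close> the limit \<phi> is H \<psi> for V t = exp(i t H):
  positivity is expressed by difference quotients, so the unbounded generator and its domain never
  appear as objects.\<close>

locale positive_group =
  fixes V :: "real \<Rightarrow> 'a \<Rightarrow> 'a::chilbert"
  assumes V_add: "V (s + t) x = V s (V t x)"
    and V_zero: "V 0 x = x"
    and V_clinear: "clinear (V t)"
    and V_cinner: "cinner (V t x) (V t y) = cinner x y"
    and V_continuous: "continuous_on UNIV (\<lambda>t. V t x)"
    and V_positive: "((\<lambda>t. (1 / (\<i> * of_real t)) *\<^sub>C (V t \<psi> - \<psi>)) \<longlongrightarrow> \<phi>) (at 0) \<Longrightarrow> 0 \<le> Re (cinner \<psi> \<phi>)"
begin

lemma V_plus: "V t (x + y) = V t x + V t y"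
  and V_scaleC: "V t (c *\<^sub>C x) = c *\<^sub>C V t x"
  using V_clinear unfolding clinear_def by auto

lemma V_minus_cancel [simp]: "V t (V (- t) x) = x" "V (- t) (V t x) = x"
  using V_add[of t "- t" x] V_add[of "- t" t x] by (simp_all add: V_zero)

lemma V_cinner_right: "cinner x (V t y) = cinner (V (- t) x) y"
  by (metis V_cinner V_minus_cancel(1))

lemma norm_V [simp]: "norm (V t x) = norm x"
  by (simp add: norm_eq_sqrt_inner inner_eq_Re_cinner V_cinner)

lemma V_diff: "V t (x - y) = V t x - V t y"
  using V_plus[of t "x - y" y] by (simp add: algebra_simps)

lemma continuous_on_V [continuous_intros]:
  fixes f :: "'b::topological_space \<Rightarrow> real"
  shows "continuous_on S f \<Longrightarrow> continuous_on S (\<lambda>u. V (f u) y)"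
  by (rule continuous_on_compose2[OF V_continuous]) auto

lemma bcont_V:
  assumes "continuous_on UNIV f"
  shows "bcont (\<lambda>u. V (f u) y)"
  unfolding bcont_def using assms by (auto simp: bounded_iff intro!: continuous_intros)

lemma bcont_V_orbit: "bcont (\<lambda>t. V t y)"
  by (rule bcont_V) (rule continuous_on_id)

section \<open>Kernel integrals of orbits and the effect of positivity\<close>

definition cauchy2 where "cauchy2 y w = wint (ak w) (\<lambda>t. V t y)"

text \<open>Shifting the integration variable turns the group action into a real shift of
  \<open>w\<close>. The generator therefore acts on \<open>cauchy2 y w\<close> as -i times the
  complex derivative.\<close>

lemma V_cauchy2:
  assumes "Im w \<noteq> 0"
  shows "V s (cauchy2 y w) = cauchy2 y (w + of_real s)"
proof (rule cinner_ext)
  fix x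
  have "cinner x (V s (cauchy2 y w)) = (LINT t|lborel. ak w t * cinner (V (- s) x) (V t y))"
    by (simp add: V_cinner_right cauchy2_def cinner_wint bcont_V_orbit assms)
  also have "\<dots> = (LINT t|lborel. ak (w + of_real s) (s + 1 * t) * cinner x (V (s + 1 * t) y))"
    by (intro Bochner_Integration.integral_cong refl) (simp add: ak_def V_add V_cinner_right)
  also have "\<dots> = (LINT t|lborel. ak (w + of_real s) t * cinner x (V t y))"
    using lborel_integral_real_affine[of 1 "\<lambda>t. ak (w + of_real s) t * cinner x (V t y)" s] by simp
  also have "\<dots> = cinner x (cauchy2 y (w + of_real s))"
    by (simp add: cauchy2_def cinner_wint bcont_V_orbit assms)
  finally show "cinner x (V s (cauchy2 y w)) = cinner x (cauchy2 y (w + of_real s))" .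
qed

text \<open>Differentiating along the real direction shows that \<open>cauchy2 y w\<close> lies in the domain of the
  generator, so its norm grows as \<open>w\<close> moves down the lower half plane; but it tends to 0 there.\<close>

lemma cauchy2_zero:
  assumes w: "Im w < 0"
  shows "cauchy2 y w = 0"
proof -
  define B where "B z = wint (bk z) (\<lambda>t. V t y)" for z
  have cd: "cderiv (cauchy2 y) (B z) z" if "Im z \<noteq> 0" for z
    unfolding cauchy2_def[abs_def] B_def using that by (intro cderiv_wint_ak bcont_V_orbit)
  \<comment> \<open>By \<open>V_cauchy2\<close> the difference quotients of the group at
    \<open>cauchy2 y z\<close> converge to -i times the complex derivative, so
    \<open>V_positive\<close> applies to this pair.\<close>
  have pos: "0 \<le> Re (cinner (cauchy2 y z) ((- \<i>) *\<^sub>C B z))" if z: "Im z \<noteq> 0" for z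
  proof (rule V_positive)
    have lim: "filterlim (\<lambda>t. z + of_real t) (at z) (at (0::real))"
      unfolding filterlim_at by (auto intro!: tendsto_eq_intros simp: eventually_at_filter)
    have "((\<lambda>t. (1 / (z + of_real t - z)) *\<^sub>C (cauchy2 y (z + of_real t) - cauchy2 y z)) \<longlongrightarrow> B z) (at (0::real))"
      by (rule filterlim_compose[OF cd[OF z, unfolded cderiv_def] lim])
    then have "((\<lambda>t. (- \<i>) *\<^sub>C (1 / (z + of_real t - z)) *\<^sub>C (cauchy2 y (z + of_real t) - cauchy2 y z)) \<longlongrightarrow> (- \<i>) *\<^sub>C B z) (at (0::real))"
      by (rule tendsto_scaleC[OF tendsto_const])
    moreover have "(- \<i>) * (1 / (z + of_real t - z)) = 1 / (\<i> * of_real t)" for t :: real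
      by (cases "t = 0") (auto simp: field_simps)
    ultimately show "((\<lambda>t. (1 / (\<i> * of_real t)) *\<^sub>C (V t (cauchy2 y z) - cauchy2 y z)) \<longlongrightarrow> (- \<i>) *\<^sub>C B z) (at 0)"
      by (simp only: scaleC_scaleC V_cauchy2[OF z])
  qed
  \<comment> \<open>Straight down, d/ds is -i d/dz, so the derivative of \<open>a\<close> is the
    generator applied to \<open>a\<close>, and positivity makes its norm nondecreasing.\<close>
  define a where "a s = cauchy2 y (w - \<i> * of_real s)" for s :: real
  have da: "(a has_vector_derivative (- \<i>) *\<^sub>C B (w - \<i> * of_real s)) (at s)" if "s \<ge> 0" for s
  proof -
    define z where "z = w - \<i> * of_real s"
    have z: "Im z \<noteq> 0" using w that by (simp add: z_def)
    have lim: "filterlim (\<lambda>h. w - \<i> * of_real h) (at z) (at s)"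
      unfolding filterlim_at z_def by (auto intro!: tendsto_eq_intros simp: eventually_at_filter)
    have "((\<lambda>h. (1 / (w - \<i> * of_real h - z)) *\<^sub>C (cauchy2 y (w - \<i> * of_real h) - cauchy2 y z)) \<longlongrightarrow> B z) (at s)"
      by (rule filterlim_compose[OF cd[OF z, unfolded cderiv_def] lim])
    then have "((\<lambda>h. (- \<i>) *\<^sub>C (1 / (w - \<i> * of_real h - z)) *\<^sub>C (cauchy2 y (w - \<i> * of_real h) - cauchy2 y z)) \<longlongrightarrow> (- \<i>) *\<^sub>C B z) (at s)"
      by (rule tendsto_scaleC[OF tendsto_const])
    moreover have "(- \<i>) * (1 / (w - \<i> * of_real h - z)) = of_real (1 / (h - s))" for h
    proof (cases "h = s")
      case False
      have "w - \<i> * of_real h - z = (- \<i>) * of_real (h - s)" by (simp add: z_def algebra_simps)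
      then show ?thesis using False by simp
    qed (simp add: z_def)
    ultimately have "((\<lambda>h. (1 / (h - s)) *\<^sub>R (a h - a s)) \<longlongrightarrow> (- \<i>) *\<^sub>C B z) (at s)"
      by (simp only: scaleC_scaleC scaleR_eq_scaleC a_def z_def[symmetric])
    then have "((\<lambda>h. norm ((1 / (h - s)) *\<^sub>R (a h - a s) - (- \<i>) *\<^sub>C B z)) \<longlongrightarrow> 0) (at s)"
      by (intro tendsto_norm_zero) (simp add: LIM_zero)
    moreover have "norm ((1 / (h - s)) *\<^sub>R (a h - a s) - d) = norm (a h - a s - (h - s) *\<^sub>R d) / norm (h - s)"
      if "h \<noteq> s" for h d
    proof -
      have "a h - a s - (h - s) *\<^sub>R d = (h - s) *\<^sub>R ((1 / (h - s)) *\<^sub>R (a h - a s) - d)"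
        using that by (simp add: scaleR_diff_right)
      then show ?thesis using that by simp
    qed
    ultimately have "((\<lambda>h. norm (a h - a s - (h - s) *\<^sub>R ((- \<i>) *\<^sub>C B z)) / norm (h - s)) \<longlongrightarrow> 0) (at s)"
      by (simp cong: LIM_cong)
    then show ?thesis
      unfolding z_def[symmetric] has_vector_derivative_def has_derivative_iff_norm
      by (simp add: bounded_linear_scaleR_left)
  qed
  define N where "N s = inner (a s) (a s)" for s
  have mono: "N 0 \<le> N s" if "s \<ge> 0" for s
  proof (rule DERIV_nonneg_imp_nondecreasing[OF that])
    fix u assume u: "0 \<le> u" "u \<le> s"
    let ?d = "(- \<i>) *\<^sub>C B (w - \<i> * of_real u)"
    have "(N has_vector_derivative (inner (a u) ?d + inner ?d (a u))) (at u)"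
      unfolding N_def by (rule bounded_bilinear.has_vector_derivative[OF bounded_bilinear_inner da[OF u(1)] da[OF u(1)]])
    then have "(N has_real_derivative (inner (a u) ?d + inner ?d (a u))) (at u)"
      by (simp add: has_real_derivative_iff_has_vector_derivative)
    moreover have "inner (a u) ?d \<ge> 0"
      unfolding a_def inner_eq_Re_cinner using w u by (intro pos) auto
    ultimately show "\<exists>y. (N has_real_derivative y) (at u) \<and> 0 \<le> y"
      by (metis add_nonneg_nonneg inner_commute)
  qed
  have norm_a: "norm (a s) \<le> pi * norm y / (s - Im w)" if "s \<ge> 0" for s
  proof -
    have Im: "Im (w - \<i> * of_real s) \<noteq> 0" using w that by auto
    have "norm (a s) \<le> (LINT t|lborel. cmod (ak (w - \<i> * of_real s) t) * norm (V t y))"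
      unfolding a_def cauchy2_def by (intro norm_wint_le integrable_ak Im bcont_V_orbit)
    also have "\<dots> = pi / \<bar>Im (w - \<i> * of_real s)\<bar> * norm y"
      by (simp only: norm_V integral_mult_left_zero LINT_cmod_ak[OF Im])
    also have "\<bar>Im (w - \<i> * of_real s)\<bar> = s - Im w" using w that by simp
    finally show ?thesis by simp
  qed
  have "((\<lambda>s. (c / (s - b))\<^sup>2) \<longlongrightarrow> 0) at_top" for b c :: real
  proof -
    have "filterlim (\<lambda>s. s - b) at_infinity at_top"
      by (rule filterlim_at_top_imp_at_infinity)
         (simp add: filterlim_tendsto_add_at_top[OF tendsto_const[of "- b"] filterlim_ident, simplified])
    from tendsto_power[OF tendsto_divide_0[OF tendsto_const this], of c 2] show ?thesis by simp
  qed
  moreover have "eventually (\<lambda>s. N 0 \<le> (pi * norm y / (s - Im w))\<^sup>2) at_top"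
    using eventually_ge_at_top[of 0]
  proof eventually_elim
    case (elim s)
    have "N 0 \<le> N s" by (rule mono[OF elim])
    also have "\<dots> = (norm (a s))\<^sup>2" by (simp add: N_def power2_norm_eq_inner)
    also have "\<dots> \<le> (pi * norm y / (s - Im w))\<^sup>2" by (intro power_mono norm_a elim norm_ge_zero)
    finally show ?case .
  qed
  ultimately have "N 0 \<le> 0" by (rule tendsto_lowerbound) simp
  then have "a 0 = 0" unfolding N_def by (metis inner_eq_zero_iff inner_ge_zero order_antisym)
  then show ?thesis by (simp add: a_def)
qed

text \<open>Formally exp(i z H) for Im z \<ge> 0. The substitution t = Re z + u * Im z brings every
  Poisson kernel to the fixed \<open>pk\<close>, so the formula also makes sense on the real axis,
  where it returns the group. Below the axis it gives the reflected value, because \<open>pk\<close>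
  is even.\<close>

definition T :: "complex \<Rightarrow> 'a \<Rightarrow> 'a" where
  "T z y = wint pk (\<lambda>u. V (Re z + u * Im z) y)"

lemma bcont_T: "bcont (\<lambda>u. V (Re z + u * Im z) y)"
  by (intro bcont_V continuous_intros)

lemma T_real: "T (of_real t) y = V t y"
proof -
  have "(LINT u|lborel. pk u) = 1"
  proof -
    have "pk = (\<lambda>u. complex_of_real (1 / pi * (1 / (1 + u\<^sup>2))))" by (simp add: pk_def[abs_def])
    then have "(LINT u|lborel. pk u) = of_real (LINT u|lborel. 1 / pi * (1 / (1 + u\<^sup>2)))"
      by (metis integral_complex_of_real)
    then show ?thesis unfolding integral_mult_right_zero LINT_lorentz by simp
  qed
  then show ?thesis
    unfolding T_def by (intro wint_eqI integrable_pk bcont_T) simp_all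
qed

lemma clinear_T: "clinear (T z)"
  unfolding clinear_def T_def V_plus V_scaleC
  by (simp add: wint_add_right wint_scale_right bcont_T)

text \<open>\<open>pk\<close> is positive with mass one. This is the gain of the Poisson over the
  Cauchy kernel: the constant is 1 at every height, so long products stay bounded independently of
  their length.\<close>

lemma norm_T_le: "norm (T z y) \<le> norm y"
proof -
  have "norm (T z y) \<le> (LINT u|lborel. cmod (pk u) * norm (V (Re z + u * Im z) y))"
    unfolding T_def by (intro norm_wint_le integrable_pk bcont_T)
  also have "\<dots> = norm y" by (simp add: LINT_cmod_pk)
  finally show ?thesis .
qed

lemma T_V: "T z (V s y) = T (z + of_real s) y"
  unfolding T_def by (simp add: V_add[symmetric] add_ac)

lemma V_T: "V s (T z y) = T (z + of_real s) y"
proof (rule cinner_ext)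
  fix x
  show "cinner x (V s (T z y)) = cinner x (T (z + of_real s) y)"
    unfolding T_def V_cinner_right[of x s] cinner_wint[OF integrable_pk bcont_T]
    by (simp add: V_cinner_right[of x s, symmetric] V_add[symmetric] add_ac)
qed

text \<open>Strong continuity of the orbits and dominated convergence; it includes the real axis,
  which the pasting arguments rely on.\<close>

lemma continuous_T: "continuous_on UNIV (\<lambda>z. T z y)"
proof (rule continuous_at_imp_continuous_on, rule ballI)
  fix z0 :: complex
  show "isCont (\<lambda>z. T z y) z0"
    unfolding continuous_at_sequentially comp_def
  proof (intro allI impI)
    fix Z :: "nat \<Rightarrow> complex" assume Z: "Z \<longlonglongrightarrow> z0"
    let ?v = "\<lambda>z u. V (Re z + u * Im z) y"
    let ?d = "\<lambda>n u. cmod (pk u) * norm (?v (Z n) u - ?v z0 u)"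
    have bc: "bcont (\<lambda>u. ?v (Z n) u - ?v z0 u)" for n by (intro bcont_diff bcont_T)
    have "(\<lambda>n. LINT u|lborel. ?d n u) \<longlonglongrightarrow> (LINT (u::real)|lborel. (0::real))"
    proof (rule Bochner_Integration.integral_dominated_convergence)
      show "?d n \<in> borel_measurable lborel" for n
        using integrable_norm_bcont[OF integrable_pk bc] by (rule borel_measurable_integrable)
      show "integrable lborel (\<lambda>u. cmod (pk u) * (2 * norm y))"
        by (intro integrable_mult_left integrable_norm integrable_pk)
      have "(\<lambda>n. ?d n u) \<longlonglongrightarrow> 0" for u
      proof -
        have "(\<lambda>n. Re (Z n) + u * Im (Z n)) \<longlonglongrightarrow> Re z0 + u * Im z0"
          by (intro tendsto_intros Z)
        moreover have "isCont (\<lambda>t. V t y) (Re z0 + u * Im z0)"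
          using V_continuous continuous_on_eq_continuous_at open_UNIV by blast
        ultimately have "(\<lambda>n. ?v (Z n) u) \<longlonglongrightarrow> ?v z0 u"
          by (rule isCont_tendsto_compose[rotated])
        then have "(\<lambda>n. cmod (pk u) * norm (?v (Z n) u - ?v z0 u)) \<longlonglongrightarrow> cmod (pk u) * norm (?v z0 u - ?v z0 u)"
          by (intro tendsto_intros)
        then show ?thesis by simp
      qed
      then show "AE u in lborel. (\<lambda>n. ?d n u) \<longlonglongrightarrow> 0" by simp
      show "AE u in lborel. norm (?d n u) \<le> cmod (pk u) * (2 * norm y)" for n
      proof (rule AE_I2)
        fix u
        have "norm (?v (Z n) u - ?v z0 u) \<le> 2 * norm y"
          using norm_triangle_ineq4[of "?v (Z n) u" "?v z0 u"] by simp
        then show "norm (?d n u) \<le> cmod (pk u) * (2 * norm y)"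
          by (simp add: abs_mult mult_left_mono)
      qed
    qed simp
    then have "(\<lambda>n. LINT u|lborel. ?d n u) \<longlonglongrightarrow> 0" by simp
    moreover have "norm (T (Z n) y - T z0 y) \<le> (LINT u|lborel. ?d n u)" for n
      unfolding T_def wint_diff_right[OF integrable_pk bcont_T bcont_T, symmetric]
      by (intro norm_wint_le integrable_pk bc)
    ultimately have "(\<lambda>n. T (Z n) y - T z0 y) \<longlonglongrightarrow> 0"
      using Lim_null_comparison[of "\<lambda>n. T (Z n) y - T z0 y" "\<lambda>n. LINT u|lborel. ?d n u" sequentially]
      by simp
    then show "(\<lambda>n. T (Z n) y) \<longlonglongrightarrow> T z0 y" by (simp add: LIM_zero_iff)
  qed
qed

definition cauchy1 where "cauchy1 y w = wint (ck w) (\<lambda>t. V t y)"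

text \<open>The derivative is \<open>cauchy2\<close>, which vanishes in the lower half plane, so the
  function is constant there; at -i the kernel \<open>ck\<close> is identically 0.\<close>

lemma cauchy1_zero:
  assumes "Im w < 0"
  shows "cauchy1 y w = 0"
proof (rule cinner_ext)
  fix x
  have "(\<lambda>w. cinner x (cauchy1 y w)) constant_on {z. Im z < 0}"
  proof (rule has_field_derivative_0_imp_constant_on)
    show "((\<lambda>w. cinner x (cauchy1 y w)) has_field_derivative 0) (at z)" if "z \<in> {z. Im z < 0}" for z
    proof -
      have "cderiv (cauchy1 y) (cauchy2 y z) z"
        unfolding cauchy2_def cauchy1_def[abs_def] using that by (intro cderiv_wint_ck bcont_V_orbit) auto
      then show ?thesis using cderiv_cinner[of "cauchy1 y" "cauchy2 y z" z x] cauchy2_zero[of z y] that by simp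
    qed
    show "connected {z. Im z < 0}" by (simp add: convex_connected convex_halfspace_Im_lt)
    show "open {z. Im z < 0}" by (rule open_halfspace_Im_lt)
  qed
  moreover have "cauchy1 y (- \<i>) = 0"
  proof -
    have "ck (- \<i>) = (\<lambda>t. 0)" by (simp add: ck_def[abs_def])
    then show ?thesis unfolding cauchy1_def by (intro wint_eqI) (simp_all add: bcont_V_orbit)
  qed
  ultimately show "cinner x (cauchy1 y w) = cinner x 0"
    using assms unfolding constant_on_def by (metis cinner_zero_right mem_Collect_eq uminus_complex.sel(2) imaginary_unit.sel(2) neg_less_0_iff_less zero_less_one)
qed

text \<open>The Poisson kernel is the difference of the Cauchy kernels at \<open>z\<close> and
  \<open>cnj z\<close>, divided by 2 pi i. The reflected one contributes nothing by
  \<open>cauchy1_zero\<close>, so the Poisson integral is a Cauchy integral and hence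
  holomorphic.\<close>

lemma T_eq_cauchy1:
  assumes z: "Im z > 0"
  shows "T z y = (1 / (2 * of_real pi * \<i>)) *\<^sub>C cauchy1 y z"
proof (rule cinner_ext)
  fix x
  let ?f = "\<lambda>t. cinner x (V t y)"
  let ?c = "1 / (2 * of_real pi * \<i>) :: complex"
  have Im: "Im z \<noteq> 0" "Im (cnj z) \<noteq> 0" using z by auto
  note i = integrable_cinner[OF integrable_ck[OF Im(1)] bcont_V_orbit, of x y]
    integrable_cinner[OF integrable_ck[OF Im(2)] bcont_V_orbit, of x y]
  have "(LINT t|lborel. ck (cnj z) t * ?f t) = cinner x (cauchy1 y (cnj z))"
    unfolding cauchy1_def by (simp add: cinner_wint bcont_V_orbit Im)
  then have 0: "(LINT t|lborel. ck (cnj z) t * ?f t) = 0"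
    using cauchy1_zero[of "cnj z" y] z by simp
  have "cinner x (?c *\<^sub>C cauchy1 y z) = ?c * (LINT t|lborel. ck z t * ?f t)"
    unfolding cauchy1_def cinner_scaleC_right by (simp add: cinner_wint bcont_V_orbit Im)
  also have "\<dots> = (LINT t|lborel. ?c * (ck z t * ?f t - ck (cnj z) t * ?f t))"
    unfolding integral_mult_right_zero Bochner_Integration.integral_diff[OF i] 0 by simp
  also have "\<dots> = \<bar>Im z\<bar> *\<^sub>R (LINT u|lborel. ?c * (ck z (Re z + Im z * u) * ?f (Re z + Im z * u)
      - ck (cnj z) (Re z + Im z * u) * ?f (Re z + Im z * u)))"
    by (rule lborel_integral_real_affine[OF Im(1)])
  also have "\<dots> = (LINT u|lborel. \<bar>Im z\<bar> *\<^sub>R (?c * (ck z (Re z + Im z * u) * ?f (Re z + Im z * u)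
      - ck (cnj z) (Re z + Im z * u) * ?f (Re z + Im z * u))))"
    by simp
  also have "\<dots> = (LINT u|lborel. pk u * ?f (Re z + u * Im z))"
  proof (rule Bochner_Integration.integral_cong)
    fix u :: real
    have nz: "complex_of_real u - \<i> \<noteq> 0" "complex_of_real u + \<i> \<noteq> 0" "complex_of_real (1 + u\<^sup>2) \<noteq> 0" "complex_of_real (Im z) \<noteq> 0"
      using z by (auto simp: complex_eq_iff) (smt (verit) zero_le_power2)
    have e1: "of_real (Re z + Im z * u) - z = of_real (Im z) * (of_real u - \<i>)"
      and e2: "of_real (Re z + Im z * u) - cnj z = of_real (Im z) * (of_real u + \<i>)"
      by (simp_all add: complex_eq_iff algebra_simps)
    have "ck z (Re z + Im z * u) - ck (cnj z) (Re z + Im z * u)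
      = 1 / (of_real (Im z) * (of_real u - \<i>)) - 1 / (of_real (Im z) * (of_real u + \<i>))"
      unfolding ck_def e1 e2 by simp
    also have "\<dots> = 2 * \<i> / (of_real (Im z) * ((of_real u - \<i>) * (of_real u + \<i>)))"
    proof -
      have "1 / (I * p) - 1 / (I * q) = (q - p) / (I * (p * q))" if "p \<noteq> 0" "q \<noteq> 0" "I \<noteq> 0" for I p q :: complex
        using that by (simp add: field_simps)
      from this[OF nz(1,2,4)] show ?thesis by simp
    qed
    also have "(of_real u - \<i>) * (of_real u + \<i>) = of_real (1 + u\<^sup>2)"
      by (simp add: algebra_simps power2_eq_square)
    finally have e: "\<bar>Im z\<bar> *\<^sub>R (?c * (ck z (Re z + Im z * u) - ck (cnj z) (Re z + Im z * u))) = pk u"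
    proof -
      assume e: "ck z (Re z + Im z * u) - ck (cnj z) (Re z + Im z * u) = 2 * \<i> / (of_real (Im z) * of_real (1 + u\<^sup>2))"
      have "I * (1 / (2 * p * \<i>) * (2 * \<i> / (I * S))) = 1 / (p * S)" if "I \<noteq> 0" "S \<noteq> 0" "p \<noteq> 0" for I S p :: complex
        using that by (simp add: field_simps)
      from this[OF nz(4,3), of "of_real pi"] show ?thesis
        unfolding e pk_def scaleR_conv_of_real using z by simp
    qed
    have "\<bar>Im z\<bar> *\<^sub>R (?c * (ck z (Re z + Im z * u) * ?f (Re z + Im z * u)
      - ck (cnj z) (Re z + Im z * u) * ?f (Re z + Im z * u)))
      = (\<bar>Im z\<bar> *\<^sub>R (?c * (ck z (Re z + Im z * u) - ck (cnj z) (Re z + Im z * u)))) * ?f (Re z + Im z * u)"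
      by (simp only: left_diff_distrib[symmetric] mult.assoc mult_scaleR_left)
    then show "\<bar>Im z\<bar> *\<^sub>R (?c * (ck z (Re z + Im z * u) * ?f (Re z + Im z * u)
      - ck (cnj z) (Re z + Im z * u) * ?f (Re z + Im z * u))) = pk u * ?f (Re z + u * Im z)"
      unfolding e by (simp only: mult.commute[of "Im z" u])
  qed simp
  also have "\<dots> = cinner x (T z y)"
    unfolding T_def by (simp add: cinner_wint bcont_T)
  finally show "cinner x (T z y) = cinner x (?c *\<^sub>C cauchy1 y z)" by simp
qed

lemma cderiv_T:
  assumes "Im z > 0"
  shows "\<exists>d. cderiv (\<lambda>w. T w y) d z"
proof -
  have "cderiv (cauchy1 y) (cauchy2 y z) z"
    unfolding cauchy2_def cauchy1_def[abs_def] using assms by (intro cderiv_wint_ck bcont_V_orbit) auto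
  then have "cderiv (\<lambda>w. T w y) ((1 / (2 * of_real pi * \<i>)) *\<^sub>C cauchy2 y z) z"
    by (intro cderiv_transform[OF cderiv_scale open_halfspace_Im_gt[of 0]]) (auto simp: assms T_eq_cauchy1)
  then show ?thesis by blast
qed

end

section \<open>Pasting, zeros and boundary uniqueness\<close>

lemma holomorphic_paste_horizontal:
  assumes S: "open S"
    and f: "continuous_on {z\<in>S. Im z \<le> c} f" "f holomorphic_on {z\<in>S. Im z < c}"
    and g: "continuous_on {z\<in>S. c \<le> Im z} g" "g holomorphic_on {z\<in>S. c < Im z}"
    and eq: "\<And>z. z \<in> S \<Longrightarrow> Im z = c \<Longrightarrow> f z = g z"
  shows "(\<lambda>z. if Im z \<le> c then f z else g z) holomorphic_on S"
proof (rule holomorphic_on_paste_across_line[OF S, of \<i> _ c])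
  have *: "S \<inter> {z. \<i> \<bullet> z < c} = {z\<in>S. Im z < c}" "S \<inter> {z. c < \<i> \<bullet> z} = {z\<in>S. c < Im z}"
    by (auto simp: inner_complex_def)
  show "(\<lambda>z. if Im z \<le> c then f z else g z) holomorphic_on (S \<inter> {z. \<i> \<bullet> z < c})"
    unfolding * by (rule holomorphic_transform[OF f(2)]) auto
  show "(\<lambda>z. if Im z \<le> c then f z else g z) holomorphic_on (S \<inter> {z. c < \<i> \<bullet> z})"
    unfolding * by (rule holomorphic_transform[OF g(2)]) auto
  show "continuous_on S (\<lambda>z. if Im z \<le> c then f z else g z)"
    by (rule continuous_on_cases_le[OF f(1) g(1)]) (auto intro!: continuous_intros eq)
qed simp

text \<open>With decreasing \<open>h\<close>, n lines cut \<open>S\<close> into n + 1 pieces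
  numbered from the top; the guards drop the absent upper bound of piece 0 and the absent lower
  bound of piece n.\<close>

definition strip :: "complex set \<Rightarrow> (nat \<Rightarrow> real) \<Rightarrow> nat \<Rightarrow> nat \<Rightarrow> complex set" where
  "strip S h n p = {z\<in>S. (p > 0 \<longrightarrow> Im z \<le> h (p - 1)) \<and> (p < n \<longrightarrow> h p \<le> Im z)}"

definition open_strip :: "complex set \<Rightarrow> (nat \<Rightarrow> real) \<Rightarrow> nat \<Rightarrow> nat \<Rightarrow> complex set" where
  "open_strip S h n p = {z\<in>S. (p > 0 \<longrightarrow> Im z < h (p - 1)) \<and> (p < n \<longrightarrow> h p < Im z)}"

lemma open_open_strip: "open S \<Longrightarrow> open (open_strip S h n p)"
proof -
  assume "open S"
  moreover have "open_strip S h n p = S \<inter> ((if p > 0 then {z. Im z < h (p - 1)} else UNIV) \<inter> (if p < n then {z. h p < Im z} else UNIV))"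
    by (auto simp: open_strip_def)
  ultimately show ?thesis
    by (auto intro!: open_Int simp: open_halfspace_Im_lt open_halfspace_Im_gt)
qed

text \<open>Induction on the number of lines: the two lowest pieces are pasted into one, which then
  serves as the bottom piece for one line fewer.\<close>

lemma holomorphic_paste_strips:
  assumes S: "open S" and h: "\<And>p. h (Suc p) < h p"
    and "\<And>p. p \<le> n \<Longrightarrow> continuous_on (strip S h n p) (g p)"
    and "\<And>p. p \<le> n \<Longrightarrow> g p holomorphic_on (open_strip S h n p)"
    and "\<And>p z. p < n \<Longrightarrow> z \<in> S \<Longrightarrow> Im z = h p \<Longrightarrow> g p z = g (Suc p) z"
  shows "\<exists>G. G holomorphic_on S \<and> (\<forall>p\<le>n. \<forall>z\<in>strip S h n p. G z = g p z)"
  using assms(3-)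
proof (induction n arbitrary: g)
  case 0
  then show ?case by (auto simp: strip_def open_strip_def)
next
  case (Suc n)
  define m where "m z = (if Im z \<le> h n then g (Suc n) z else g n z)" for z
  define g' where "g' = g(n := m)"
  have eq: "g n z = g (Suc n) z" if "z \<in> S" "Im z = h n" for z
    using Suc.prems(3)[of n z] that by simp
  have sub: "{z \<in> strip S h n n. Im z \<le> h n} \<subseteq> strip S h (Suc n) (Suc n)"
    "{z \<in> strip S h n n. h n \<le> Im z} \<subseteq> strip S h (Suc n) n"
    "{z \<in> open_strip S h n n. Im z \<le> h n} \<subseteq> strip S h (Suc n) (Suc n)"
    "{z \<in> open_strip S h n n. h n \<le> Im z} \<subseteq> strip S h (Suc n) n"
    "{z \<in> open_strip S h n n. Im z < h n} \<subseteq> open_strip S h (Suc n) (Suc n)"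
    "{z \<in> open_strip S h n n. h n < Im z} \<subseteq> open_strip S h (Suc n) n"
    by (auto simp: strip_def open_strip_def)
  have "continuous_on (strip S h n n) m"
    unfolding m_def
    by (rule continuous_on_cases_le[OF continuous_on_subset[OF Suc.prems(1) sub(1)]
          continuous_on_subset[OF Suc.prems(1) sub(2)]])
       (auto intro!: continuous_intros eq[symmetric] simp: strip_def)
  moreover have "m holomorphic_on (open_strip S h n n)"
    unfolding m_def
    by (rule holomorphic_paste_horizontal[OF open_open_strip[OF S]
        continuous_on_subset[OF Suc.prems(1) sub(3)] holomorphic_on_subset[OF Suc.prems(2) sub(5)]
        continuous_on_subset[OF Suc.prems(1) sub(4)] holomorphic_on_subset[OF Suc.prems(2) sub(6)]])
       (auto intro!: eq[symmetric] simp: open_strip_def)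
  moreover have "strip S h n p = strip S h (Suc n) p" "open_strip S h n p = open_strip S h (Suc n) p" if "p < n" for p
    using that by (auto simp: strip_def open_strip_def)
  ultimately have "\<exists>G. G holomorphic_on S \<and> (\<forall>p\<le>n. \<forall>z\<in>strip S h n p. G z = g' p z)"
  proof (intro Suc.IH)
    fix p z assume p: "p < n" "z \<in> S" "Im z = h p"
    have "g p z = g (Suc p) z" using p Suc.prems(3)[of p z] by simp
    moreover have "m z = g n z" if "Suc p = n"
      using p(3) h[of p] that by (auto simp: m_def)
    ultimately show "g' p z = g' (Suc p) z" using p by (auto simp: g'_def)
  qed (auto simp: g'_def le_less Suc.prems)
  then obtain G where G: "G holomorphic_on S" "\<And>p z. p \<le> n \<Longrightarrow> z \<in> strip S h n p \<Longrightarrow> G z = g' p z"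
    by blast
  have "G z = g p z" if "p \<le> Suc n" "z \<in> strip S h (Suc n) p" for p z
  proof -
    consider "p < n" | "p = n" | "p = Suc n" using \<open>p \<le> Suc n\<close> by linarith
    then show ?thesis
    proof cases
      case 1
      then show ?thesis using G(2)[of p z] that by (auto simp: strip_def g'_def)
    next
      case 2
      then show ?thesis using G(2)[of n z] that eq[of z] by (auto simp: strip_def g'_def m_def)
    next
      case 3
      \<comment> \<open>The old bottom piece lies below line n, whereas the merged piece is bounded
        by line n - 1; the heights decrease, so the former is contained in the latter.\<close>
      have "n > 0 \<Longrightarrow> h n < h (n - 1)" using h[of "n - 1"] by simp
      then have "n > 0 \<longrightarrow> Im z \<le> h (n - 1)" using that 3 by (auto simp: strip_def)
      then show ?thesis using G(2)[of n z] that 3 by (simp add: strip_def g'_def m_def)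
    qed
  qed
  then show ?case using G(1) by blast
qed

lemma holomorphic_factor_zero:
  assumes "g holomorphic_on S" "open S" "g a = 0"
  shows "\<exists>q. q holomorphic_on S \<and> (\<forall>z\<in>S. g z = (z - a) * q z)"
proof -
  define q where "q z = (if z = a then deriv g a else g z / (z - a))" for z
  have "q holomorphic_on S"
    by (rule pole_theorem_open_0[OF assms(1,2), of a]) (auto simp: q_def assms(3))
  moreover have "g z = (z - a) * q z" for z by (simp add: q_def assms(3))
  ultimately show ?thesis by blast
qed

lemma holomorphic_factor_zeros:
  fixes a :: "nat \<Rightarrow> complex"
  assumes "f holomorphic_on S" "open S" "inj_on a {..<n}"
    "\<And>k. k < n \<Longrightarrow> a k \<in> S \<and> f (a k) = 0"
  shows "\<exists>q. q holomorphic_on S \<and> (\<forall>z\<in>S. f z = (\<Prod>k<n. z - a k) * q z)"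
  using assms(3,4)
proof (induction n)
  case 0
  then show ?case using assms(1) by auto
next
  case (Suc n)
  have "inj_on a {..<n}" by (rule inj_on_subset[OF Suc.prems(1)]) auto
  then obtain q where q: "q holomorphic_on S" "\<And>z. z \<in> S \<Longrightarrow> f z = (\<Prod>k<n. z - a k) * q z"
    using Suc.IH Suc.prems(2) by auto
  have "(\<Prod>k<n. a n - a k) \<noteq> 0"
    using inj_onD[OF Suc.prems(1), of n] by fastforce
  then have "q (a n) = 0" using q(2)[of "a n"] Suc.prems(2)[of n] by auto
  then obtain r where "r holomorphic_on S" "\<And>z. z \<in> S \<Longrightarrow> q z = (z - a n) * r z"
    using holomorphic_factor_zero[OF q(1) assms(2)] by blast
  then show ?case using q(2) by (intro exI[of _ r]) (auto simp: mult_ac)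
qed

text \<open>Divide out the zeros and apply the maximum principle to the quotient on the circle of
  radius \<open>r\<close>, where each factor has modulus at least r - \<delta>. Choosing r < R keeps
  this circle inside the domain of \<open>f\<close>.\<close>

lemma schwarz_zeros:
  fixes a :: "nat \<Rightarrow> complex"
  assumes f: "f holomorphic_on ball 0 R" and K: "\<And>z. z \<in> ball 0 R \<Longrightarrow> cmod (f z) \<le> K"
    and r: "\<delta> < r" "r < R" and a: "inj_on a {..<n}" "\<And>k. k < n \<Longrightarrow> cmod (a k) \<le> \<delta> \<and> f (a k) = 0"
    and z: "cmod z \<le> r"
  shows "cmod (f z) \<le> K * (\<Prod>k<n. cmod (z - a k) / (r - \<delta>))"
proof -
  have aR: "a k \<in> ball 0 R" if "k < n" for k using a(2)[OF that] r by auto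
  obtain q where q: "q holomorphic_on ball 0 R" "\<And>z. z \<in> ball 0 R \<Longrightarrow> f z = (\<Prod>k<n. z - a k) * q z"
    using holomorphic_factor_zeros[OF f open_ball a(1)] a(2) aR by blast
  have sub: "cball 0 r \<subseteq> ball (0::complex) R" using r by auto
  have r0: "r \<ge> 0" using z norm_ge_zero[of z] by linarith
  have "cmod (q z) \<le> K / (r - \<delta>) ^ n"
  proof (rule maximum_modulus_frontier[where S="cball 0 r" and f=q])
    show "q holomorphic_on interior (cball 0 r)"
      using q(1) sub interior_subset by (meson holomorphic_on_subset order_trans)
    show "continuous_on (closure (cball 0 r)) q"
      using holomorphic_on_imp_continuous_on[OF q(1)] sub by (simp add: continuous_on_subset)
    fix w :: complex assume "w \<in> frontier (cball 0 r)"
    then have w: "cmod w = r" using r0 by (auto simp: frontier_cball)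
    then have "w \<in> ball 0 R" using r by simp
    have p: "(r - \<delta>) ^ n \<le> cmod (\<Prod>k<n. w - a k)"
    proof -
      have "(\<Prod>k<n. r - \<delta>) \<le> (\<Prod>k<n. cmod (w - a k))"
      proof (intro prod_mono conjI)
        fix k assume "k \<in> {..<n}"
        then show "r - \<delta> \<le> cmod (w - a k)"
          using a(2)[of k] w norm_triangle_ineq2[of w "a k"] by auto
      qed (use r in auto)
      then show ?thesis by (simp add: prod_norm)
    qed
    have "cmod (q w) * (r - \<delta>) ^ n \<le> cmod (q w) * cmod (\<Prod>k<n. w - a k)"
      by (intro mult_left_mono p) auto
    also have "\<dots> = cmod (f w)" using q(2)[OF \<open>w \<in> ball 0 R\<close>] by (simp add: norm_mult)
    also have "\<dots> \<le> K" by (rule K) fact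
    finally show "cmod (q w) \<le> K / (r - \<delta>) ^ n" using r by (simp add: pos_le_divide_eq)
  qed (use z in auto)
  then have "cmod (\<Prod>k<n. z - a k) * cmod (q z) \<le> cmod (\<Prod>k<n. z - a k) * (K / (r - \<delta>) ^ n)"
    by (intro mult_left_mono) auto
  moreover have "z \<in> ball 0 R" using z r by simp
  ultimately have "cmod (f z) \<le> cmod (\<Prod>k<n. z - a k) * (K / (r - \<delta>) ^ n)"
    using q(2)[of z] by (simp add: norm_mult)
  then show ?thesis by (simp add: prod_dividef prod_norm mult.commute)
qed

text \<open>Extended by 0 below the real interval, \<open>f\<close> becomes holomorphic across it
  and vanishes on a half disc; the identity theorem carries the zero through the strip.\<close>

lemma boundary_uniqueness:
  assumes cont: "continuous_on {z. 0 \<le> Im z \<and> Im z < \<rho>} f"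
    and hol: "f holomorphic_on {z. 0 < Im z \<and> Im z < \<rho>}"
    and \<epsilon>: "\<epsilon> > 0" and zero: "\<And>t. \<bar>t\<bar> < \<epsilon> \<Longrightarrow> f (of_real t) = 0"
    and z: "0 \<le> Im z" "Im z < \<rho>"
  shows "f z = 0"
proof -
  \<comment> \<open>At most \<epsilon>, so that \<open>zero\<close> covers the real points of the
    ball; at most \<rho>, so that its upper half stays in the strip.\<close>
  define \<sigma> where "\<sigma> = min \<epsilon> \<rho>"
  have \<sigma>: "\<sigma> > 0" "\<sigma> \<le> \<rho>" "\<sigma> \<le> \<epsilon>" using \<epsilon> z by (auto simp: \<sigma>_def)
  let ?B = "ball (0::complex) \<sigma>" and ?O = "{z. 0 < Im z \<and> Im z < \<rho>}"
  have Im_lt: "Im w < \<rho>" if "w \<in> ?B" for w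
    using that \<sigma>(2) abs_Im_le_cmod[of w] by auto
  let ?g = "\<lambda>w. if Im w \<le> 0 then 0 else f w"
  have g: "?g holomorphic_on ?B"
  proof (rule holomorphic_paste_horizontal)
    show "continuous_on {z \<in> ?B. 0 \<le> Im z} f" "f holomorphic_on {z \<in> ?B. 0 < Im z}"
      using Im_lt by (auto intro!: continuous_on_subset[OF cont] holomorphic_on_subset[OF hol])
    fix w :: complex assume w: "w \<in> ?B" "Im w = 0"
    have "w = of_real (Re w)" using w by (simp add: complex_eq_iff)
    moreover have "\<bar>Re w\<bar> < \<epsilon>" using w \<sigma>(3) abs_Re_le_cmod[of w] by auto
    ultimately show "0 = f w" using zero[of "Re w"] by simp
  qed auto
  have fO: "f w = 0" if w: "w \<in> ?O" for w
  proof -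
    have g0: "?g w = 0" if "w \<in> ?B" for w
    proof (rule analytic_continuation_open[of "{z\<in>?B. Im z < 0}" ?B ?g "\<lambda>_. 0"])
      show "open {z \<in> ?B. Im z < 0}"
        using open_Int[OF open_ball open_halfspace_Im_lt[of 0], of 0 \<sigma>] by (simp add: Int_def)
      have "- \<i> * of_real (\<sigma> / 2) \<in> {z\<in>?B. Im z < 0}" using \<sigma> by (auto simp: norm_mult)
      then show "{z\<in>?B. Im z < 0} \<noteq> {}" by blast
    qed (use g that in auto)
    show ?thesis
    proof (rule analytic_continuation_open[of "{z\<in>?B. 0 < Im z}" ?O f "\<lambda>_. 0"])
      show "open {z\<in>?B. 0 < Im z}"
        using open_Int[OF open_ball open_halfspace_Im_gt[of 0], of 0 \<sigma>] by (simp add: Int_def)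
      have "\<i> * of_real (\<sigma> / 2) \<in> {z\<in>?B. 0 < Im z}" using \<sigma> by (auto simp: norm_mult)
      then show "{z\<in>?B. 0 < Im z} \<noteq> {}" by blast
      have O: "?O = {z. 0 < Im z} \<inter> {z. Im z < \<rho>}" by auto
      show "open ?O" unfolding O by (intro open_Int open_halfspace_Im_gt open_halfspace_Im_lt)
      show "connected ?O" unfolding O
        by (intro convex_connected convex_Int convex_halfspace_Im_gt convex_halfspace_Im_lt)
      show "f z = 0" if "z \<in> {z\<in>?B. 0 < Im z}" for z using g0[of z] that by auto
    qed (use Im_lt hol w in auto)
  qed
  show ?thesis
  proof (cases "Im z = 0")
    case False
    then show ?thesis using fO z by simp
  next
    case True
    \<comment> \<open>Other boundary points, possibly far from the interval, are approached
      vertically from inside the strip; the factor \<rho> / 2 keeps the approach below its upper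
      edge.\<close>
    define s where "s n = \<rho> / 2 * inverse (real (Suc n))" for n
    define Z where "Z n = z + \<i> * of_real (s n)" for n
    have "Z \<longlonglongrightarrow> z + \<i> * of_real (\<rho> / 2 * 0)"
      unfolding Z_def s_def by (intro tendsto_intros LIMSEQ_inverse_real_of_nat)
    moreover have ZO: "Z n \<in> ?O" for n
    proof -
      have "0 < \<rho>" using z by simp
      moreover have "inverse (real (Suc n)) \<le> 1" "0 < inverse (real (Suc n))" by (auto simp: field_simps)
      ultimately have "0 < s n" "s n \<le> \<rho> / 2 * 1"
        unfolding s_def by (auto intro!: mult_left_mono simp del: of_nat_Suc)
      moreover have "Im (Z n) = s n" using True by (simp add: Z_def)
      ultimately have "0 < Im (Z n)" "Im (Z n) < \<rho>" using \<open>0 < \<rho>\<close> by linarith+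
      then show ?thesis by simp
    qed
    ultimately have "(\<lambda>n. f (Z n)) \<longlonglongrightarrow> f z"
      using z by (intro continuous_on_tendsto_compose[OF cont]) (auto simp: less_imp_le)
    then show ?thesis using fO[OF ZO] by (simp add: LIMSEQ_const_iff)
  qed
qed

text \<open>Identity theorem in the half plane, then continuity at 0. It serves to remove the
  padding \<open>T (\<i> * of_real \<rho>)\<close>.\<close>

lemma boundary_zero_of_line:
  assumes cont: "continuous_on {z. 0 \<le> Im z} f" and hol: "f holomorphic_on {z. 0 < Im z}"
    and \<rho>: "\<rho> > 0" and zero: "\<And>z. Im z = \<rho> \<Longrightarrow> f z = 0"
  shows "f 0 = 0"
proof -
  have fO: "f w = 0" if w: "Im w > 0" for w
  proof (rule analytic_continuation[OF hol, of "{z. Im z = \<rho>}" "\<i> * of_real \<rho>"])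
    show "\<i> * of_real \<rho> islimpt {z. Im z = \<rho>}"
      unfolding islimpt_sequential
    proof (intro exI[of _ "\<lambda>n. \<i> * of_real \<rho> + of_real (inverse (Suc n))"] conjI allI)
      have "(\<lambda>n. \<i> * of_real \<rho> + of_real (inverse (real (Suc n)))) \<longlonglongrightarrow> \<i> * of_real \<rho> + of_real 0"
        by (intro tendsto_intros LIMSEQ_inverse_real_of_nat)
      then show "(\<lambda>n. \<i> * complex_of_real \<rho> + of_real (inverse (real (Suc n)))) \<longlonglongrightarrow> \<i> * of_real \<rho>"
        by simp
    qed (auto simp: complex_eq_iff)
  qed (use \<rho> w zero in \<open>auto simp: open_halfspace_Im_gt convex_connected convex_halfspace_Im_gt\<close>)
  have "(\<lambda>n. \<i> * complex_of_real (inverse (real (Suc n)))) \<longlonglongrightarrow> \<i> * of_real 0"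
    by (intro tendsto_intros LIMSEQ_inverse_real_of_nat)
  then have "(\<lambda>n. f (\<i> * complex_of_real (inverse (real (Suc n))))) \<longlonglongrightarrow> f 0"
    by (intro continuous_on_tendsto_compose[OF cont]) auto
  then show ?thesis using fO by (simp add: LIMSEQ_const_iff)
qed

section \<open>Holomorphic families of contractions\<close>

definition contr :: "('a::chilbert \<Rightarrow> 'a) \<Rightarrow> bool" where
  "contr Q \<longleftrightarrow> clinear Q \<and> (\<forall>x. norm (Q x) \<le> norm x)"

lemma contr_add: "contr Q \<Longrightarrow> Q (x + y) = Q x + Q y"
  and contr_scaleC: "contr Q \<Longrightarrow> Q (c *\<^sub>C x) = c *\<^sub>C Q x"
  and contr_norm: "contr Q \<Longrightarrow> norm (Q x) \<le> norm x"
  unfolding contr_def clinear_def by auto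

lemma contr_zero: "contr Q \<Longrightarrow> Q 0 = 0"
  using contr_scaleC[of Q 0 0] by simp

lemma contr_diff: "contr Q \<Longrightarrow> Q (x - y) = Q x - Q y"
  using contr_add[of Q "x - y" y] by (simp add: algebra_simps)

lemma contr_comp: "contr P \<Longrightarrow> contr Q \<Longrightarrow> contr (\<lambda>x. P (Q x))"
  unfolding contr_def clinear_def by (auto intro: order_trans)

text \<open>The uniform bound 1 lets strong limits be composed: the moving operator may be applied
  to a moving vector.\<close>

lemma contr_tendsto:
  assumes "eventually (\<lambda>z. contr (P z)) F" "(q \<longlongrightarrow> l) F" "((\<lambda>z. P z l) \<longlongrightarrow> m) F"
  shows "((\<lambda>z. P z (q z)) \<longlongrightarrow> m) F"
proof -
  have "((\<lambda>z. norm (q z - l)) \<longlongrightarrow> 0) F"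
    using assms(2) by (intro tendsto_norm_zero) (simp add: LIM_zero)
  moreover have "eventually (\<lambda>z. norm (P z (q z) - P z l) \<le> norm (q z - l)) F"
    using assms(1) by eventually_elim (simp add: contr_diff[symmetric] contr_norm)
  ultimately have "((\<lambda>z. P z (q z) - P z l) \<longlongrightarrow> 0) F"
    by (intro Lim_null_comparison[of "\<lambda>z. P z (q z) - P z l"])
  from tendsto_add[OF this assms(3)] show ?thesis by simp
qed

text \<open>Differentiability is asked on the open part \<open>D\<close> only, but strong continuity
  and the bound 1 on all of \<open>C\<close>: the pieces are later pasted along lines where they are
  merely continuous.\<close>

definition opfam :: "complex set \<Rightarrow> complex set \<Rightarrow> (complex \<Rightarrow> 'a::chilbert \<Rightarrow> 'a) \<Rightarrow> bool" where
  "opfam C D Q \<longleftrightarrow> open D \<and> D \<subseteq> C \<and> (\<forall>z\<in>C. contr (Q z)) \<and>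
    (\<forall>x. continuous_on C (\<lambda>z. Q z x)) \<and> (\<forall>x. \<forall>z\<in>D. \<exists>d. cderiv (\<lambda>w. Q w x) d z)"

lemma opfam_contr: "opfam C D Q \<Longrightarrow> z \<in> C \<Longrightarrow> contr (Q z)"
  by (simp add: opfam_def)

lemma opfam_const: "open D \<Longrightarrow> D \<subseteq> C \<Longrightarrow> contr Q \<Longrightarrow> opfam C D (\<lambda>z. Q)"
  unfolding opfam_def cderiv_def by (auto intro!: exI[of _ 0])

lemma opfam_comp:
  assumes P: "opfam C D P" and Q: "opfam C D Q"
  shows "opfam C D (\<lambda>z x. P z (Q z x))"
proof -
  have D: "open D" "D \<subseteq> C" using P by (auto simp: opfam_def)
  have lim: "((\<lambda>w. P w (q w)) \<longlongrightarrow> P z l) (at z within C)" if z: "z \<in> C" and q: "(q \<longlongrightarrow> l) (at z within C)" for q z l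
  proof (rule contr_tendsto[OF _ q])
    show "eventually (\<lambda>w. contr (P w)) (at z within C)"
      using P unfolding eventually_at_filter opfam_def by (auto intro: always_eventually)
    show "((\<lambda>w. P w l) \<longlongrightarrow> P z l) (at z within C)"
      using P z unfolding opfam_def continuous_on_def by blast
  qed
  have "continuous_on C (\<lambda>z. P z (Q z x))" for x
    unfolding continuous_on_def
    using Q by (intro ballI lim) (auto simp: opfam_def continuous_on_def)
  moreover have "\<exists>d. cderiv (\<lambda>w. P w (Q w x)) d z" if z: "z \<in> D" for x z
  proof -
    obtain d where d: "cderiv (\<lambda>w. Q w x) d z" using Q z unfolding opfam_def by blast
    obtain e where e: "cderiv (\<lambda>w. P w (Q z x)) e z" using P z unfolding opfam_def by blast
    have zC: "z \<in> C" using z D(2) by (rule subsetD[rotated])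
    have at: "at z within C = at z" using z D by (rule at_within_open_subset)
    \<comment> \<open>Product rule with the moving \<open>P w\<close> on the difference quotient of
      \<open>Q\<close>; its limit exists because \<open>P\<close> is uniformly bounded and strongly
      continuous.\<close>
    have "((\<lambda>w. P w ((1 / (w - z)) *\<^sub>C (Q w x - Q z x)) + (1 / (w - z)) *\<^sub>C (P w (Q z x) - P z (Q z x))) \<longlongrightarrow> P z d + e) (at z)"
      by (rule tendsto_add[OF lim[OF zC, unfolded at, OF d[unfolded cderiv_def]] e[unfolded cderiv_def]])
    moreover have "eventually (\<lambda>w. w \<in> D) (at z)"
      using D(1) z by (metis eventually_at_topological)
    then have "eventually (\<lambda>w. P w ((1 / (w - z)) *\<^sub>C (Q w x - Q z x)) + (1 / (w - z)) *\<^sub>C (P w (Q z x) - P z (Q z x))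
       = (1 / (w - z)) *\<^sub>C (P w (Q w x) - P z (Q z x))) (at z)"
    proof eventually_elim
      case (elim w)
      then have "contr (P w)" using D by (intro opfam_contr[OF P]) auto
      then show ?case by (simp add: contr_scaleC contr_diff scaleC_add_right[symmetric])
    qed
    ultimately have "cderiv (\<lambda>w. P w (Q w x)) (P z d + e) z"
      unfolding cderiv_def by (rule Lim_transform_eventually)
    then show ?thesis ..
  qed
  moreover have "contr (\<lambda>x. P z (Q z x))" if "z \<in> C" for z
    by (rule contr_comp[OF opfam_contr[OF P that] opfam_contr[OF Q that]])
  ultimately show ?thesis unfolding opfam_def by (intro conjI allI ballI D)
qed

lemma opfam_cinner:
  assumes "opfam C D Q"
  shows "continuous_on C (\<lambda>z. cinner \<phi> (Q z \<psi>))" "(\<lambda>z. cinner \<phi> (Q z \<psi>)) holomorphic_on D"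
    "z \<in> C \<Longrightarrow> cmod (cinner \<phi> (Q z \<psi>)) \<le> norm \<phi> * norm \<psi>"
proof -
  show "continuous_on C (\<lambda>z. cinner \<phi> (Q z \<psi>))"
    using assms unfolding opfam_def by (intro continuous_intros) auto
  show "(\<lambda>z. cinner \<phi> (Q z \<psi>)) holomorphic_on D"
    unfolding holomorphic_on_def field_differentiable_def
  proof
    fix z assume "z \<in> D"
    then obtain d where "cderiv (\<lambda>w. Q w \<psi>) d z" using assms unfolding opfam_def by blast
    from cderiv_cinner[OF this, of \<phi>]
    show "\<exists>f'. ((\<lambda>z. cinner \<phi> (Q z \<psi>)) has_field_derivative f') (at z within D)"
      by (blast intro: has_field_derivative_at_within)
  qed
  show "cmod (cinner \<phi> (Q z \<psi>)) \<le> norm \<phi> * norm \<psi>" if "z \<in> C"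
  proof -
    have "contr (Q z)" by (rule opfam_contr[OF assms that])
    then have "norm \<phi> * norm (Q z \<psi>) \<le> norm \<phi> * norm \<psi>"
      by (intro mult_left_mono contr_norm) auto
    then show ?thesis using cmod_cinner_le[of \<phi> "Q z \<psi>"] by linarith
  qed
qed

section \<open>Products of slots separated by imaginary times\<close>

fun lchain :: "('a \<Rightarrow> 'a) \<Rightarrow> (nat \<Rightarrow> 'a \<Rightarrow> 'a) \<Rightarrow> nat \<Rightarrow> 'a \<Rightarrow> 'a" where
  "lchain D B 0 x = B 0 x"
| "lchain D B (Suc q) x = lchain D B q (D (B (Suc q) x))"

text \<open>The two chains stand left and right of \<open>A\<close>, and each recursion grows at the
  end facing \<open>A\<close>: \<open>lchain\<close> ends in slot q, \<open>rchain\<close> starts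
  with slot m - k. Moving \<open>A\<close> across one slot is then a single unfolding on either
  side.\<close>

fun rchain :: "('a \<Rightarrow> 'a) \<Rightarrow> (nat \<Rightarrow> 'a \<Rightarrow> 'a) \<Rightarrow> nat \<Rightarrow> nat \<Rightarrow> 'a \<Rightarrow> 'a" where
  "rchain D B m 0 x = B m x"
| "rchain D B m (Suc k) x = B (m - Suc k) (D (rchain D B m k x))"

lemma contr_lchain: "contr D \<Longrightarrow> (\<And>k. contr (B k)) \<Longrightarrow> contr (lchain D B q)"
proof (induction q)
  case 0
  moreover have "lchain D B 0 = B 0" by (rule ext) simp
  ultimately show ?case by simp
next
  case (Suc q)
  have "lchain D B (Suc q) = (\<lambda>x. lchain D B q (D (B (Suc q) x)))" by (rule ext) simp
  moreover have "contr (\<lambda>x. lchain D B q (D (B (Suc q) x)))"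
    by (rule contr_comp[OF Suc.IH[OF Suc.prems] contr_comp[OF Suc.prems]])
  ultimately show ?case by simp
qed

lemma contr_rchain: "contr D \<Longrightarrow> (\<And>k. contr (B k)) \<Longrightarrow> contr (rchain D B m k)"
proof (induction k)
  case 0
  moreover have "rchain D B m 0 = B m" by (rule ext) simp
  ultimately show ?case by simp
next
  case (Suc k)
  have "rchain D B m (Suc k) = (\<lambda>x. B (m - Suc k) (D (rchain D B m k x)))" by (rule ext) simp
  moreover have "contr (\<lambda>x. B (m - Suc k) (D (rchain D B m k x)))"
    by (rule contr_comp[OF Suc.prems(2) contr_comp[OF Suc.prems(1) Suc.IH[OF Suc.prems]]])
  ultimately show ?case by simp
qed

lemma strip_cover: "z \<in> S \<Longrightarrow> \<exists>p\<le>n. z \<in> strip S h n p"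
proof (induction n)
  case 0
  then show ?case by (simp add: strip_def)
next
  case (Suc n)
  then obtain p where p: "p \<le> n" "z \<in> strip S h n p" by blast
  show ?case
  proof (cases "p < n")
    case True
    then show ?thesis using p by (intro exI[of _ p]) (auto simp: strip_def)
  next
    case False
    then show ?thesis using p
      by (cases "h n \<le> Im z") (auto simp: strip_def intro: exI[of _ n] exI[of _ "Suc n"])
  qed
qed

context positive_group
begin

lemma contr_T: "contr (T z)"
  by (simp add: contr_def clinear_T norm_T_le)

lemma contr_V: "contr (V t)"
  by (simp add: contr_def V_clinear)

lemma opfam_T:
  assumes "open D" "D \<subseteq> C" "s \<noteq> 0" "\<And>z. z \<in> D \<Longrightarrow> 0 < Im (s * z + b)"
  shows "opfam C D (\<lambda>z. T (s * z + b))"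
proof -
  have "continuous_on C (\<lambda>z. T (s * z + b) x)" for x
    by (rule continuous_on_compose2[OF continuous_T]) (auto intro!: continuous_intros)
  moreover have "\<exists>d. cderiv (\<lambda>w. T (s * w + b) x) d z" if "z \<in> D" for x z
    using cderiv_T[OF assms(4)[OF that], of x] cderiv_affine[of "\<lambda>w. T w x" _ s z b] assms(3) by blast
  ultimately show ?thesis using assms contr_T by (auto simp: opfam_def)
qed

lemma opfam_T_upper: "opfam {z. 0 \<le> Im z} {z. 0 < Im z} T"
  using opfam_T[of "{z. 0 < Im z}" "{z. 0 \<le> Im z}" 1 0]
  by (simp add: open_halfspace_Im_gt Collect_mono)

lemma T_zero: "T 0 y = y"
  using T_real[of 0 y] by (simp add: V_zero)

text \<open>A zero at i \<rho> spreads along the line Im z = \<rho> because \<open>V\<close> acts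
  isometrically there. This strips the padding on the left.\<close>

lemma T_injective:
  assumes \<rho>: "\<rho> > 0" and x: "T (\<i> * of_real \<rho>) x = 0"
  shows "x = 0"
proof (rule cinner_ext)
  fix y
  have "cinner y (T 0 x) = 0"
  proof (rule boundary_zero_of_line[OF opfam_cinner(1,2)[OF opfam_T_upper] \<rho>])
    fix z assume "Im z = \<rho>"
    then have "z = \<i> * of_real \<rho> + of_real (Re z)" by (simp add: complex_eq_iff)
    then have "T z x = V (Re z) (T (\<i> * of_real \<rho>) x)" by (metis V_T)
    then show "cinner y (T z x) = 0" using x contr_zero[OF contr_V] by simp
  qed
  then show "cinner y x = cinner y 0" by (simp add: T_zero)
qed

text \<open>Density of the range, stated in the form in which it is used: an operator that kills the
  range is 0. This strips the padding on the right.\<close>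

lemma T_dense_range:
  assumes \<rho>: "\<rho> > 0" and Q: "contr Q" and zero: "\<And>\<psi>. Q (T (\<i> * of_real \<rho>) \<psi>) = 0"
  shows "Q \<psi> = 0"
proof (rule cinner_ext)
  fix y
  have fam: "opfam {z. 0 \<le> Im z} {z. 0 < Im z} (\<lambda>z x. Q (T z x))"
    by (rule opfam_comp[OF opfam_const opfam_T_upper]) (auto simp: Q open_halfspace_Im_gt)
  have "cinner y (Q (T 0 \<psi>)) = 0"
  proof (rule boundary_zero_of_line[OF opfam_cinner(1,2)[OF fam] \<rho>])
    fix z assume "Im z = \<rho>"
    then have "z = \<i> * of_real \<rho> + of_real (Re z)" by (simp add: complex_eq_iff)
    then have "T z \<psi> = T (\<i> * of_real \<rho>) (V (Re z) \<psi>)" by (metis T_V)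
    then show "cinner y (Q (T z \<psi>)) = 0" using zero by simp
  qed
  then show "cinner y (Q \<psi>) = cinner y 0" by (simp add: T_zero)
qed

text \<open>For 1 \<le> p \<le> m, piece p of the pasted function is the matrix element of T(z + i
  rho) B_0 T(i eta) ... B_(p-1) T(-z - i (p-1) eta) A T(z + i p eta) B_p T(i eta) ... B_m T(-z + i
  (rho - m eta)); slot k sits at time z + i k eta. Strip p is where both exponents next to A lie in
  the closed upper half plane. At p = 0 and p = m + 1 the side of A without slots is just T(i
  rho).\<close>

lemma slots_bound_spaced:
  fixes B :: "nat \<Rightarrow> 'a \<Rightarrow> 'a" and m :: nat and \<eta> :: real
  assumes A: "contr A" and B: "\<And>k. contr (B k)"
    and AB: "\<And>k x. A (B k x) = 0"
    and comm: "\<And>k t x. \<bar>t\<bar> < \<epsilon> \<Longrightarrow> A (V t (B k (V (- t) x))) = V t (B k (V (- t) (A x)))"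
    and r: "r < R" "R \<le> \<epsilon>" and t: "\<bar>t\<bar> \<le> r" and \<eta>: "0 < \<eta>" "m * \<eta> < r"
  defines "\<rho> \<equiv> 2 * R"
  shows "cmod (cinner \<phi> (T (\<i> * of_real \<rho>) (A (V t (rchain (T (\<i> * of_real \<eta>)) B m m
      (T (of_real (- t) + \<i> * of_real (\<rho> - m * \<eta>)) \<psi>))))))
    \<le> norm \<phi> * norm \<psi> * (\<Prod>k<Suc m. cmod (of_real t + \<i> * of_real (k * \<eta>)) / (r - m * \<eta>))"
proof -
  have R: "R > 0" using r t by linarith
  define S where "S = ball (0::complex) R"
  \<comment> \<open>The height at which the time of slot \<open>p\<close> becomes real, so that
    \<open>A\<close> may change sides.\<close>
  define h where "h p = - (real p * \<eta>)" for p
  define D where "D = T (\<i> * of_real \<eta>)"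
  \<comment> \<open>With p slots to the left of \<open>A\<close> the last one has index q = p - 1.
    The forms \<open>1 * z\<close> and \<open>(- 1) * z\<close> match the pattern
    \<open>s * z + b\<close> of \<open>opfam_T\<close>.\<close>
  define L where "L p z = (case p of 0 \<Rightarrow> T (\<i> * of_real \<rho>)
     | Suc q \<Rightarrow> (\<lambda>x. T (1 * z + \<i> * of_real \<rho>) (lchain D B q (T ((- 1) * z + (- \<i> * of_real (q * \<eta>))) x))))" for p z
  define W where "W p z = (if p \<le> m
     then (\<lambda>x. T (1 * z + \<i> * of_real (p * \<eta>)) (rchain D B m (m - p) (T ((- 1) * z + \<i> * of_real (\<rho> - m * \<eta>)) x)))
     else T (\<i> * of_real \<rho>))" for p z
  define g where "g p z = cinner \<phi> (L p z (A (W p z \<psi>)))" for p z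
  have D: "contr D" unfolding D_def by (rule contr_T)
  have S: "open S" "\<And>z. z \<in> S \<Longrightarrow> \<bar>Im z\<bar> < R \<and> \<bar>Re z\<bar> < R"
    unfolding S_def using abs_Im_le_cmod abs_Re_le_cmod by (auto intro: order_le_less_trans)
  have h_dec: "h (Suc p) < h p" for p using \<eta> by (simp add: h_def algebra_simps)
  have osub: "open_strip S h n p \<subseteq> strip S h n p" for n p
    by (auto simp: strip_def open_strip_def)
  note opn = open_open_strip[OF S(1)]
  have fam: "opfam (strip S h (Suc m) p) (open_strip S h (Suc m) p) (\<lambda>z x. L p z (A (W p z x)))"
    if p: "p \<le> Suc m" for p
  proof -
    have "opfam (strip S h (Suc m) p) (open_strip S h (Suc m) p) (\<lambda>z x. L p z x)"
    proof (cases p)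
      case 0
      then show ?thesis unfolding L_def by (auto intro!: opfam_const opn osub contr_T)
    next
      case (Suc q)
      have "opfam (strip S h (Suc m) p) (open_strip S h (Suc m) p) (\<lambda>z x. T (1 * z + \<i> * of_real \<rho>) (lchain D B q (T ((- 1) * z + (- \<i> * of_real (q * \<eta>))) x)))"
      proof (rule opfam_comp[OF opfam_T opfam_comp[OF opfam_const opfam_T]],
          rule_tac [7] contr_lchain[OF D B])
        fix z assume z: "z \<in> open_strip S h (Suc m) p"
        then have "Im z < h q" "z \<in> S" using Suc by (auto simp: open_strip_def)
        then show "0 < Im (1 * z + \<i> * of_real \<rho>)" "0 < Im ((- 1) * z + (- \<i> * of_real (q * \<eta>)))"
          using S(2)[of z] R by (auto simp: \<rho>_def h_def)
      qed (auto simp: opn intro!: osub)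
      then show ?thesis unfolding L_def Suc by simp
    qed
    moreover have "opfam (strip S h (Suc m) p) (open_strip S h (Suc m) p) (\<lambda>z x. W p z x)"
    proof (cases "p \<le> m")
      case False
      then show ?thesis unfolding W_def by (auto intro!: opfam_const opn osub contr_T)
    next
      case True
      have "opfam (strip S h (Suc m) p) (open_strip S h (Suc m) p) (\<lambda>z x. T (1 * z + \<i> * of_real (p * \<eta>)) (rchain D B m (m - p) (T ((- 1) * z + \<i> * of_real (\<rho> - m * \<eta>)) x)))"
      proof (rule opfam_comp[OF opfam_T opfam_comp[OF opfam_const opfam_T]],
          rule_tac [7] contr_rchain[OF D B])
        \<comment> \<open>Here Im z < R and m * \<eta> < r < R, so \<rho> = 2 * R is enough to keep
          the outermost exponent in the upper half plane.\<close>
        fix z assume z: "z \<in> open_strip S h (Suc m) p"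
        then have "h p < Im z" "z \<in> S" using True by (auto simp: open_strip_def)
        then show "0 < Im (1 * z + \<i> * of_real (p * \<eta>))" "0 < Im ((- 1) * z + \<i> * of_real (\<rho> - m * \<eta>))"
          using S(2)[of z] R \<eta> r by (auto simp: \<rho>_def h_def)
      qed (auto simp: opn intro!: osub)
      then show ?thesis unfolding W_def using True by simp
    qed
    ultimately show ?thesis
      by (rule opfam_comp[OF _ opfam_comp[OF opfam_const[OF opn osub A]]])
  qed
  \<comment> \<open>On the line Im z = h p the exponents adjacent to slot p turn into
    \<open>V \<tau>\<close> and \<open>V (- \<tau>)\<close> with real \<tau>, so neighbouring pieces
    differ only by commuting \<open>A\<close> with the translated slot.\<close>
  have match: "L (Suc p) z x = L p z (V \<tau> (B p (V (- \<tau>) x)))"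
       "W p z x = V \<tau> (B p (V (- \<tau>) (W (Suc p) z x)))"
    if p: "p \<le> m" and z: "z = of_real \<tau> + \<i> * of_real (h p)" for p z \<tau> x
  proof -
    have e1: "T (z + \<i> * of_real (real p * \<eta>)) y = V \<tau> y" for y
      using T_real[of \<tau> y] by (simp add: z h_def)
    have e2: "T (- z - \<i> * of_real (real p * \<eta>)) y = V (- \<tau>) y" for y
      using T_real[of "- \<tau>" y] by (simp add: z h_def)
    show "L (Suc p) z x = L p z (V \<tau> (B p (V (- \<tau>) x)))"
    proof (cases p)
      case 0
      then show ?thesis using e2[of x] by (simp add: L_def T_V z h_def add.commute)
    next
      case (Suc q)
      have "T (- z - \<i> * of_real (real q * \<eta>)) (V \<tau> y) = D y" for y
        unfolding T_V D_def by (simp add: z h_def Suc algebra_simps)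
      then show ?thesis using e2[of x] by (simp add: L_def Suc algebra_simps)
    qed
    show "W p z x = V \<tau> (B p (V (- \<tau>) (W (Suc p) z x)))"
    proof (cases "p = m")
      case True
      have "T (- z + \<i> * of_real (\<rho> - real m * \<eta>)) x = V (- \<tau>) (T (\<i> * of_real \<rho>) x)"
        unfolding V_T by (simp add: z h_def True algebra_simps)
      then show ?thesis using True e1 by (simp add: W_def)
    next
      case False
      then have Suc: "m - p = Suc (m - Suc p)" "Suc p \<le> m" "m - Suc (m - Suc p) = p" using p by auto
      have "V (- \<tau>) (T (z + \<i> * of_real (real (Suc p) * \<eta>)) y) = D y" for y
        unfolding V_T D_def by (simp add: z h_def algebra_simps)
      then show ?thesis using p Suc e1 by (simp add: W_def algebra_simps)
    qed
  qed
  have Llin: "L p z 0 = 0" for p z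
    unfolding L_def by (cases p) (auto simp: contr_zero contr_T contr_lchain[OF D B])
  have "\<exists>G. G holomorphic_on S \<and> (\<forall>p\<le>Suc m. \<forall>z\<in>strip S h (Suc m) p. G z = g p z)"
  proof (rule holomorphic_paste_strips[where h=h and g=g, OF S(1)])
    show "h (Suc p) < h p" for p by (rule h_dec)
  next
    fix p assume p: "p \<le> Suc m"
    show "continuous_on (strip S h (Suc m) p) (g p)" "g p holomorphic_on open_strip S h (Suc m) p"
      unfolding g_def using opfam_cinner(1,2)[OF fam[OF p]] by blast+
  next
    fix p z assume p: "p < Suc m" and z: "z \<in> S" "Im z = h p"
    have e: "z = of_real (Re z) + \<i> * of_real (h p)" using z by (simp add: complex_eq_iff)
    have "\<bar>Re z\<bar> < \<epsilon>" using S(2)[OF z(1)] r by linarith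
    then show "g p z = g (Suc p) z"
      using p by (simp add: g_def match(1)[OF _ e] match(2)[OF _ e] comm)
  qed
  then obtain G where G: "G holomorphic_on S" "\<And>p z. p \<le> Suc m \<Longrightarrow> z \<in> strip S h (Suc m) p \<Longrightarrow> G z = g p z"
    by blast
  define a where "a k = - \<i> * of_real (real k * \<eta>)" for k
  have "cmod (G (of_real t)) \<le> norm \<phi> * norm \<psi> * (\<Prod>k<Suc m. cmod (of_real t - a k) / (r - m * \<eta>))"
  proof (rule schwarz_zeros)
    show "G holomorphic_on ball 0 R" using G(1) by (simp add: S_def)
    show "cmod (G z) \<le> norm \<phi> * norm \<psi>" if z: "z \<in> ball 0 R" for z
    proof -
      obtain p where p: "p \<le> Suc m" "z \<in> strip S h (Suc m) p"
        using strip_cover[of z S "Suc m" h] z unfolding S_def by blast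
      show ?thesis using opfam_cinner(3)[OF fam[OF p(1)] p(2)] G(2)[OF p] by (simp add: g_def)
    qed
    show "inj_on a {..<Suc m}" using \<eta> by (auto simp: a_def inj_on_def complex_eq_iff)
    fix k assume k: "k < Suc m"
    have ak: "cmod (a k) \<le> m * \<eta>" using k \<eta> by (simp add: a_def norm_mult)
    moreover have "G (a k) = 0"
    proof -
      \<comment> \<open>At this point slot k stands at time 0 immediately to the right of
        \<open>A\<close>, which annihilates it.\<close>
      have e: "a k = of_real 0 + \<i> * of_real (h k)" by (simp add: a_def h_def)
      have "a k \<in> strip S h (Suc m) k"
        using k \<eta> r ak by (auto simp: strip_def S_def a_def h_def)
      then have "G (a k) = g k (a k)" using G(2) k by simp
      also have "\<dots> = 0" using k by (simp add: g_def match(2)[OF _ e] V_zero AB Llin)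
      finally show ?thesis .
    qed
    ultimately show "cmod (a k) \<le> m * \<eta> \<and> G (a k) = 0" ..
  qed (use \<eta> r t in auto)
  moreover have "G (of_real t) = cinner \<phi> (T (\<i> * of_real \<rho>) (A (V t (rchain D B m m (T (of_real (- t) + \<i> * of_real (\<rho> - m * \<eta>)) \<psi>)))))"
  proof -
    \<comment> \<open>Real points lie in the top strip, since h 0 = 0: there \<open>A\<close> stands
      to the left of all slots.\<close>
    have "of_real t \<in> strip S h (Suc m) 0" using r t by (auto simp: strip_def S_def h_def)
    then have "G (of_real t) = g 0 (of_real t)" using G(2) by simp
    then show ?thesis by (simp add: g_def L_def W_def T_real)
  qed
  ultimately show ?thesis by (simp add: a_def D_def)
qed

lemma rchain_tendsto:
  assumes "\<And>k. contr (B k)" "(x \<longlongrightarrow> x0) F" "((\<lambda>u. D u) \<longlongrightarrow> 0) F"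
  shows "((\<lambda>u. rchain (T (D u)) B m k (x u)) \<longlongrightarrow> rchain (\<lambda>y. y) B m k x0) F"
proof (induction k)
  case 0
  show ?case
    using contr_tendsto[where P="\<lambda>_. B m", OF always_eventually assms(2) tendsto_const] assms(1) by simp
next
  case (Suc k)
  have "((\<lambda>u. T (D u) y) \<longlongrightarrow> T 0 y) F" for y
    by (rule continuous_on_tendsto_compose[OF continuous_T assms(3)]) auto
  from contr_tendsto[where P="\<lambda>u. T (D u)", OF always_eventually Suc this[unfolded T_zero]]
  have "((\<lambda>u. T (D u) (rchain (T (D u)) B m k (x u))) \<longlongrightarrow> rchain (\<lambda>y. y) B m k x0) F"
    by (simp add: contr_T)
  from contr_tendsto[where P="\<lambda>_. B (m - Suc k)", OF always_eventually this tendsto_const]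
  show ?case using assms(1) by simp
qed

text \<open>The slots, spread out over imaginary times, give one zero each; letting the spacing tend to 0
  the function acquires a zero of order \<open>Suc m\<close> at 0 while its bound does not depend on \<open>m\<close>.\<close>

lemma slots_bound:
  fixes B :: "nat \<Rightarrow> 'a \<Rightarrow> 'a" and m :: nat
  assumes A: "contr A" and B: "\<And>k. contr (B k)"
    and AB: "\<And>k x. A (B k x) = 0"
    and comm: "\<And>k t x. \<bar>t\<bar> < \<epsilon> \<Longrightarrow> A (V t (B k (V (- t) x))) = V t (B k (V (- t) (A x)))"
    and r: "0 < r" "r < R" "R \<le> \<epsilon>" and t: "\<bar>t\<bar> \<le> r"
  defines "\<rho> \<equiv> 2 * R"
  shows "cmod (cinner \<phi> (T (\<i> * of_real \<rho>) (A (V t (rchain (\<lambda>y. y) B m m (V (- t) (T (\<i> * of_real \<rho>) \<psi>)))))))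
    \<le> norm \<phi> * norm \<psi> * (\<bar>t\<bar> / r) ^ Suc m"
proof (rule tendsto_le)
  \<comment> \<open>The limit is taken from the right: positive spacing keeps the zeros distinct and
    the exponents in the upper half plane.\<close>
  let ?F = "at_right (0::real)"
  let ?f = "\<lambda>\<eta>::real. cmod (cinner \<phi> (T (\<i> * of_real \<rho>) (A (V t (rchain (T (\<i> * of_real \<eta>)) B m m
      (T (of_real (- t) + \<i> * of_real (\<rho> - m * \<eta>)) \<psi>))))))"
  let ?g = "\<lambda>\<eta>::real. norm \<phi> * norm \<psi> * (\<Prod>k<Suc m. cmod (of_real t + \<i> * of_real (k * \<eta>)) / (r - m * \<eta>))"
  show "?F \<noteq> bot" by simp
  have lin: "((\<lambda>\<eta>. real k * \<eta>) \<longlongrightarrow> 0) ?F" for k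
    using tendsto_mult[OF tendsto_const[of "real k"] tendsto_ident_at[of 0]] by simp
  show "(?g \<longlongrightarrow> norm \<phi> * norm \<psi> * (\<bar>t\<bar> / r) ^ Suc m) ?F"
  proof -
    have "(?g \<longlongrightarrow> norm \<phi> * norm \<psi> * (\<Prod>k<Suc m. cmod (of_real t + \<i> * of_real 0) / (r - 0))) ?F"
      using r by (intro tendsto_intros lin) auto
    then show ?thesis by simp
  qed
  show "(?f \<longlongrightarrow> cmod (cinner \<phi> (T (\<i> * of_real \<rho>) (A (V t (rchain (\<lambda>y. y) B m m (V (- t) (T (\<i> * of_real \<rho>) \<psi>))))))) ) ?F"
  proof -
    have "((\<lambda>\<eta>. T (of_real (- t) + \<i> * of_real (\<rho> - m * \<eta>)) \<psi>) \<longlongrightarrow> T (of_real (- t) + \<i> * of_real (\<rho> - 0)) \<psi>) ?F"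
      by (rule continuous_on_tendsto_compose[OF continuous_T])
         (intro tendsto_intros lin, simp_all)
    also have "T (of_real (- t) + \<i> * of_real (\<rho> - 0)) \<psi> = V (- t) (T (\<i> * of_real \<rho>) \<psi>)"
      by (simp add: V_T)
    finally have 1: "((\<lambda>\<eta>. rchain (T (\<i> * of_real \<eta>)) B m m (T (of_real (- t) + \<i> * of_real (\<rho> - m * \<eta>)) \<psi>))
       \<longlongrightarrow> rchain (\<lambda>y. y) B m m (V (- t) (T (\<i> * of_real \<rho>) \<psi>))) ?F"
      by (intro rchain_tendsto B) (auto intro!: tendsto_eq_intros)
    have "contr (\<lambda>x. T (\<i> * of_real \<rho>) (A (V t x)))"
      by (rule contr_comp[OF contr_T contr_comp[OF A contr_V]])
    then have "((\<lambda>\<eta>. T (\<i> * of_real \<rho>) (A (V t (rchain (T (\<i> * of_real \<eta>)) B m m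
        (T (of_real (- t) + \<i> * of_real (\<rho> - m * \<eta>)) \<psi>)))))
      \<longlongrightarrow> T (\<i> * of_real \<rho>) (A (V t (rchain (\<lambda>y. y) B m m (V (- t) (T (\<i> * of_real \<rho>) \<psi>)))))) ?F"
      by (intro contr_tendsto[where P="\<lambda>_ x. T (\<i> * of_real \<rho>) (A (V t x))", OF always_eventually 1 tendsto_const]) simp
    then show ?thesis by (intro tendsto_norm tendsto_cinner tendsto_const)
  qed
  have "eventually (\<lambda>\<eta>. m * \<eta> < r) ?F"
    by (rule order_tendstoD(2)[of _ 0]) (auto intro!: tendsto_eq_intros simp: r)
  moreover have "eventually (\<lambda>\<eta>. 0 < \<eta>) ?F" by (rule eventually_at_right_less)
  ultimately show "eventually (\<lambda>\<eta>. ?f \<eta> \<le> ?g \<eta>) ?F"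
  proof eventually_elim
    case (elim \<eta>)
    show ?case unfolding \<rho>_def by (rule slots_bound_spaced[OF A B AB comm]) (use r t elim in auto)
  qed
qed

end

section \<open>Effects\<close>

lemma cnorm_chilbert: "cnorm = (norm :: 'a::chilbert \<Rightarrow> real)"
  by (rule ext) (rule cnorm_eq_norm)

lemma effect_lin:
  assumes "effect E"
  shows "E (x + y) = E x + E y" "E (c *\<^sub>C x) = c *\<^sub>C E x"
  using assms unfolding effect_def bounded_op_def clinear_def by blast+

lemma effect_diff: "effect E \<Longrightarrow> E (x - y) = E x - E (y::'a::complex_hilbert)"
  using effect_lin(1)[of E "x - y" y] by (simp add: algebra_simps)

lemma effect_pos: "effect E \<Longrightarrow> 0 \<le> Re (cinner x (E x))"
  and effect_le: "effect E \<Longrightarrow> Re (cinner x (E x)) \<le> Re (cinner x x)"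
  and effect_Im: "effect E \<Longrightarrow> Im (cinner x (E x)) = 0"
  unfolding effect_def by blast+

text \<open>Polarisation: real expectations at x + y and x + i y give the imaginary and the real
  part of the symmetry.\<close>

lemma effect_selfadjoint:
  assumes "effect E"
  shows "cinner (E x) y = cinner x (E y)"
proof -
  note l = effect_lin[OF assms] and z = effect_Im[OF assms]
  have 1: "Im (cinner x (E y)) + Im (cinner y (E x)) = 0"
    using z[of "x + y"] z[of x] z[of y] by (simp add: l cinner_add_left cinner_add_right)
  have 2: "Re (cinner x (E y)) - Re (cinner y (E x)) = 0"
    using z[of "x + \<i> *\<^sub>C y"] z[of x] z[of y]
    by (simp add: l cinner_add_left cinner_add_right cinner_scaleC_left cinner_scaleC_right)
  have "cinner (E x) y = cnj (cinner y (E x))" by (rule cinner_conj)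
  then show ?thesis using 1 2 by (simp add: complex_eq_iff)
qed

text \<open>E^2 \<le> E without square roots: positivity at x - E x reads E - 2 E^2 + E^3 \<ge> 0,
  and E^3 \<le> E^2 is the upper bound at E x.\<close>

lemma effect_square_le:
  assumes "effect E"
  shows "Re (cinner (E x) (E x)) \<le> Re (cinner x (E x))"
proof -
  have "0 \<le> Re (cinner (x - E x) (E (x - E x)))" by (rule effect_pos[OF assms])
  moreover have "Re (cinner (E x) (E (E x))) \<le> Re (cinner (E x) (E x))" by (rule effect_le[OF assms])
  moreover have "cinner x (E (E x)) = cinner (E x) (E x)" by (rule effect_selfadjoint[OF assms, symmetric])
  ultimately show ?thesis
    by (simp add: effect_diff[OF assms] cinner_diff_left cinner_diff_right)
qed

lemma effectI:
  fixes E :: "'a::chilbert \<Rightarrow> 'a"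
  assumes "contr E" "\<And>x. Im (cinner x (E x)) = 0" "\<And>x. 0 \<le> Re (cinner x (E x))"
    "\<And>x. Re (cinner x (E x)) \<le> Re (cinner x x)"
  shows "effect E"
  using assms unfolding effect_def bounded_op_def contr_def cnorm_chilbert
  by (auto intro!: exI[of _ 1])

lemma contr_effect:
  fixes E :: "'a::chilbert \<Rightarrow> 'a"
  assumes "effect E"
  shows "contr E"
proof -
  have "norm (E x) \<le> norm x" for x
    using effect_square_le[OF assms, of x] effect_le[OF assms, of x]
    by (simp add: norm_eq_sqrt_inner inner_eq_Re_cinner)
  moreover have "clinear E" using assms by (simp add: effect_def bounded_op_def)
  ultimately show ?thesis by (simp add: contr_def)
qed

lemma effect_complement:
  fixes E :: "'a::chilbert \<Rightarrow> 'a"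
  assumes "effect E"
  shows "effect (\<lambda>x. x - E x)"
proof -
  let ?F = "\<lambda>x. x - E x"
  have "norm (?F x) \<le> norm x" for x
  proof -
    have "Re (cinner (?F x) (?F x)) \<le> Re (cinner x x)"
      using effect_square_le[OF assms, of x] effect_pos[OF assms, of x] effect_selfadjoint[OF assms, of x x]
      by (simp add: cinner_diff_left cinner_diff_right)
    then show ?thesis by (simp add: norm_eq_sqrt_inner inner_eq_Re_cinner)
  qed
  then have "contr ?F"
    unfolding contr_def clinear_def by (simp add: effect_lin[OF assms] scaleC_diff_right)
  then show ?thesis
    by (rule effectI)
       (simp_all add: cinner_diff_right effect_Im[OF assms] effect_pos[OF assms] effect_le[OF assms])
qed

lemma effect_id: "effect (\<lambda>x::'a::chilbert. x)"
  by (rule effectI) (auto simp: contr_def clinear_def cinner_pos)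

text \<open>One factor is moved to each side of the inner product, E^(j+2) = E E^j E, so positivity
  and the upper bound come from E^j; hence the two base cases.\<close>

lemma effect_funpow:
  fixes E :: "'a::chilbert \<Rightarrow> 'a"
  assumes "effect E"
  shows "effect (E ^^ k)"
proof (induction k rule: less_induct)
  case (less k)
  consider "k = 0" | "k = 1" | j where "k = Suc (Suc j)"
    by (metis One_nat_def not0_implies_Suc)
  then show ?case
  proof cases
    case 1
    then show ?thesis using effect_id by (simp add: id_def)
  next
    case 2
    then show ?thesis using assms by simp
  next
    case (3 j)
    have j: "effect (E ^^ j)" using less[of j] 3 by simp
    have eq: "E ^^ k = (\<lambda>x. E ((E ^^ j) (E x)))"
      unfolding 3 funpow.simps(2) by (rule ext) (simp add: funpow_swap1)
    have e: "cinner x ((E ^^ k) x) = cinner (E x) ((E ^^ j) (E x))" for x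
      unfolding eq by (rule effect_selfadjoint[OF assms, symmetric])
    have c: "contr (E ^^ k)"
      unfolding eq by (rule contr_comp[OF contr_effect[OF assms] contr_comp[OF contr_effect[OF j] contr_effect[OF assms]]])
    show ?thesis
    proof (rule effectI[OF c])
      fix x
      show "Im (cinner x ((E ^^ k) x)) = 0" unfolding e by (rule effect_Im[OF j])
      show "0 \<le> Re (cinner x ((E ^^ k) x))" unfolding e by (rule effect_pos[OF j])
      have "Re (cinner x ((E ^^ k) x)) \<le> Re (cinner (E x) (E x))" unfolding e by (rule effect_le[OF j])
      also have "\<dots> \<le> Re (cinner x x)"
        using effect_square_le[OF assms, of x] effect_le[OF assms, of x] by linarith
      finally show "Re (cinner x ((E ^^ k) x)) \<le> Re (cinner x x)" .
    qed
  qed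
qed

text \<open>\<open>compl_pow B N\<close> approximates the support projection of \<open>B\<close> as \<open>N\<close> grows, without
  invoking the spectral theorem.\<close>

definition compl_pow :: "('a::chilbert \<Rightarrow> 'a) \<Rightarrow> nat \<Rightarrow> 'a \<Rightarrow> 'a" where
  "compl_pow B N x = x - ((\<lambda>y. y - B y) ^^ N) x"

lemma effect_compl_pow: "effect B \<Longrightarrow> effect (compl_pow B N)"
  unfolding compl_pow_def[abs_def] by (intro effect_complement effect_funpow)

text \<open>With C = 1 - B the numbers <x, C^k x> decrease to a limit, and the square of the norm of
  B C^m x is at most <C^m x, B C^m x>, the difference of the terms 2 m and 2 m + 1.\<close>

lemma complement_powers_vanish:
  fixes B :: "'a::chilbert \<Rightarrow> 'a"
  assumes B: "effect B"
  shows "(\<lambda>N. B (((\<lambda>y. y - B y) ^^ N) x)) \<longlonglongrightarrow> 0"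
proof -
  define C where "C = (\<lambda>y. y - B y)"
  have C: "effect C" unfolding C_def by (rule effect_complement[OF B])
  note Ck = effect_funpow[OF C]
  define c where "c k = Re (cinner x ((C ^^ k) x))" for k
  have c_add: "c (m + k) = Re (cinner ((C ^^ m) x) ((C ^^ k) x))" for m k
    unfolding c_def funpow_add comp_def using effect_selfadjoint[OF Ck, of m x "(C ^^ k) x"] by simp
  have dec: "c (Suc k) \<le> c k" for k
  \<comment> \<open>Splitting the power evenly leaves C \<le> 1 for even k and C^2 \<le> C for odd
    k.\<close>
  proof (cases "even k")
    case True
    then obtain m where k: "k = m + m" by (metis evenE mult_2)
    have "c (Suc k) = Re (cinner ((C ^^ m) x) (C ((C ^^ m) x)))" using c_add[of m "Suc m"] k by simp
    also have "\<dots> \<le> c k" using effect_le[OF C] c_add[of m m] k by simp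
    finally show ?thesis .
  next
    case False
    then obtain m where k: "k = m + Suc m" by (metis oddE add_Suc_right add.commute mult_2 plus_1_eq_Suc)
    have "c (Suc k) = Re (cinner (C ((C ^^ m) x)) (C ((C ^^ m) x)))" using c_add[of "Suc m" "Suc m"] k by simp
    also have "\<dots> \<le> c k" using effect_square_le[OF C, of "(C ^^ m) x"] c_add[of m "Suc m"] k by simp
    finally show ?thesis .
  qed
  have "decseq c" using dec by (simp add: decseq_Suc_iff)
  moreover have "\<bar>c k\<bar> \<le> norm x * norm x" for k
    unfolding c_def
    using effect_le[OF Ck, of x k] effect_pos[OF Ck, of x k]
    by (simp add: inner_eq_Re_cinner[symmetric] power2_eq_square dot_square_norm)
  ultimately obtain L where "c \<longlonglongrightarrow> L"
    using decseq_convergent[of c "- (norm x * norm x)"] by (metis abs_le_D2 minus_le_iff)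
  then have "(\<lambda>m. c (m + m)) \<longlonglongrightarrow> L" "(\<lambda>m. c (Suc (m + m))) \<longlonglongrightarrow> L"
    using LIMSEQ_subseq_LIMSEQ[of c L "\<lambda>m. m + m"] LIMSEQ_subseq_LIMSEQ[of c L "\<lambda>m. Suc (m + m)"]
    by (auto simp: strict_mono_def comp_def)
  from tendsto_diff[OF this] have "(\<lambda>m. c (m + m) - c (Suc (m + m))) \<longlonglongrightarrow> 0" by simp
  from tendsto_real_sqrt[OF this] have lim: "(\<lambda>m. sqrt (c (m + m) - c (Suc (m + m)))) \<longlonglongrightarrow> 0"
    by simp
  have le: "norm (B ((C ^^ m) x)) \<le> sqrt (c (m + m) - c (Suc (m + m)))" for m
  proof -
    let ?y = "(C ^^ m) x"
    have "Re (cinner ?y (B ?y)) = c (m + m) - c (m + Suc m)"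
      unfolding c_add by (simp add: C_def cinner_diff_right)
    then show ?thesis using effect_square_le[OF B, of ?y]
      by (simp add: norm_eq_sqrt_inner inner_eq_Re_cinner)
  qed
  show ?thesis
    unfolding C_def[symmetric] by (rule Lim_null_comparison[OF always_eventually[OF allI[OF le]] lim])
qed

text \<open>A substitute for the idempotence of a projection: in B Y^(n+1) = B Y^n - Y^n B C^N the
  last term tends to 0, since Y = 1 - C^N commutes with B and Y^n is a contraction.\<close>

lemma compl_pow_approx:
  fixes B :: "'a::chilbert \<Rightarrow> 'a"
  assumes B: "effect B"
  shows "(\<lambda>N. B ((compl_pow B N ^^ n) x)) \<longlonglongrightarrow> B x"
proof (induction n)
  case (Suc n)
  let ?C = "\<lambda>y. y - B y"
  define Y where "Y N = compl_pow B N" for N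
  have Y: "effect (Y N ^^ n)" for N unfolding Y_def by (intro effect_funpow effect_compl_pow B)
  have commC: "B ((?C ^^ N) y) = (?C ^^ N) (B y)" for N y
    by (induction N) (simp_all add: effect_diff[OF B])
  have commY1: "B (Y N y) = Y N (B y)" for N y
    by (simp add: Y_def compl_pow_def effect_diff[OF B] commC)
  have commY: "B ((Y N ^^ n) y) = (Y N ^^ n) (B y)" for N y
    by (induction n) (simp_all add: commY1)
  have "norm ((Y N ^^ n) (B ((?C ^^ N) x))) \<le> norm (B ((?C ^^ N) x))" for N
    by (rule contr_norm[OF contr_effect[OF Y]])
  then have "(\<lambda>N. (Y N ^^ n) (B ((?C ^^ N) x))) \<longlonglongrightarrow> 0"
    by (rule Lim_null_comparison[OF always_eventually[OF allI] tendsto_norm_zero[OF complement_powers_vanish[OF B, of x]]])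
  from tendsto_diff[OF Suc[folded Y_def] this]
  have "(\<lambda>N. B ((Y N ^^ n) x) - (Y N ^^ n) (B ((?C ^^ N) x))) \<longlonglongrightarrow> B x" by simp
  moreover have "B ((Y N ^^ Suc n) x) = B ((Y N ^^ n) x) - (Y N ^^ n) (B ((?C ^^ N) x))" for N
  proof -
    have "(Y N ^^ Suc n) x = (Y N ^^ n) (x - (?C ^^ N) x)"
      by (simp add: funpow_swap1 Y_def compl_pow_def)
    then show ?thesis by (simp add: effect_diff[OF Y] effect_diff[OF B] commY)
  qed
  ultimately show ?case by (simp add: Y_def)
qed simp

section \<open>Borchers' theorem for effects\<close>

context positive_group
begin

text \<open>Slot 0 carries \<open>B\<close>, the others \<open>compl_pow B N\<close>. The bound is
  uniform in N, so N tends to infinity first with the number of slots fixed; afterwards the number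
  of slots grows and |t| / r < 1 forces 0.\<close>

lemma borchers_local:
  assumes A: "effect A" and B: "effect B" and AB: "\<And>x. A (B x) = 0" and BA: "\<And>x. B (A x) = 0"
    and comm: "\<And>t x. \<bar>t\<bar> < \<epsilon> \<Longrightarrow> A (V t (B (V (- t) x))) = V t (B (V (- t) (A x)))"
    and t: "\<bar>t\<bar> < \<epsilon>"
  shows "A (V t (B (V (- t) x))) = 0"
proof -
  \<comment> \<open>Any value strictly between |t| and \<epsilon> would do; R = \<epsilon> is used
    in \<open>slots_bound\<close>, which makes \<rho> = 2 * \<epsilon>.\<close>
  define r where "r = (\<bar>t\<bar> + 2 * \<epsilon>) / 3"
  define \<rho> where "\<rho> = 2 * \<epsilon>"
  have r: "0 < r" "\<bar>t\<bar> < r" "r < \<epsilon>" using t by (auto simp: r_def)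
  have \<rho>: "\<rho> > 0" using t by (simp add: \<rho>_def)
  let ?C = "\<lambda>y. y - B y"
  have cA: "contr A" and cB: "contr B" using A B by (auto intro: contr_effect)
  \<comment> \<open>Next to \<open>A\<close> the powers of 1 - B act as the identity, so
    \<open>A\<close> annihilates \<open>compl_pow B N\<close> as it annihilates
    \<open>B\<close>.\<close>
  have C_A: "A ((?C ^^ N) y) = A y" "(?C ^^ N) (A y) = A y" for N y
    by (induction N arbitrary: y) (simp_all add: contr_diff[OF cA] AB BA)
  have C_comm: "A (V s ((?C ^^ N) (V (- s) y))) = V s ((?C ^^ N) (V (- s) (A y)))" if s: "\<bar>s\<bar> < \<epsilon>" for N s y
  proof (induction N arbitrary: y)
    case (Suc N)
    have e: "V (- s) y - B (V (- s) y) = V (- s) (y - V s (B (V (- s) y)))" for y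
      by (simp add: V_diff)
    show ?case
      unfolding funpow_Suc_right comp_def e Suc
      by (simp add: contr_diff[OF cA] comm[OF s])
  qed simp
  have "T (\<i> * of_real \<rho>) (A (V t (B (V (- t) (T (\<i> * of_real \<rho>) \<psi>))))) = 0" for \<psi>
  proof (rule cinner_ext)
    fix \<phi> :: 'a
    define u where "u = V (- t) (T (\<i> * of_real \<rho>) \<psi>)"
    define K where "K = norm \<phi> * norm \<psi>"
    define \<Lambda> where "\<Lambda> y = cinner \<phi> (T (\<i> * of_real \<rho>) (A (V t y)))" for y
    have bound: "cmod (\<Lambda> (B ((compl_pow B N ^^ Suc k) u))) \<le> K * (\<bar>t\<bar> / r) ^ Suc (Suc k)" for N k
    proof -
      define S where "S j = (if j = 0 then B else compl_pow B N)" for j :: nat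
      have rch: "rchain (\<lambda>y. y) S (Suc k) j y = (compl_pow B N ^^ Suc j) y" if "j \<le> k" for j y
        using that by (induction j) (auto simp: S_def)
      have cY: "contr (compl_pow B N)" by (intro contr_effect effect_compl_pow B)
      have "cmod (cinner \<phi> (T (\<i> * of_real (2 * \<epsilon>)) (A (V t (rchain (\<lambda>y. y) S (Suc k) (Suc k) (V (- t) (T (\<i> * of_real (2 * \<epsilon>)) \<psi>)))))))
          \<le> norm \<phi> * norm \<psi> * (\<bar>t\<bar> / r) ^ Suc (Suc k)"
      proof (rule slots_bound[OF cA])
        show "contr (S j)" for j using cB cY by (simp add: S_def)
        show "A (S j y) = 0" for j y
          by (simp add: S_def AB compl_pow_def contr_diff[OF cA] C_A)
        show "A (V s (S j (V (- s) y))) = V s (S j (V (- s) (A y)))" if "\<bar>s\<bar> < \<epsilon>" for j s y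
          using that by (simp add: S_def comm compl_pow_def V_diff contr_diff[OF cA] C_comm)
      qed (use r in auto)
      then show ?thesis
        by (simp add: rch S_def \<Lambda>_def u_def K_def \<rho>_def del: funpow.simps power_Suc)
    qed
    have c: "contr (\<lambda>y. T (\<i> * of_real \<rho>) (A (V t y)))"
      by (rule contr_comp[OF contr_T contr_comp[OF cA contr_V]])
    \<comment> \<open>N tends to infinity; the single \<open>B\<close> in slot 0 provides the strong
      limit that \<open>compl_pow_approx\<close> requires.\<close>
    have lim: "cmod (\<Lambda> (B u)) \<le> K * (\<bar>t\<bar> / r) ^ Suc (Suc k)" for k
    proof (rule Lim_bounded)
      have "(\<lambda>N. T (\<i> * of_real \<rho>) (A (V t (B ((compl_pow B N ^^ Suc k) u))))) \<longlonglongrightarrow> T (\<i> * of_real \<rho>) (A (V t (B u)))"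
        by (rule contr_tendsto[where P="\<lambda>_ y. T (\<i> * of_real \<rho>) (A (V t y))", OF _ compl_pow_approx[OF B] tendsto_const])
           (simp add: c)
      then show "(\<lambda>N. cmod (\<Lambda> (B ((compl_pow B N ^^ Suc k) u)))) \<longlonglongrightarrow> cmod (\<Lambda> (B u))"
        unfolding \<Lambda>_def by (intro tendsto_norm tendsto_cinner tendsto_const)
    qed (use bound in blast)
    have "(\<lambda>k. (\<bar>t\<bar> / r) ^ k) \<longlonglongrightarrow> 0" using r by (intro LIMSEQ_power_zero) simp
    then have "(\<lambda>k. K * (\<bar>t\<bar> / r) ^ Suc (Suc k)) \<longlonglongrightarrow> K * 0"
      by (intro tendsto_mult tendsto_const LIMSEQ_Suc)
    then have "cmod (\<Lambda> (B u)) \<le> K * 0" by (rule LIMSEQ_le_const) (use lim in blast)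
    then show "cinner \<phi> (T (\<i> * of_real \<rho>) (A (V t (B (V (- t) (T (\<i> * of_real \<rho>) \<psi>)))))) = cinner \<phi> 0"
      by (simp add: \<Lambda>_def u_def)
  qed
  then have z: "A (V t (B (V (- t) (T (\<i> * of_real \<rho>) \<psi>)))) = 0" for \<psi>
    by (rule T_injective[OF \<rho>])
  show ?thesis
    by (rule T_dense_range[where Q="\<lambda>y. A (V t (B (V (- t) y)))", OF \<rho> _ z])
       (rule contr_comp[OF cA contr_comp[OF contr_V contr_comp[OF cB contr_V]]])
qed

text \<open>No commutation is involved. Padding only on the right, the matrix elements of A T(z) B
  T(-z + i) are continuous for 0 \<le> Im z < 1 and vanish on a real interval, hence on the whole
  real line.\<close>

lemma vanishing_extends:
  assumes A: "contr A" and B: "contr B" and \<epsilon>: "\<epsilon> > 0"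
    and zero: "\<And>t x. \<bar>t\<bar> < \<epsilon> \<Longrightarrow> A (V t (B (V (- t) x))) = 0"
  shows "A (V t (B (V (- t) x))) = 0"
proof -
  have z: "A (V t (B (V (- t) (T (\<i> * of_real 1) \<psi>)))) = 0" for \<psi>
  proof (rule cinner_ext)
    fix \<phi> :: 'a
    let ?O = "{z. 0 < Im z \<and> Im z < 1}" and ?C = "{z. 0 \<le> Im z \<and> Im z < 1}"
    have O: "open ?O" "?O \<subseteq> ?C"
      using open_Int[OF open_halfspace_Im_gt[of 0] open_halfspace_Im_lt[of 1]] by (auto simp: Int_def)
    have fam: "opfam ?C ?O (\<lambda>z x. A (T (1 * z + 0) (B (T ((- 1) * z + \<i>) x))))"
      by (rule opfam_comp[OF opfam_const[OF O A] opfam_comp[OF opfam_T[OF O] opfam_comp[OF opfam_const[OF O B] opfam_T[OF O]]]])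
         auto
    have eq: "A (T (1 * of_real s + 0) (B (T ((- 1) * of_real s + \<i>) \<psi>))) = A (V s (B (V (- s) (T (\<i> * of_real 1) \<psi>))))" for s
      by (simp add: T_real V_T)
    have "cinner \<phi> (A (T (1 * of_real t + 0) (B (T ((- 1) * of_real t + \<i>) \<psi>)))) = 0"
    proof (rule boundary_uniqueness[OF opfam_cinner(1,2)[OF fam] \<epsilon>])
      fix s :: real assume "\<bar>s\<bar> < \<epsilon>"
      then show "cinner \<phi> (A (T (1 * of_real s + 0) (B (T ((- 1) * of_real s + \<i>) \<psi>)))) = 0"
        unfolding eq using zero by simp
    qed auto
    then show "cinner \<phi> (A (V t (B (V (- t) (T (\<i> * of_real 1) \<psi>))))) = cinner \<phi> 0"
      unfolding eq by simp
  qed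
  show ?thesis
    by (rule T_dense_range[where Q="\<lambda>y. A (V t (B (V (- t) y)))", OF zero_less_one _ z])
       (rule contr_comp[OF A contr_comp[OF contr_V contr_comp[OF B contr_V]]])
qed

end

section \<open>Translation groups\<close>

lemmas hilb_rep_eqs = zero_hilb.rep_eq plus_hilb.rep_eq minus_hilb.rep_eq uminus_hilb.rep_eq
  scaleC_hilb.rep_eq cinner_hilb.rep_eq to_hilb_inverse[OF UNIV_I] of_hilb_inverse

definition lift_op :: "('a::complex_hilbert \<Rightarrow> 'a) \<Rightarrow> 'a hilb \<Rightarrow> 'a hilb" where
  "lift_op Q X = to_hilb (Q (of_hilb X))"

lemma of_hilb_lift_op [simp]: "of_hilb (lift_op Q X) = Q (of_hilb X)"
  by (simp add: lift_op_def hilb_rep_eqs)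

lemma norm_hilb_cnorm: "norm X = cnorm (of_hilb X)"
  by (simp add: cnorm_def norm_hilb_eq hilb_rep_eqs)

lemma effect_lift_op:
  assumes "effect E"
  shows "effect (lift_op E)"
proof -
  obtain K where "\<And>x. cnorm (E x) \<le> K * cnorm x"
    using assms unfolding effect_def bounded_op_def by blast
  then have "cnorm (lift_op E X) \<le> K * cnorm X" for X
    unfolding cnorm_eq_norm norm_hilb_cnorm by simp
  moreover have "clinear (lift_op E)"
    unfolding clinear_def of_hilb_inject[symmetric] by (simp add: hilb_rep_eqs effect_lin[OF assms])
  ultimately show ?thesis
    unfolding effect_def bounded_op_def
    by (auto simp: hilb_rep_eqs effect_Im[OF assms] effect_pos[OF assms] effect_le[OF assms])
qed

lemma unitary_rep_props:
  assumes "unitary_rep U"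
  shows "U 0 x = x" "U (a + b) x = U a (U b x)" "U a (x + y) = U a x + U a y"
    "U a (c *\<^sub>C x) = c *\<^sub>C U a x" "cinner (U a x) (U a y) = cinner x y"
proof -
  have U: "unitary_op (U a)" "U 0 = id" "U (a + b) = U a \<circ> U b" for a b
    using assms unfolding unitary_rep_def by blast+
  show "U 0 x = x" "U (a + b) x = U a (U b x)" by (simp_all add: U(2,3))
  show "U a (x + y) = U a x + U a y" "U a (c *\<^sub>C x) = c *\<^sub>C U a x" "cinner (U a x) (U a y) = cinner x y"
    using U(1)[of a] unfolding unitary_op_def bounded_op_def clinear_def by blast+
qed

lemma unitary_rep_cancel:
  assumes "unitary_rep U"
  shows "U a (U (- a) x) = x" "U (- a) (U a x) = x"
  using unitary_rep_props(2)[OF assms, of a "- a" x] unitary_rep_props(2)[OF assms, of "- a" a x]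
  by (simp_all add: unitary_rep_props(1)[OF assms])

lemma cadjoint_unitary_rep:
  assumes U: "unitary_rep U"
  shows "cadjoint (U a) = U (- a)"
proof (rule ext)
  fix y
  have adj: "cinner (U a x) y = cinner x (U (- a) y)" for x
    using unitary_rep_props(5)[OF U, of a x "U (- a) y"] by (simp add: unitary_rep_cancel[OF U])
  show "cadjoint (U a) y = U (- a) y"
    unfolding cadjoint_def
  proof (rule the_equality)
    fix z assume "\<forall>x. cinner (U a x) y = cinner x z"
    then show "z = U (- a) y" by (intro cinner_ext) (simp add: adj[symmetric])
  qed (simp add: adj)
qed

text \<open>The scalar phase subtracts the lower bound c from the generator, making it
  nonnegative.\<close>

lemma positive_group_direction:
  assumes U: "unitary_rep U" and cont: "strongly_continuous U" and "generator_bounded_below U b"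
  obtains c where "positive_group (\<lambda>t X. exp (- (\<i> * of_real (c * t))) *\<^sub>C lift_op (U (t *\<^sub>R b)) X)"
proof -
  obtain c where c: "\<And>\<psi> \<phi>. gen_at U b \<psi> \<phi> \<Longrightarrow> c * (cnorm \<psi>)\<^sup>2 \<le> Re (cinner \<psi> \<phi>)"
    using assms(3) unfolding generator_bounded_below_def by blast
  define e where "e t = exp (- (\<i> * complex_of_real (c * t)))" for t
  define W where "W t = lift_op (U (t *\<^sub>R b))" for t
  note Up = unitary_rep_props[OF U]
  have W_add: "W (s + t) X = W s (W t X)" and W_plus: "W t (X + Y) = W t X + W t Y"
    and W_scaleC: "W t (k *\<^sub>C X) = k *\<^sub>C W t X" and W_cinner: "cinner (W t X) (W t Y) = cinner X Y"
    and W_zero: "W 0 X = X" for s t k X Y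
    unfolding W_def of_hilb_inject[symmetric]
    by (simp_all add: hilb_rep_eqs Up scaleR_add_left)
  have W_cont: "continuous_on UNIV (\<lambda>t. W t X)" for X
    unfolding continuous_on_iff dist_norm
  proof (intro ballI allI impI)
    fix t :: real and \<epsilon> :: real assume "\<epsilon> > 0"
    then obtain d where d: "d > 0" "\<And>a. norm (a - t *\<^sub>R b) < d \<Longrightarrow> cnorm (U a (of_hilb X) - U (t *\<^sub>R b) (of_hilb X)) < \<epsilon>"
      using cont unfolding strongly_continuous_def by blast
    show "\<exists>d>0. \<forall>s\<in>UNIV. norm (s - t) < d \<longrightarrow> norm (W s X - W t X) < \<epsilon>"
    proof (intro exI[of _ "d / (norm b + 1)"] conjI ballI impI)
      show "0 < d / (norm b + 1)" using d(1) by (intro divide_pos_pos) (auto simp: add_nonneg_pos)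
      fix s assume s: "norm (s - t) < d / (norm b + 1)"
      have "norm (s - t) * (norm b + 1) < d"
        using s by (simp add: pos_less_divide_eq add_nonneg_pos)
      moreover have "norm (s *\<^sub>R b - t *\<^sub>R b) \<le> norm (s - t) * (norm b + 1)"
        by (simp add: scaleR_left_diff_distrib[symmetric] mult_left_mono)
      ultimately have "norm (s *\<^sub>R b - t *\<^sub>R b) < d" by linarith
      from d(2)[OF this] show "norm (W s X - W t X) < \<epsilon>"
        by (simp add: norm_hilb_cnorm hilb_rep_eqs W_def)
    qed
  qed
  have e_add: "e (s + t) = e s * e t" for s t
    by (simp add: e_def exp_add[symmetric] algebra_simps)
  have e_unit: "cnj (e t) * e t = 1" for t
    by (simp add: e_def exp_cnj exp_add[symmetric])
  have e_cont: "continuous_on UNIV e" unfolding e_def by (intro continuous_intros)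
  have "positive_group (\<lambda>t X. e t *\<^sub>C W t X)"
  proof
    fix s t :: real and X Y \<psi> \<phi> :: "'a hilb"
    show "e (s + t) *\<^sub>C W (s + t) X = e s *\<^sub>C W s (e t *\<^sub>C W t X)"
      by (simp add: W_add e_add W_scaleC scaleC_scaleC)
    show "e 0 *\<^sub>C W 0 X = X" by (simp add: e_def W_zero scaleC_one)
    show "clinear (\<lambda>X. e t *\<^sub>C W t X)"
      unfolding clinear_def by (simp add: W_plus W_scaleC scaleC_add_right scaleC_scaleC mult.commute)
    show "cinner (e t *\<^sub>C W t X) (e t *\<^sub>C W t Y) = cinner X Y"
      using e_unit[of t] by (simp add: cinner_scaleC_left cinner_scaleC_right W_cinner flip: mult.assoc) (simp add: mult.commute)
    show "continuous_on UNIV (\<lambda>t. e t *\<^sub>C W t X)" by (intro continuous_intros e_cont W_cont)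
    assume lim: "((\<lambda>t. (1 / (\<i> * of_real t)) *\<^sub>C (e t *\<^sub>C W t \<psi> - \<psi>)) \<longlongrightarrow> \<phi>) (at 0)"
    have e_lim: "((\<lambda>t. cnj (e t)) \<longlongrightarrow> 1) (at 0)"
    proof -
      have "isCont e 0" using e_cont continuous_on_eq_continuous_at open_UNIV by blast
      then have "(e \<longlongrightarrow> e 0) (at 0)" by (simp add: isCont_def)
      from tendsto_cnj[OF this] show ?thesis by (simp add: e_def)
    qed
    have e_deriv: "((\<lambda>t. 1 / (\<i> * of_real t) * (cnj (e t) - 1)) \<longlongrightarrow> of_real c) (at 0)"
    proof -
      have e': "cnj (e t) = exp (\<i> * of_real c * of_real t)" for t
        by (simp add: e_def exp_cnj mult.assoc)
      have "((\<lambda>z. exp (\<i> * of_real c * z)) has_field_derivative (\<i> * of_real c)) (at 0)"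
        by (auto intro!: derivative_eq_intros)
      then have "((\<lambda>z. (exp (\<i> * of_real c * z) - 1) / z) \<longlongrightarrow> \<i> * of_real c) (at 0)"
        by (simp add: has_field_derivative_iff)
      moreover have "filterlim complex_of_real (at 0) (at 0)"
        unfolding filterlim_at by (auto intro!: tendsto_eq_intros simp: eventually_at_filter)
      ultimately have "((\<lambda>t. (exp (\<i> * of_real c * of_real t) - 1) / of_real t) \<longlongrightarrow> \<i> * of_real c) (at 0)"
        by (rule filterlim_compose)
      from tendsto_mult[OF tendsto_const[of "1 / \<i>"] this]
      have "((\<lambda>t. 1 / \<i> * ((cnj (e t) - 1) / of_real t)) \<longlongrightarrow> 1 / \<i> * (\<i> * of_real c)) (at 0)"
        unfolding e' .
      moreover have "1 / \<i> * (w / of_real t) = 1 / (\<i> * of_real t) * w" for w and t :: real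
        by (cases "t = 0") (simp_all add: field_simps)
      ultimately show ?thesis by simp
    qed
    \<comment> \<open>Undo the phase by the product rule: a limit \<phi> for the shifted group
      becomes \<phi> + c \<psi> for the original one, where the lower bound is known.\<close>
    have "((\<lambda>t. cnj (e t) *\<^sub>C (1 / (\<i> * of_real t)) *\<^sub>C (e t *\<^sub>C W t \<psi> - \<psi>)
        + (1 / (\<i> * of_real t) * (cnj (e t) - 1)) *\<^sub>C \<psi>) \<longlongrightarrow> 1 *\<^sub>C \<phi> + of_real c *\<^sub>C \<psi>) (at 0)"
      by (rule tendsto_add[OF tendsto_scaleC[OF e_lim lim] tendsto_scaleC[OF e_deriv tendsto_const]])
    moreover have "cnj (e t) *\<^sub>C (1 / (\<i> * of_real t)) *\<^sub>C (e t *\<^sub>C W t \<psi> - \<psi>)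
        + (1 / (\<i> * of_real t) * (cnj (e t) - 1)) *\<^sub>C \<psi> = (1 / (\<i> * of_real t)) *\<^sub>C (W t \<psi> - \<psi>)" for t
    proof -
      have "cnj (e t) *\<^sub>C k *\<^sub>C (e t *\<^sub>C w - \<psi>) + (k * (cnj (e t) - 1)) *\<^sub>C \<psi> = k *\<^sub>C (w - \<psi>)" for k w
      proof -
        have "cnj (e t) *\<^sub>C k *\<^sub>C (e t *\<^sub>C w - \<psi>) = (k * (cnj (e t) * e t)) *\<^sub>C w - (k * cnj (e t)) *\<^sub>C \<psi>"
          by (simp add: scaleC_diff_right scaleC_scaleC mult_ac)
        then show ?thesis
          by (simp add: e_unit right_diff_distrib scaleC_diff_left scaleC_diff_right)
      qed
      then show ?thesis .
    qed
    ultimately have "((\<lambda>t. (1 / (\<i> * of_real t)) *\<^sub>C (W t \<psi> - \<psi>)) \<longlongrightarrow> \<phi> + of_real c *\<^sub>C \<psi>) (at 0)"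
      by (simp add: scaleC_one)
    then have "((\<lambda>t. norm ((1 / (\<i> * of_real t)) *\<^sub>C (W t \<psi> - \<psi>) - (\<phi> + of_real c *\<^sub>C \<psi>))) \<longlongrightarrow> 0) (at 0)"
      by (intro tendsto_norm_zero) (simp only: LIM_zero)
    then have "gen_at U b (of_hilb \<psi>) (of_hilb (\<phi> + of_real c *\<^sub>C \<psi>))"
      unfolding gen_at_def by (simp add: norm_hilb_cnorm hilb_rep_eqs W_def)
    from c[OF this] have "c * (norm \<psi>)\<^sup>2 \<le> Re (cinner \<psi> (\<phi> + of_real c *\<^sub>C \<psi>))"
      by (simp add: norm_hilb_cnorm cinner_hilb.rep_eq)
    also have "\<dots> = Re (cinner \<psi> \<phi>) + c * (norm \<psi>)\<^sup>2"
      by (simp add: cinner_add_right cinner_scaleC_right cinner_self)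
    finally show "0 \<le> Re (cinner \<psi> \<phi>)" by simp
  qed
  then show thesis by (intro that[of c]) (simp add: e_def W_def)
qed

text \<open>The phases at t and -t cancel, so the shift of the generator is invisible to translated
  effects.\<close>

lemma conjugated_group:
  assumes U: "unitary_rep U" and E: "effect E"
    and V: "V = (\<lambda>t X. exp (- (\<i> * of_real (c * t))) *\<^sub>C lift_op (U (t *\<^sub>R b)) X)"
  shows "V t (lift_op E (V (- t) X)) = to_hilb (U (t *\<^sub>R b) (E (U (- (t *\<^sub>R b)) (of_hilb X))))"
proof -
  have "exp (- (\<i> * of_real (c * t))) * exp (- (\<i> * of_real (c * (- t)))) = 1"
    by (simp add: exp_add[symmetric])
  then show ?thesis
    unfolding of_hilb_inject[symmetric] V
    by (simp add: hilb_rep_eqs unitary_rep_props[OF U] effect_lin[OF E] scaleC_scaleC scaleC_one)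
qed

lemma borchers_direction:
  assumes U: "unitary_rep U" "strongly_continuous U" "generator_bounded_below U b"
    and E: "effect E1" "effect E2" and zero: "\<And>x. E1 (E2 x) = 0" "\<And>x. E2 (E1 x) = 0"
    and \<epsilon>: "\<epsilon> > 0"
    and comm: "\<And>t x. \<bar>t\<bar> < \<epsilon> \<Longrightarrow> E1 (U (t *\<^sub>R b) (E2 (U (- (t *\<^sub>R b)) x))) = U (t *\<^sub>R b) (E2 (U (- (t *\<^sub>R b)) (E1 x)))"
    and t: "\<bar>t\<bar> < \<epsilon>"
  shows "E1 (U (t *\<^sub>R b) (E2 (U (- (t *\<^sub>R b)) x))) = 0"
proof -
  obtain c where pg: "positive_group (\<lambda>t X. exp (- (\<i> * of_real (c * t))) *\<^sub>C lift_op (U (t *\<^sub>R b)) X)"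
    (is "positive_group ?V") using positive_group_direction[OF U] by blast
  note conj = conjugated_group[OF U(1) E(2) refl, of c _ b]
  have "lift_op E1 (?V t (lift_op E2 (?V (- t) (to_hilb x)))) = 0"
  proof (rule positive_group.borchers_local[OF pg effect_lift_op[OF E(1)] effect_lift_op[OF E(2)] _ _ _ t])
    show "lift_op E1 (lift_op E2 X) = 0" "lift_op E2 (lift_op E1 X) = 0" for X
      unfolding of_hilb_inject[symmetric] by (simp_all add: hilb_rep_eqs zero)
    show "lift_op E1 (?V t (lift_op E2 (?V (- t) X))) = ?V t (lift_op E2 (?V (- t) (lift_op E1 X)))"
      if "\<bar>t\<bar> < \<epsilon>" for t X
      unfolding conj of_hilb_inject[symmetric] by (simp add: hilb_rep_eqs comm[OF that])
  qed
  then have "of_hilb (lift_op E1 (?V t (lift_op E2 (?V (- t) (to_hilb x))))) = of_hilb 0" by (rule arg_cong)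
  then show ?thesis unfolding conj by (simp add: hilb_rep_eqs)
qed

lemma vanishing_direction:
  assumes U: "unitary_rep U" "strongly_continuous U" "generator_bounded_below U b"
    and E: "effect E1" "effect E2" and \<epsilon>: "\<epsilon> > 0"
    and zero: "\<And>t x. \<bar>t\<bar> < \<epsilon> \<Longrightarrow> E1 (U (t *\<^sub>R b) (E2 (U (- (t *\<^sub>R b)) x))) = 0"
  shows "E1 (U (t *\<^sub>R b) (E2 (U (- (t *\<^sub>R b)) x))) = 0"
proof -
  obtain c where pg: "positive_group (\<lambda>t X. exp (- (\<i> * of_real (c * t))) *\<^sub>C lift_op (U (t *\<^sub>R b)) X)"
    (is "positive_group ?V") using positive_group_direction[OF U] by blast
  note conj = conjugated_group[OF U(1) E(2) refl, of c _ b]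
  have "lift_op E1 (?V t (lift_op E2 (?V (- t) (to_hilb x)))) = 0"
  proof (rule positive_group.vanishing_extends[OF pg contr_effect[OF effect_lift_op[OF E(1)]]
        contr_effect[OF effect_lift_op[OF E(2)]] \<epsilon>])
    show "lift_op E1 (?V t (lift_op E2 (?V (- t) X))) = 0" if "\<bar>t\<bar> < \<epsilon>" for t X
      unfolding conj of_hilb_inject[symmetric] by (simp add: hilb_rep_eqs zero[OF that])
  qed
  then have "of_hilb (lift_op E1 (?V t (lift_op E2 (?V (- t) (to_hilb x))))) = of_hilb 0" by (rule arg_cong)
  then show ?thesis unfolding conj by (simp add: hilb_rep_eqs)
qed

section \<open>Minkowski geometry\<close>

lemma mink_prod_add_right: "mink_prod z (x + y) = mink_prod z x + mink_prod z y"
  and mink_prod_scale: "mink_prod (r *\<^sub>R x) z = r * mink_prod x z"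
  and mink_prod_scale_right: "mink_prod z (r *\<^sub>R x) = r * mink_prod z x"
  by (simp_all add: mink_prod_def inner_add_right algebra_simps)

lemma abs_mink_prod_le: "\<bar>mink_prod x y\<bar> \<le> 2 * norm x * norm y"
proof -
  have f: "\<bar>fst z\<bar> \<le> norm z" "norm (snd z) \<le> norm z" for z :: mink
    using norm_fst_le[of "fst z" "snd z"] norm_snd_le[of "snd z" "fst z"] by auto
  have "\<bar>mink_prod x y\<bar> \<le> \<bar>fst x * fst y\<bar> + \<bar>snd x \<bullet> snd y\<bar>"
    unfolding mink_prod_def by (rule abs_triangle_ineq4)
  also have "\<dots> \<le> \<bar>fst x\<bar> * \<bar>fst y\<bar> + norm (snd x) * norm (snd y)"
    by (simp add: abs_mult Cauchy_Schwarz_ineq2)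
  also have "\<dots> \<le> norm x * norm y + norm x * norm y"
    by (intro add_mono mult_mono f) auto
  finally show ?thesis by simp
qed

lemma orthogonal_spacelike:
  assumes "timelike n"
  obtains e where "mink_prod n e = 0" "spacelike e"
proof -
  define w :: "real^3" where "w = axis 1 1"
  have w: "norm w = 1" "w \<bullet> w = 1" by (simp_all add: w_def norm_axis_1 inner_axis_axis)
  \<comment> \<open>The time component solves the orthogonality equation; it is smaller than 1 in
    modulus because |snd n| < |fst n|, so \<open>e\<close> is spacelike.\<close>
  define e where "e = (snd n \<bullet> w / fst n, w)"
  have n: "(norm (snd n))\<^sup>2 < (fst n)\<^sup>2"
    using assms by (simp add: timelike_def mink_prod_def power2_eq_square power2_norm_eq_inner dot_square_norm)
  then have n0: "fst n \<noteq> 0" using zero_le_power2[of "norm (snd n)"] by auto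
  have "(snd n \<bullet> w)\<^sup>2 \<le> (norm (snd n))\<^sup>2"
    using Cauchy_Schwarz_ineq2[of "snd n" w] w by (metis abs_le_square_iff abs_norm_cancel mult_1_right)
  then have "(snd n \<bullet> w)\<^sup>2 < (fst n)\<^sup>2" using n by linarith
  then have "(snd n \<bullet> w / fst n)\<^sup>2 < 1" using n0 by (simp add: power_divide divide_less_eq)
  then have "spacelike e" by (simp add: spacelike_def mink_prod_def e_def w power2_eq_square)
  moreover have "mink_prod n e = 0" using n0 by (simp add: mink_prod_def e_def)
  ultimately show thesis by (rule that[rotated])
qed

lemma far_spacelike:
  assumes "spacelike e" "R \<ge> 0"
  obtains l where "\<And>u. norm u \<le> R \<Longrightarrow> spacelike (u - l *\<^sub>R e)"
proof -
  define q where "q = - mink_prod e e"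
  have q: "q > 0" using assms by (simp add: q_def spacelike_def)
  \<comment> \<open>\<open>X\<close> collects the terms that l^2 q must beat. The summand X / q of
    \<open>l\<close> gives l q \<ge> X, and the extra 1 gives l \<ge> 1.\<close>
  define X where "X = 4 * R * norm e + 2 * R\<^sup>2 + 1"
  define l where "l = X / q + 1"
  have l: "l \<ge> 1" using q assms(2) by (simp add: l_def X_def)
  have "l * q = X + q" using q by (simp add: l_def field_simps)
  then have lq: "l * q \<ge> 4 * R * norm e + 2 * R\<^sup>2 + 1" using q by (simp add: X_def)
  have "spacelike (u - l *\<^sub>R e)" if u: "norm u \<le> R" for u
  proof -
    have "mink_prod (u - l *\<^sub>R e) (u - l *\<^sub>R e) = mink_prod u u - 2 * l * mink_prod u e - l * (l * q)"
      unfolding q_def mink_prod_def by (simp add: inner_diff_left inner_diff_right algebra_simps inner_commute)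
    moreover have "mink_prod u u \<le> 2 * R\<^sup>2"
    proof -
      have "mink_prod u u \<le> 2 * (norm u * norm u)" using abs_mink_prod_le[of u u] by simp
      moreover have "norm u * norm u \<le> R * R" using u assms(2) by (intro mult_mono) auto
      ultimately show ?thesis by (simp add: power2_eq_square)
    qed
    moreover have "- (2 * l * mink_prod u e) \<le> l * (4 * R * norm e)"
    proof -
      have "- mink_prod u e \<le> 2 * norm u * norm e" using abs_mink_prod_le[of u e] by linarith
      also have "\<dots> \<le> 2 * R * norm e" using u by (intro mult_right_mono) auto
      finally have "2 * l * (- mink_prod u e) \<le> 2 * l * (2 * R * norm e)" using l by (intro mult_left_mono) auto
      then show ?thesis by (simp add: mult_ac)
    qed
    moreover have "l * (4 * R * norm e + 2 * R\<^sup>2 + 1) \<le> l * (l * q)" using lq l by (intro mult_left_mono) auto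
    moreover have "2 * R\<^sup>2 + 1 \<le> l * (2 * R\<^sup>2 + 1)"
      using mult_right_mono[OF l, of "2 * R\<^sup>2 + 1"] by simp
    ultimately show ?thesis unfolding spacelike_def distrib_left by linarith
  qed
  then show thesis by (rule that)
qed

text \<open>The spectrum condition speaks of future-directed unit vectors only; past-directed ones
  are reached with a negative multiple \<open>s\<close>.\<close>

lemma timelike_direction:
  assumes "timelike v"
  obtains b s where "fst b > 0" "mink_prod b b = 1" "v = s *\<^sub>R b"
proof -
  have m: "mink_prod v v > 0" using assms by (simp add: timelike_def)
  then have v0: "fst v \<noteq> 0" by (auto simp: mink_prod_def) (smt (verit) inner_ge_zero)
  define s where "s = sgn (fst v) * sqrt (mink_prod v v)"
  have s: "s \<noteq> 0" "s * s = mink_prod v v" "fst v / s > 0"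
    using m v0 by (auto simp: s_def sgn_if divide_neg_pos)
  show thesis
  proof (rule that)
    show "fst ((1 / s) *\<^sub>R v) > 0" using s by simp
    show "mink_prod ((1 / s) *\<^sub>R v) ((1 / s) *\<^sub>R v) = 1"
      unfolding mink_prod_scale mink_prod_scale_right using s(1) s(2)[symmetric] by simp
    show "v = s *\<^sub>R ((1 / s) *\<^sub>R v)" using s by simp
  qed
qed

lemma translate_translate: "translate (translate A a) b = translate A (a + b)"
  unfolding translate_def by (auto simp: image_image add.assoc)

lemma translate_hyperplane:
  assumes "S \<in> hyperplanes n"
  shows "translate S a \<in> hyperplanes n" "mink_prod n a = 0 \<Longrightarrow> translate S a = S"
proof -
  obtain c where S: "S = {x. mink_prod n x = c}" using assms by (auto simp: hyperplanes_def)
  have eq: "translate S a = {x. mink_prod n x = c + mink_prod n a}"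
  proof (intro set_eqI iffI)
    fix x assume "x \<in> {x. mink_prod n x = c + mink_prod n a}"
    then have "x - a \<in> S" using mink_prod_add_right[of n "x - a" a] by (simp add: S)
    then show "x \<in> translate S a" unfolding translate_def by (intro image_eqI[of _ _ "x - a"]) auto
  qed (auto simp: translate_def S mink_prod_add_right)
  then show "translate S a \<in> hyperplanes n" by (auto simp: hyperplanes_def)
  show "mink_prod n a = 0 \<Longrightarrow> translate S a = S" using eq S by simp
qed

theorem theorem2:
  fixes U :: "mink \<Rightarrow> 'h::complex_hilbert \<Rightarrow> 'h"
    and n :: mink
    and F :: "mink set \<Rightarrow> mink set set"
    and E :: "mink set \<Rightarrow> 'h \<Rightarrow> 'h"
  assumes rep: "unitary_rep U"
    and cont: "strongly_continuous U"
    and spec: "spectrum_condition U"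
    and n_timelike: "timelike n"
    and F_sub: "\<forall>S\<in>hyperplanes n. F S \<subseteq> Pow S"
    and F_cover: "\<forall>S\<in>hyperplanes n. \<exists>C\<subseteq>F S. (\<forall>\<Delta>\<in>C. bounded \<Delta>) \<and> \<Union>C = S"
    and F_transl: "\<forall>S\<in>hyperplanes n. \<forall>a. F (translate S a) = (\<lambda>\<Delta>. translate \<Delta> a) ` F S"
    and E_effect: "\<forall>S\<in>hyperplanes n. \<forall>\<Delta>\<in>F S. effect (E \<Delta>)"
    and covariance: "\<forall>S\<in>hyperplanes n. \<forall>\<Delta>\<in>F S. \<forall>a.
        U a \<circ> E \<Delta> \<circ> cadjoint (U a) = E (translate \<Delta> a)"
    and localizability: "\<forall>S\<in>hyperplanes n. \<forall>\<Delta>1\<in>F S. \<forall>\<Delta>2\<in>F S. \<Delta>1 \<inter> \<Delta>2 = {} \<longrightarrow>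
        E \<Delta>1 \<circ> E \<Delta>2 = (\<lambda>_. 0) \<and> E \<Delta>2 \<circ> E \<Delta>1 = (\<lambda>_. 0)"
    and local_comm: "\<forall>S1\<in>hyperplanes n. \<forall>S2\<in>hyperplanes n. \<forall>\<Delta>1\<in>F S1. \<forall>\<Delta>2\<in>F S2.
        spacelike_separated \<Delta>1 \<Delta>2 \<longrightarrow> E \<Delta>1 \<circ> E \<Delta>2 = E \<Delta>2 \<circ> E \<Delta>1"
  shows "\<forall>S\<in>hyperplanes n. \<forall>\<Delta>\<in>F S. bounded \<Delta> \<longrightarrow> E \<Delta> = (\<lambda>_. 0)"
proof (intro ballI impI)
  fix S \<Delta> assume S: "S \<in> hyperplanes n" and \<Delta>: "\<Delta> \<in> F S" and bdd: "bounded \<Delta>"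
  note Up = unitary_rep_props[OF rep]
  have in_F: "translate \<Delta> c \<in> F (translate S c)" for c
  proof -
    have "F (translate S c) = (\<lambda>\<Delta>. translate \<Delta> c) ` F S" using F_transl S by blast
    then show ?thesis using \<Delta> by blast
  qed
  have eff: "effect (E (translate \<Delta> c))" for c
    using E_effect in_F translate_hyperplane(1)[OF S] by blast
  have cov: "U d (E (translate \<Delta> c) (U (- d) x)) = E (translate \<Delta> (c + d)) x" for c d x
  proof -
    have "U d \<circ> E (translate \<Delta> c) \<circ> cadjoint (U d) = E (translate (translate \<Delta> c) d)"
      using covariance in_F translate_hyperplane(1)[OF S] by blast
    from fun_cong[OF this, of x] show ?thesis
      by (simp add: cadjoint_unitary_rep[OF rep] translate_translate)
  qed
  have \<Delta>0: "translate \<Delta> 0 = \<Delta>" by (simp add: translate_def)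
  have eff\<Delta>: "effect (E \<Delta>)" using eff[of 0] by (simp add: \<Delta>0)
  have gen: "generator_bounded_below U b" if "fst b > 0" "mink_prod b b = 1" for b
    using spec that unfolding spectrum_condition_def by blast
  obtain M where M: "\<And>x. x \<in> \<Delta> \<Longrightarrow> norm x \<le> M" and M0: "M \<ge> 0"
    using bdd unfolding bounded_iff by (metis norm_ge_zero order_trans linear)
  obtain e where e: "mink_prod n e = 0" "spacelike e" using orthogonal_spacelike[OF n_timelike] .
  \<comment> \<open>Differences of points of \<Delta> have norm at most 2 M; the extra 1 leaves room
    to move the distant copy by any vector of norm at most 1.\<close>
  obtain l where l: "\<And>u. norm u \<le> 2 * M + 1 \<Longrightarrow> spacelike (u - l *\<^sub>R e)"
    using far_spacelike[OF e(2), of "2 * M + 1"] M0 by auto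
  define a where "a = l *\<^sub>R e"
  have sep: "spacelike_separated \<Delta> (translate \<Delta> (a + w))" if w: "norm w \<le> 1" for w
    unfolding spacelike_separated_def translate_def
  proof (intro ballI, elim imageE)
    fix x y y' assume x: "x \<in> \<Delta>" and y: "y' \<in> \<Delta>" "y = y' + (a + w)"
    have "norm (x - y' - w) \<le> norm x + norm y' + norm w"
      using norm_triangle_ineq4[of "x - y'" w] norm_triangle_ineq4[of x y'] by linarith
    also have "\<dots> \<le> 2 * M + 1" using M[OF x] M[OF y(1)] w by linarith
    finally have "spacelike (x - y' - w - l *\<^sub>R e)" by (rule l)
    then show "spacelike (x - y)" by (simp add: y a_def algebra_simps)
  qed
  \<comment> \<open>The shift stays inside the hyperplane, so \<Delta> and its translate belong to
    the same family and localizability applies.\<close>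
  have Sa: "translate S a = S"
    by (rule translate_hyperplane(2)[OF S]) (simp add: a_def mink_prod_scale_right e)
  \<comment> \<open>Spacelike separated sets are disjoint because the zero vector is not
    spacelike.\<close>
  have "\<Delta> \<inter> translate \<Delta> a = {}"
  proof -
    have "spacelike_separated \<Delta> (translate \<Delta> a)" using sep[of 0] by simp
    moreover have "\<not> spacelike (x - x)" for x by (simp add: spacelike_def mink_prod_def)
    ultimately show ?thesis unfolding spacelike_separated_def by blast
  qed
  then have "E \<Delta> \<circ> E (translate \<Delta> a) = (\<lambda>_. 0) \<and> E (translate \<Delta> a) \<circ> E \<Delta> = (\<lambda>_. 0)"
    using localizability S \<Delta> in_F[of a] unfolding Sa by blast
  then have zero: "E \<Delta> (E (translate \<Delta> a) x) = 0" "E (translate \<Delta> a) (E \<Delta> x) = 0" for x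
    by (auto simp: fun_eq_iff)
  have comm: "E \<Delta> (E (translate \<Delta> (a + w)) x) = E (translate \<Delta> (a + w)) (E \<Delta> x)"
    if "norm w \<le> 1" for w x
  proof -
    have "E \<Delta> \<circ> E (translate \<Delta> (a + w)) = E (translate \<Delta> (a + w)) \<circ> E \<Delta>"
      using local_comm S translate_hyperplane(1)[OF S] \<Delta> in_F sep[OF that] by blast
    then show ?thesis by (simp add: fun_eq_iff)
  qed
  have step1: "E \<Delta> (E (translate \<Delta> (a + v)) x) = 0" if "timelike v" for v x
  proof -
    obtain b s where b: "fst b > 0" "mink_prod b b = 1" "v = s *\<^sub>R b"
      using timelike_direction[OF \<open>timelike v\<close>] by blast
    define \<epsilon> where "\<epsilon> = 1 / (norm b + 1)"
    have \<epsilon>: "\<epsilon> > 0" by (simp add: \<epsilon>_def add_nonneg_pos)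
    have small: "norm (t *\<^sub>R b) \<le> 1" if "\<bar>t\<bar> < \<epsilon>" for t
    proof -
      have "\<bar>t\<bar> * (norm b + 1) < 1" using that by (simp add: \<epsilon>_def pos_less_divide_eq add_nonneg_pos)
      then show ?thesis by (simp add: distrib_left)
    qed
    \<comment> \<open>For these t the translates t b stay in the unit ball of slack, so local
      commutativity holds and \<open>borchers_direction\<close> applies.\<close>
    have near: "E \<Delta> (U (t *\<^sub>R b) (E (translate \<Delta> a) (U (- (t *\<^sub>R b)) x))) = 0" if t: "\<bar>t\<bar> < \<epsilon>" for t x
      by (rule borchers_direction[OF rep cont gen[OF b(1,2)] eff\<Delta> eff zero \<epsilon> _ t])
         (simp_all only: zero cov comm[OF small])
    have "E \<Delta> (U (s *\<^sub>R b) (E (translate \<Delta> a) (U (- (s *\<^sub>R b)) x))) = 0"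
      by (rule vanishing_direction[OF rep cont gen[OF b(1,2)] eff\<Delta> eff \<epsilon> near])
    then show ?thesis by (simp add: cov b(3))
  qed
  \<comment> \<open>A time shift long enough that both \<open>v1\<close> and -a - v1 are timelike:
    |fst a + \<tau>| exceeds the norm of \<open>snd a\<close>.\<close>
  define \<tau> where "\<tau> = \<bar>fst a\<bar> + norm (snd a) + 1"
  define v1 :: mink where "v1 = (\<tau>, 0)"
  have \<tau>: "\<tau> > 0" by (simp add: \<tau>_def add_nonneg_pos)
  have "timelike (- a - v1)"
  proof -
    have "norm (snd a) < fst a + \<tau>" by (simp add: \<tau>_def)
    then have "(norm (snd a))\<^sup>2 < (fst a + \<tau>)\<^sup>2" by (intro power_strict_mono) auto
    then show ?thesis
      unfolding power2_norm_eq_inner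
      by (simp add: timelike_def mink_prod_def v1_def power2_eq_square algebra_simps)
  qed
  then obtain b s where b: "fst b > 0" "mink_prod b b = 1" "- a - v1 = s *\<^sub>R b"
    using timelike_direction by blast
  \<comment> \<open>With b of Minkowski square 1, v1 + t b has square \<tau>^2 + 2 t \<tau> fst b +
    t^2, which is positive once |t| * 2 * fst b < \<tau>.\<close>
  define \<epsilon> where "\<epsilon> = \<tau> / (2 * fst b)"
  have \<epsilon>: "\<epsilon> > 0" using \<tau> b(1) by (simp add: \<epsilon>_def)
  have tl: "timelike (v1 + t *\<^sub>R b)" if t: "\<bar>t\<bar> < \<epsilon>" for t
  proof -
    have "\<bar>t\<bar> * (2 * fst b) < \<tau>" using t b(1) by (simp add: \<epsilon>_def pos_less_divide_eq)
    then have "- \<tau> < t * (2 * fst b)" using b(1) by (smt (verit) mult_minus_left mult_right_mono)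
    then have "0 < \<tau> * (\<tau> + t * (2 * fst b))" using \<tau> by (intro mult_pos_pos) auto
    moreover have "mink_prod (v1 + t *\<^sub>R b) (v1 + t *\<^sub>R b) = \<tau> * (\<tau> + t * (2 * fst b)) + t * t * mink_prod b b"
      by (simp add: mink_prod_def v1_def algebra_simps)
    ultimately show ?thesis using b(2) by (simp add: timelike_def add_pos_nonneg)
  qed
  \<comment> \<open>The open timelike cone covered by \<open>step1\<close> supplies the interval of
    vanishing for the second leg, which ends at s b = -a - v1.\<close>
  have near: "E \<Delta> (U (t *\<^sub>R b) (E (translate \<Delta> (a + v1)) (U (- (t *\<^sub>R b)) x))) = 0" if "\<bar>t\<bar> < \<epsilon>" for t x
    using step1[OF tl[OF that], of x] by (simp add: cov add.assoc)
  have "E \<Delta> (U (s *\<^sub>R b) (E (translate \<Delta> (a + v1)) (U (- (s *\<^sub>R b)) x))) = 0" for x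
    by (rule vanishing_direction[OF rep cont gen[OF b(1,2)] eff\<Delta> eff \<epsilon> near])
  then have "E \<Delta> (E (translate \<Delta> (a + v1 + s *\<^sub>R b)) x) = 0" for x by (simp only: cov)
  moreover have "a + v1 + s *\<^sub>R b = 0" unfolding b(3)[symmetric] by simp
  ultimately have "E \<Delta> (E \<Delta> x) = 0" for x by (simp only: \<Delta>0)
  \<comment> \<open>The square of the selfadjoint \<open>E \<Delta>\<close> is 0, so every E
    \<Delta> x has norm 0.\<close>
  then have "cinner (E \<Delta> x) (E \<Delta> x) = 0" for x
    by (simp add: effect_selfadjoint[OF eff\<Delta>])
  then show "E \<Delta> = (\<lambda>_. 0)" by (simp add: cinner_eq_zero fun_eq_iff)
qed

end
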